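(* Let $\Delta$ be a compact convex quadrilateral. (a) If $\Delta$ is a parallelogram, then for any affine normals $\mathbf{L}$, $(\Delta,\mathbf{L})$ is K-polystable. (b) If $\Delta$ is not a parallelogram, then there exist choices for the affine normals $\mathbf{L}$ such that $(\Delta,\mathbf{L})$ is K-polystable, as well as choices such that $(\Delta,\mathbf{L})$ is K-unstable.
   Context: Let $\Delta$ be a compact convex quadrilateral in a real affine plane $\Xi$ with facets (sides) $F_1,\dots,F_4$. Affine normals for $\Delta$ are a list $\mathbf{L}=(L_1,\dots,L_4)$ of affine functions on $\Xi$, such that $L_j$ vanishes on $F_j$ and is positive on the interior of $\Delta$; each $L_j$ is thus determined up to a positive scale. The inward normals are $u_j=dL_j$. (In the toric orbifold setting one also asks that $u_1,\dots,u_4$ lie in a common lattice.) Fix a translation invariant volume form $d\lambda$ on $\Xi$ and let $\nu$ be the positive measure on $\partial\Delta$ with $u_j\wedge d\nu=-d\lambda$ on $F_j$. The extremal affine function $\zeta$ of $(\Delta,\mathbf{L})$ is the unique affine function with $\int_\Delta\zeta A\,d\lambda=2\int_{\partial\Delta}A\,d\nu$ for all affine functions $A$. The relative Futaki invariant of a continuous function $f$ on $\Delta$ is $$\mathcal{F}_{\Delta,\mathbf{L}}(f)=\int_{\partial\Delta}f\,d\nu-\tfrac12\int_\Delta\zeta f\,d\lambda .$$ Let $\mathcal{PL}(\Delta)$ be the set of continuous convex piecewise-linear functions on $\Delta$ (maxima of finitely many affine functions). $(\Delta,\mathbf{L})$ is K-polystable if $\mathcal{F}_{\Delta,\mathbf{L}}(f)\ge0$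 for all $f\in\mathcal{PL}(\Delta)$ with equality iff $f$ is affine; it is K-unstable if $\mathcal{F}_{\Delta,\mathbf{L}}(f)<0$ for some $f\in\mathcal{PL}(\Delta)$. *)

theory Defs
  imports "HOL-Analysis.Analysis"
begin

text \<open>
  The affine plane is modelled by \<open>real^2\<close>. A translation invariant volume form is
  \<open>c dx\<^sub>1 \<and> dx\<^sub>2\<close> for a constant \<open>c\<close>; with the standard orientation \<open>c > 0\<close>.
  Functions on the polygon \<open>\<Delta>\<close> are total functions on the plane whose values off \<open>\<Delta>\<close> are
  ignored.
\<close>

definition affine_fun :: "(real^2 \<Rightarrow> real) \<Rightarrow> bool" where
  "affine_fun f \<longleftrightarrow> (\<exists>l b. linear l \<and> f = (\<lambda>x. l x + b))"

definition differential :: "(real^2 \<Rightarrow> real) \<Rightarrow> real^2 \<Rightarrow> real" where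
  "differential f v = f v - f 0" \<comment> \<open>meaningful for affine \<open>f\<close> only\<close>

definition convex_quadrilateral :: "(real^2) set \<Rightarrow> bool" where
  "convex_quadrilateral \<Delta> \<longleftrightarrow>
     polytope \<Delta> \<and> aff_dim \<Delta> = 2 \<and> card {F. F facet_of \<Delta>} = 4"

definition parallelogram :: "(real^2) set \<Rightarrow> bool" where
  "parallelogram \<Delta> \<longleftrightarrow>
     (\<exists>p v w. v \<noteq> w \<and> independent {v, w} \<and> \<Delta> = convex hull {p, p + v, p + v + w, p + w})"

text \<open>Affine normals are indexed by the facets themselves instead of by an enumeration of them.\<close>

definition affine_normals ::
    "(real^2) set \<Rightarrow> ((real^2) set \<Rightarrow> real^2 \<Rightarrow> real) \<Rightarrow> bool" where
  "affine_normals \<Delta> L \<longleftrightarrow>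
     (\<forall>F. F facet_of \<Delta> \<longrightarrow>
        affine_fun (L F) \<and> (\<forall>x\<in>F. L F x = 0) \<and> (\<forall>x\<in>interior \<Delta>. L F x > 0))"

definition volume_form :: "real \<Rightarrow> real^2 \<Rightarrow> real^2 \<Rightarrow> real" where
  "volume_form c x y = c * det (vector [x, y] :: real^2^2)"

definition volume_measure :: "real \<Rightarrow> (real^2) measure" where
  "volume_measure c = density lborel (\<lambda>_. ennreal c)"

definition wedge :: "(real^2 \<Rightarrow> real) \<Rightarrow> (real^2 \<Rightarrow> real) \<Rightarrow> real^2 \<Rightarrow> real^2 \<Rightarrow> real" where
  "wedge \<alpha> \<beta> x y = \<alpha> x * \<beta> y - \<alpha> y * \<beta> x"

text \<open>
  A constant 1-form \<open>\<alpha>\<close> with \<open>u \<and> \<alpha> = - d\<lambda>\<close>. It exists if \<open>u \<noteq> 0\<close> and is unique up to adding a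
  multiple of \<open>u\<close>, so its restriction to a line on which \<open>u\<close> is constant is unique up to an
  additive constant.
\<close>

definition conormal_form :: "real \<Rightarrow> (real^2 \<Rightarrow> real) \<Rightarrow> real^2 \<Rightarrow> real" where
  "conormal_form c u =
     (SOME \<alpha>. linear \<alpha> \<and> (\<forall>x y. wedge u \<alpha> x y = - volume_form c x y))"

text \<open>
  On a facet \<open>F\<close> with normal \<open>u\<close>, the form \<open>\<alpha>\<close> above is an injective coordinate whose differential
  is \<open>d\<nu>\<close>. Hence the positive measure \<open>\<nu>\<close> on \<open>F\<close> is Lebesgue measure in the coordinate \<open>\<alpha>\<close>.
\<close>

definition boundary_measure ::
    "real \<Rightarrow> (real^2) set \<Rightarrow> ((real^2) set \<Rightarrow> real^2 \<Rightarrow> real) \<Rightarrow> (real^2) measure" where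
  "boundary_measure c \<Delta> L =
     measure_of UNIV (sets borel)
       (\<lambda>A. \<Sum>F | F facet_of \<Delta>.
          emeasure lborel (conormal_form c (differential (L F)) ` (F \<inter> A)))"

definition extremal_affine ::
    "real \<Rightarrow> (real^2) set \<Rightarrow> ((real^2) set \<Rightarrow> real^2 \<Rightarrow> real) \<Rightarrow> real^2 \<Rightarrow> real" where
  "extremal_affine c \<Delta> L =
     (THE \<zeta>. affine_fun \<zeta> \<and>
        (\<forall>A. affine_fun A \<longrightarrow>
           (LINT x:\<Delta>|volume_measure c. \<zeta> x * A x) =
             2 * (LINT x:frontier \<Delta>|boundary_measure c \<Delta> L. A x)))"

definition futaki ::
    "real \<Rightarrow> (real^2) set \<Rightarrow> ((real^2) set \<Rightarrow> real^2 \<Rightarrow> real) \<Rightarrow> (real^2 \<Rightarrow> real) \<Rightarrow> real" where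
  "futaki c \<Delta> L f =
     (LINT x:frontier \<Delta>|boundary_measure c \<Delta> L. f x)
       - 1/2 * (LINT x:\<Delta>|volume_measure c. extremal_affine c \<Delta> L x * f x)"

definition PL :: "(real^2) set \<Rightarrow> (real^2 \<Rightarrow> real) set" where
  "PL \<Delta> = {f. \<exists>S. finite S \<and> S \<noteq> {} \<and> (\<forall>a\<in>S. affine_fun a) \<and>
                    (\<forall>x\<in>\<Delta>. f x = Max ((\<lambda>a. a x) ` S))}"

definition K_polystable ::
    "real \<Rightarrow> (real^2) set \<Rightarrow> ((real^2) set \<Rightarrow> real^2 \<Rightarrow> real) \<Rightarrow> bool" where
  "K_polystable c \<Delta> L \<longleftrightarrow>
     (\<forall>f\<in>PL \<Delta>. futaki c \<Delta> L f \<ge> 0 \<and>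
        (futaki c \<Delta> L f = 0 \<longleftrightarrow> (\<exists>a. affine_fun a \<and> (\<forall>x\<in>\<Delta>. f x = a x))))"

definition K_unstable ::
    "real \<Rightarrow> (real^2) set \<Rightarrow> ((real^2) set \<Rightarrow> real^2 \<Rightarrow> real) \<Rightarrow> bool" where
  "K_unstable c \<Delta> L \<longleftrightarrow> (\<exists>f\<in>PL \<Delta>. futaki c \<Delta> L f < 0)"

end

theory Submission
  imports Defs
begin

text \<open>
  On each side of the polygon the boundary measure is a multiple of the affine parameter measure; on
  the side with end points \<open>a\<close>, \<open>b\<close> and normal \<open>L\<close> the factor is \<open>c |det (a - P, b - P)| / |L P|\<close> for any
  point \<open>P\<close> off that side (\<open>LINT_boundary\<close>). Choosing affine normals is therefore the same as choosing
  positive densities on the sides (\<open>normals_with_density\<close>). The extremal affine function, and with it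
  the relative Futaki invariant, depends linearly on these densities.

  Stable normals exist on every polygon. Normalize the normals to take the value one at the
  barycenter \<open>P\<close>. In polar coordinates about \<open>P\<close> the area form becomes \<open>r dr d\<nu>\<close>. Integrating affine
  functions along the rays shows that the extremal function is the constant 4, and convexity along
  the rays gives \<open>3 F(f) \<ge> \<integral> f d\<nu> - f(P) \<nu>(\<partial>\<Delta>)\<close>. The right-hand side is nonnegative because \<open>P\<close> is also
  the barycenter of \<open>\<nu>\<close> and \<open>f\<close> lies above an affine function that agrees with it at \<open>P\<close>; if it
  vanishes, then \<open>f\<close> equals that affine function on the boundary, hence everywhere
  (\<open>K_polystable_normals_exist\<close>).

  On a parallelogram use coordinates in which it is the unit square. The extremal function is then a
  function of one coordinate plus a function of the other, and \<open>F\<close> is a sum of one term per side. The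
  term of the side \<open>s = 0\<close> is the integral over \<open>t\<close> of \<open>g 0 - \<integral> (4 - 6 s) g s ds\<close>, where \<open>g\<close> is the
  restriction of \<open>f\<close> to a coordinate line. The weight \<open>4 - 6 s\<close> reproduces the value at 0 of affine
  functions and changes sign only at 2/3; comparing \<open>g\<close> with its chord through 0 and 2/3 shows that
  the term is nonnegative and that it vanishes only for affine \<open>g\<close> (\<open>endpoint_defect_convex\<close>). If \<open>F\<close>
  vanishes, then \<open>f\<close> is affine in each coordinate, and convexity on the two diagonals removes the
  mixed term (\<open>parallelogram_K_polystable\<close>).

  For instability put all the boundary mass on one side \<open>E\<close>; adding a small multiple of the
  densities of the stable normals makes every density positive and, by linearity, does not spoil a
  negative value of \<open>F\<close>. Let \<open>G\<close> be a side adjacent to \<open>E\<close>, and let \<open>f\<close> be the crease function that is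
  positive on a thin strip along \<open>G\<close>, of widths \<open>\<epsilon> x\<close> and \<open>\<epsilon> y\<close> at the two ends of \<open>G\<close>. Then
  \<open>F(f) = \<epsilon>\<^sup>2 (Q(x, y) + O(\<epsilon>))\<close> for a quadratic form \<open>Q\<close> whose coefficients involve only the values of
  the extremal function at the ends of \<open>G\<close>. If \<open>G\<close> and \<open>E\<close> are the unit segments of the coordinate
  axes and \<open>(p, q)\<close> is the fourth vertex, the discriminant of \<open>Q\<close> is a positive multiple of
  \<open>(p - 1)\<^sup>2\<close> (\<open>side_discriminant\<close>). Hence \<open>Q\<close> takes negative values as soon as \<open>E\<close> is not parallel to
  the opposite side, and since its mixed coefficient is negative, it does so at some \<open>x, y > 0\<close>
  (\<open>destabilizing_crease\<close>).
\<close>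

section \<open>Integration in an affine frame\<close>

definition det2 :: "real^2 \<Rightarrow> real^2 \<Rightarrow> real" where
  "det2 x y = x$1 * y$2 - x$2 * y$1"

lemma continuous_on_vector2:
  "continuous_on S (\<lambda>z. vector [fst z, snd z] :: real^2)"
proof -
  have *: "(\<lambda>z. vector [fst z, snd z] :: real^2) = (\<lambda>z. fst z *\<^sub>R axis 1 1 + snd z *\<^sub>R axis 2 1)"
    by (auto simp: vec_eq_iff forall_2 axis_def)
  show ?thesis unfolding * by (intro continuous_intros)
qed

lemma lborel_vec2: "(lborel :: (real^2) measure) = distr lborel borel (\<lambda>z. vector [fst z, snd z])"
proof (rule lborel_eqI)
  have meas: "(\<lambda>z. vector [fst z, snd z] :: real^2) \<in> borel_measurable borel"
    by (intro borel_measurable_continuous_onI continuous_on_vector2)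
  fix l u :: "real^2" assume le: "\<And>b. b \<in> Basis \<Longrightarrow> l \<bullet> b \<le> u \<bullet> b"
  have le1: "l$1 \<le> u$1" "l$2 \<le> u$2"
    using le[of "axis 1 1"] le[of "axis 2 1"] by (auto simp: Basis_vec_def inner_axis)
  have "emeasure (distr lborel borel (\<lambda>z. vector [fst z, snd z])) (box l u)
      = emeasure lborel ((\<lambda>z. vector [fst z, snd z]) -` box l u)"
    using meas by (subst emeasure_distr) auto
  also have "(\<lambda>z. vector [fst z, snd z]) -` box l u = box (l$1, l$2) (u$1, u$2)"
    by (auto simp: mem_box_cart forall_2 mem_box Basis_prod_def)
  also have "emeasure lborel \<dots> = ennreal ((u$1 - l$1) * (u$2 - l$2))"
    using le1 by (subst emeasure_lborel_box) (auto simp: Basis_prod_def prod.union_disjoint)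
  also have "\<dots> = (\<Prod>b\<in>Basis. (u - l) \<bullet> b)"
    by (simp add: Basis_vec_def UNIV_2 inner_axis axis_eq_axis mult.commute)
  finally show "emeasure (distr lborel borel (\<lambda>z. vector [fst z, snd z])) (box l u)
      = (\<Prod>b\<in>Basis. (u - l) \<bullet> b)" .
qed simp

text \<open>
  A linear change of variables on \<open>real^2\<close> reduces this to the standard frame; \<open>lborel_vec2\<close> then
  carries the integral to \<open>real \<times> real\<close>, where Fubini's theorem applies.
\<close>

lemma integral_frame_iterated:
  fixes G :: "real^2 \<Rightarrow> real"
  assumes G: "integrable lborel G" and d: "det2 v w \<noteq> 0"
  shows "integral\<^sup>L lborel G =
    \<bar>det2 v w\<bar> * (\<integral>s. (\<integral>t. G (p + s *\<^sub>R v + t *\<^sub>R w) \<partial>lborel) \<partial>lborel)"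
proof -
  define H where "H x = G (p + x)" for x
  define g where "g x = x$1 *\<^sub>R v + x$2 *\<^sub>R w" for x :: "real^2"
  have GH: "integral\<^sup>L lborel G = integral\<^sup>L lborel H"
    unfolding H_def by (subst lborel_distr_plus[of p, symmetric], subst integral_distr)
      (use G in auto)
  have H: "integrable lborel H"
  proof -
    have "integrable (distr lborel borel ((+) p)) G" using G by (simp add: lborel_distr_plus)
    then show ?thesis unfolding H_def using G by (subst (asm) integrable_distr_eq) auto
  qed
  have lin: "linear g"
    unfolding g_def by (rule linearI) (auto simp: algebra_simps)
  have dm: "det (matrix g) = det2 v w"
    by (simp add: det_2 matrix_def g_def axis_def det2_def)
  have contg: "continuous_on UNIV g"
    unfolding g_def by (intro continuous_intros)
  have ran: "g ` UNIV = UNIV"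
    using lin d dm by (metis det_nz_iff_inj linear_injective_imp_surjective)
  have Habs: "H absolutely_integrable_on UNIV"
    using H by (simp add: set_integrable_def integrable_completion)
  have Hm: "H \<in> borel_measurable borel" using H by auto
  have Hgm: "H \<circ> g \<in> borel_measurable borel"
    by (rule measurable_comp[OF _ Hm]) (rule borel_measurable_continuous_onI[OF contg])
  define K where "K x = H x *\<^sub>R (axis 1 1 :: real^1)" for x
  have K1: "K x $ 1 = H x" for x by (simp add: K_def axis_def)
  have Kabs: "K absolutely_integrable_on UNIV"
    using absolutely_integrable_linear[OF Habs bounded_linear_scaleR_left[of "axis 1 1 :: real^1"]]
    by (simp add: K_def[abs_def] o_def)
  have Kgabs: "(K \<circ> g) absolutely_integrable_on UNIV"
    using absolutely_integrable_on_linear_image[OF lin, where f=K and S=UNIV] Kabs ran dm d by simp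
  have Hgabs: "(H \<circ> g) absolutely_integrable_on UNIV"
    using absolutely_integrable_linear[OF Kgabs bounded_linear_vec_nth[of 1]]
    by (simp add: o_def K1)
  have Hg: "integrable lborel (H \<circ> g)"
    using Hgabs Hgm by (simp add: set_integrable_def integrable_completion o_def)
  have "integral UNIV K $ 1 = \<bar>det2 v w\<bar> * (integral UNIV (K \<circ> g) $ 1)"
    using integral_change_of_variables_linear[OF lin, where f=K and S=UNIV] Kabs ran dm by simp
  then have "integral UNIV H = \<bar>det2 v w\<bar> * integral UNIV (H \<circ> g)"
    using integral_component_eq_cart[of K UNIV 1] integral_component_eq_cart[of "K \<circ> g" UNIV 1] Kabs Kgabs
    by (simp add: set_lebesgue_integral_eq_integral(1) K1 o_def)
  then have 1: "integral\<^sup>L lborel H = \<bar>det2 v w\<bar> * integral\<^sup>L lborel (H \<circ> g)"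
    using H Hg by (simp add: integral_lborel o_def)
  have vm: "(\<lambda>z. vector [fst z, snd z] :: real^2) \<in> measurable lborel borel"
    by (simp add: borel_measurable_continuous_onI continuous_on_vector2)
  have int2: "integrable lborel (\<lambda>z::real\<times>real. (H \<circ> g) (vector [fst z, snd z]))"
    using Hg vm Hgm by (subst (asm) lborel_vec2) (simp add: integrable_distr_eq)
  have "integral\<^sup>L lborel (H \<circ> g) = (\<integral>z. (H \<circ> g) (vector [fst z, snd z]) \<partial>(lborel::(real\<times>real) measure))"
    using vm Hgm by (subst lborel_vec2) (simp add: integral_distr)
  also have "\<dots> = (\<integral>s. (\<integral>t. (H \<circ> g) (vector [s, t]) \<partial>lborel) \<partial>lborel)"
    using lborel_pair.integral_fst'[of "\<lambda>z. (H \<circ> g) (vector [fst z, snd z])"] int2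
    by (simp add: lborel_prod)
  finally show ?thesis
    using GH 1 by (simp add: H_def g_def add.assoc)
qed

lemma det2_simps:
  "det2 (x + y) z = det2 x z + det2 y z" "det2 z (x + y) = det2 z x + det2 z y"
  "det2 (x - y) z = det2 x z - det2 y z" "det2 z (x - y) = det2 z x - det2 z y"
  "det2 (k *\<^sub>R x) z = k * det2 x z" "det2 z (k *\<^sub>R x) = k * det2 z x"
  "det2 (- x) z = - det2 x z" "det2 z (- x) = - det2 z x"
  "det2 x x = 0" "det2 0 x = 0" "det2 x 0 = 0"
  by (simp_all add: det2_def algebra_simps)

lemma det2_swap: "det2 y x = - det2 x y"
  by (simp add: det2_def)

lemma frame_coordinates:
  assumes "det2 v w \<noteq> 0"
  shows "x = p + (det2 (x - p) w / det2 v w) *\<^sub>R v + (det2 v (x - p) / det2 v w) *\<^sub>R w"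
proof -
  have "det2 v w *\<^sub>R (x - p) = det2 (x - p) w *\<^sub>R v + det2 v (x - p) *\<^sub>R w"
    by (simp add: vec_eq_iff forall_2 det2_def algebra_simps)
  then have "x - p = (1 / det2 v w) *\<^sub>R (det2 (x - p) w *\<^sub>R v + det2 v (x - p) *\<^sub>R w)"
    using assms by (metis divide_inverse mult_1 real_vector.scale_left_imp_eq scaleR_scaleR 
      left_inverse scaleR_one)
  then show ?thesis by (simp add: scaleR_add_right algebra_simps)
qed

lemma in_triangle_frame:
  assumes d: "det2 (a - P) (b - P) \<noteq> 0"
  shows "P + s *\<^sub>R (a - P) + t *\<^sub>R (b - a) \<in> convex hull {P, a, b} \<longleftrightarrow> 0 \<le> t \<and> t \<le> s \<and> s \<le> 1"
    (is "?x \<in> _ \<longleftrightarrow> _")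
proof
  assume "?x \<in> convex hull {P, a, b}"
  then obtain u v w where uvw: "0 \<le> u" "0 \<le> v" "0 \<le> w" "u + v + w = 1"
    and x: "?x = u *\<^sub>R P + v *\<^sub>R a + w *\<^sub>R b"
    by (auto simp: convex_hull_3)
  have u: "u = 1 - v - w" using uvw by simp
  have "?x - P = v *\<^sub>R (a - P) + w *\<^sub>R (b - P)"
    unfolding x u by (simp add: algebra_simps)
  moreover have "?x - P = (s - t) *\<^sub>R (a - P) + t *\<^sub>R (b - P)" by (simp add: algebra_simps)
  ultimately have e: "v *\<^sub>R (a - P) + w *\<^sub>R (b - P) = (s - t) *\<^sub>R (a - P) + t *\<^sub>R (b - P)" by simp
  have "v * det2 (a - P) (b - P) = (s - t) * det2 (a - P) (b - P)"
    using arg_cong[OF e, of "\<lambda>z. det2 z (b - P)"] unfolding det2_simps(1,5,9) by simp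
  moreover have "w * det2 (a - P) (b - P) = t * det2 (a - P) (b - P)"
    using arg_cong[OF e, of "\<lambda>z. det2 (a - P) z"] unfolding det2_simps(2,6,9) by simp
  ultimately show "0 \<le> t \<and> t \<le> s \<and> s \<le> 1" using d uvw by auto
next
  assume "0 \<le> t \<and> t \<le> s \<and> s \<le> 1"
  moreover have "?x = (1 - s) *\<^sub>R P + (s - t) *\<^sub>R a + t *\<^sub>R b" by (simp add: algebra_simps)
  ultimately show "?x \<in> convex hull {P, a, b}" unfolding convex_hull_3
    by (intro CollectI exI[of _ "1 - s"] exI[of _ "s - t"] exI[of _ t]) auto
qed

lemma LINT_interval_eq_integral:
  fixes f :: "real \<Rightarrow> real"
  assumes "continuous_on {a..b} f"
  shows "(\<integral>x. indicator {a..b} x * f x \<partial>lborel) = integral {a..b} f"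
  using set_borel_integral_eq_integral(2)[OF borel_integrable_atLeastAtMost'[OF assms]]
  by (simp add: set_lebesgue_integral_def)

text \<open>
  Polar coordinates with center \<open>P\<close>: substituting \<open>s t\<close> for the second frame coordinate turns the
  triangle into the unit square and produces the factor \<open>s\<close>. This is the form in which convexity along
  rays from \<open>P\<close> can be used. In the degenerate case both sides vanish.
\<close>

lemma LINT_triangle:
  fixes g :: "real^2 \<Rightarrow> real"
  assumes g: "continuous_on (convex hull {P, a, b}) g"
  shows "(LINT x:convex hull {P, a, b}|lborel. g x) = \<bar>det2 (a - P) (b - P)\<bar> *
     integral {0..1} (\<lambda>s. s * integral {0..1} (\<lambda>t. g (P + s *\<^sub>R (linepath a b t - P))))"
proof (cases "det2 (a - P) (b - P) = 0")
  case True
  have cp: "compact (convex hull {P, a, b})"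
    by (simp add: finite_imp_compact_convex_hull)
  have "measure lborel (convex hull {P, a, b}) = 0"
    using True unfolding content_triangle det2_def by (simp add: algebra_simps)
  moreover have "emeasure lborel (convex hull {P, a, b}) \<noteq> \<infinity>"
    using emeasure_compact_finite[OF cp] by simp
  ultimately have "convex hull {P, a, b} \<in> null_sets lborel"
    using cp by (intro null_setsI) (auto simp: emeasure_eq_ennreal_measure compact_imp_closed)
  then have "AE x in lborel. x \<notin> convex hull {P, a, b}"
    by (rule AE_not_in)
  then have "AE x in lborel. indicator (convex hull {P, a, b}) x *\<^sub>R g x = 0"
    by (rule eventually_mono) simp
  then have "(LINT x:convex hull {P, a, b}|lborel. g x) = 0"
    unfolding set_lebesgue_integral_def by (rule integral_eq_zero_AE)
  with True show ?thesis by simp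
next
  case d: False
  define T where "T = convex hull {P, a, b}"
  define v w where "v = a - P" and "w = b - a"
  have dvw: "det2 v w = det2 (a - P) (b - P)"
    by (simp add: v_def w_def det2_def algebra_simps)
  define F where "F = (\<lambda>s t. indicator T (P + s *\<^sub>R v + t *\<^sub>R w) * g (P + s *\<^sub>R v + t *\<^sub>R w))"
  have inT: "P + s *\<^sub>R v + t *\<^sub>R w \<in> T \<longleftrightarrow> 0 \<le> t \<and> t \<le> s \<and> s \<le> 1" for s t
    unfolding T_def v_def w_def by (rule in_triangle_frame[OF d])
  define h where "h s t = g (P + s *\<^sub>R (linepath a b t - P))" for s t
  have hpt: "P + s *\<^sub>R (linepath a b t - P) = P + s *\<^sub>R v + (s * t) *\<^sub>R w" for s t
    by (simp add: linepath_def v_def w_def algebra_simps)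
  have hT: "P + s *\<^sub>R (linepath a b t - P) \<in> T" if "s \<in> {0..1}" "t \<in> {0..1}" for s t
    unfolding hpt inT using that by (auto intro: mult_left_le)
  have cont: "continuous_on ({0..1} \<times> cbox 0 1) (\<lambda>(s, t). h s t)"
    unfolding h_def split_beta linepath_def
    by (intro continuous_on_compose2[OF g[folded T_def]] continuous_intros)
       (use hT in \<open>auto simp: linepath_def\<close>)
  have ch: "continuous_on {0..1} (h s)" if "s \<in> {0..1}" for s
  proof -
    have "continuous_on {0..1} (\<lambda>t. (\<lambda>(s, t). h s t) (s, t))"
      by (rule continuous_on_compose2[OF cont]) (use that in \<open>auto intro!: continuous_intros\<close>)
    then show ?thesis by simp
  qed
  have "integrable lborel (\<lambda>x. indicator T x *\<^sub>R g x)"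
    by (rule borel_integrable_compact) (use g in \<open>auto simp: T_def finite_imp_compact_convex_hull\<close>)
  then have "(LINT x:T|lborel. g x) = \<bar>det2 v w\<bar> * (\<integral>s. (\<integral>t. F s t \<partial>lborel) \<partial>lborel)"
    unfolding set_lebesgue_integral_def
    by (subst integral_frame_iterated[where v=v and w=w and p=P]) (use d dvw in \<open>auto simp: F_def\<close>)
  also have "(\<lambda>s. (\<integral>t. F s t \<partial>lborel)) = (\<lambda>s. indicator {0..1} s * (s * integral {0..1} (h s)))"
  proof
    fix s :: real
    show "(\<integral>t. F s t \<partial>lborel) = indicator {0..1} s * (s * integral {0..1} (h s))"
    proof (cases "s = 0")
      case True
      have "F s = (\<lambda>t. indicator {0} t * g P)"
        using True by (auto simp: F_def inT fun_eq_iff indicator_def)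
      then show ?thesis using True by simp
    next
      case False
      have "(\<integral>t. F s t \<partial>lborel) = \<bar>s\<bar> * (\<integral>t. F s (0 + s * t) \<partial>lborel)"
        using lborel_integral_real_affine[OF False, of "F s" 0] by simp
      also have "\<dots> = \<bar>s\<bar> * (indicator {0..1} s * (\<integral>t. indicator {0..1} t * h s t \<partial>lborel))"
      proof -
        have "F s (0 + s * t) = indicator {0..1} s * (indicator {0..1} t * h s t)" for t
          using False unfolding F_def inT h_def hpt indicator_def
          by (auto simp: zero_le_mult_iff mult_le_cancel_left1)
        then show ?thesis by simp
      qed
      also have "\<dots> = indicator {0..1} s * (s * integral {0..1} (h s))"
        using ch[of s] LINT_interval_eq_integral[of 0 1 "h s"] by (cases "s \<in> {0..1}") (auto simp: mult.left_commute)
      finally show ?thesis .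
    qed
  qed
  also have "(\<integral>s. indicator {0..1} s * (s * integral {0..1} (h s)) \<partial>lborel)
     = integral {0..1} (\<lambda>s. s * integral {0..1} (h s))"
    using integral_continuous_on_param[OF cont]
    by (intro LINT_interval_eq_integral continuous_intros) auto
  finally show ?thesis by (simp add: dvw T_def h_def[abs_def])
qed

section \<open>The boundary measure\<close>

text \<open>
  The boundary measure is a finite sum of measures, one for each side, but it is given only through
  its values on sets. The additivity passes from sets to functions by the usual induction.
\<close>

lemma nn_integral_sum_measure:
  assumes I: "finite I" and sets: "\<And>i. i \<in> I \<Longrightarrow> sets (N i) = sets M"
    and em: "\<And>A. A \<in> sets M \<Longrightarrow> emeasure M A = (\<Sum>i\<in>I. emeasure (N i) A)"
    and f: "f \<in> borel_measurable M"
  shows "nn_integral M f = (\<Sum>i\<in>I. nn_integral (N i) f)"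
  using f
proof (induction rule: borel_measurable_induct)
  case (cong f g)
  have "space (N i) = space M" if "i \<in> I" for i
    using sets[OF that] by (rule sets_eq_imp_space_eq)
  then have "nn_integral (N i) f = nn_integral (N i) g" if "i \<in> I" for i
    using that cong by (intro nn_integral_cong) auto
  moreover have "nn_integral M f = nn_integral M g"
    using cong by (intro nn_integral_cong) auto
  ultimately show ?case using cong by simp
next
  case (set A)
  then show ?case using sets by (simp add: em)
next
  case (mult u c)
  have "u \<in> borel_measurable (N i)" if "i \<in> I" for i
    using mult(2) measurable_cong_sets[OF sets[OF that] refl] by blast
  then show ?case using mult by (simp add: nn_integral_cmult sum_distrib_left)
next
  case (add u v)
  have "u \<in> borel_measurable (N i)" "v \<in> borel_measurable (N i)" if "i \<in> I" for i
    using add measurable_cong_sets[OF sets[OF that] refl] by blast+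
  then show ?case using add by (simp add: nn_integral_add sum.distrib)
next
  case (seq U)
  have m: "U j \<in> borel_measurable (N i)" if "i \<in> I" for i j
    using seq measurable_cong_sets[OF sets[OF that] refl] by blast
  have "nn_integral M (SUP j. U j) = (SUP j. nn_integral M (U j))"
    unfolding SUP_apply[abs_def] using seq by (intro nn_integral_monotone_convergence_SUP) auto
  also have "\<dots> = (SUP j. \<Sum>i\<in>I. nn_integral (N i) (U j))"
    using seq by simp
  also have "\<dots> = (\<Sum>i\<in>I. SUP j. nn_integral (N i) (U j))"
    using seq by (intro ennreal_SUP_sum) (auto simp: incseq_def le_fun_def intro!: nn_integral_mono)
  also have "\<dots> = (\<Sum>i\<in>I. nn_integral (N i) (SUP j. U j))"
    unfolding SUP_apply[abs_def] using seq m
    by (intro sum.cong refl nn_integral_monotone_convergence_SUP[symmetric]) auto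
  finally show ?case .
qed

lemma integral_sum_measure:
  fixes f :: "'a \<Rightarrow> real"
  assumes I: "finite I" and sets: "\<And>i. i \<in> I \<Longrightarrow> sets (N i) = sets M"
    and em: "\<And>A. A \<in> sets M \<Longrightarrow> emeasure M A = (\<Sum>i\<in>I. emeasure (N i) A)"
    and fm: "f \<in> borel_measurable M" and f: "\<And>i. i \<in> I \<Longrightarrow> integrable (N i) f"
  shows "integral\<^sup>L M f = (\<Sum>i\<in>I. integral\<^sup>L (N i) f)"
proof -
  note nn = nn_integral_sum_measure[OF I sets em]
  have fin: "(\<integral>\<^sup>+x. ennreal (f x) \<partial>N i) < \<infinity>" "(\<integral>\<^sup>+x. ennreal (- f x) \<partial>N i) < \<infinity>" if "i \<in> I" for i
    using f[OF that] by (auto elim!: integrableE simp: less_top)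
  have "(\<integral>\<^sup>+x. ennreal (norm (f x)) \<partial>M) < \<infinity>"
    using f fm by (subst nn) (auto simp: integrable_iff_bounded I less_top)
  then have "integrable M f" using fm by (simp add: integrable_iff_bounded)
  then have "integral\<^sup>L M f = enn2real (\<integral>\<^sup>+x. ennreal (f x) \<partial>M) - enn2real (\<integral>\<^sup>+x. ennreal (- f x) \<partial>M)"
    by (rule real_lebesgue_integral_def)
  also have "\<dots> = (\<Sum>i\<in>I. enn2real (\<integral>\<^sup>+x. ennreal (f x) \<partial>N i) - enn2real (\<integral>\<^sup>+x. ennreal (- f x) \<partial>N i))"
    using fm fin I by (simp add: nn enn2real_sum sum_subtractf)
  also have "\<dots> = (\<Sum>i\<in>I. integral\<^sup>L (N i) f)"
    using f by (simp add: real_lebesgue_integral_def)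
  finally show ?thesis .
qed

text \<open>
  The form is determined only up to multiples of the differential of \<open>l\<close>, which vanishes along the
  line \<open>l = 0\<close>. Evaluating the wedge condition on \<open>b - a\<close> and \<open>P - a\<close> therefore gives its increment
  along that line.
\<close>

lemma conormal_form_properties:
  fixes c :: real
  assumes l: "affine_fun l" "l a = 0" "l b = 0" and P: "l P \<noteq> 0"
  defines "\<alpha> \<equiv> conormal_form c (differential l)"
  shows "linear \<alpha>" "\<alpha> b - \<alpha> a = c * det2 (a - P) (b - P) / l P"
proof -
  obtain u k where u: "linear u" "l = (\<lambda>x. u x + k)"
    using l(1) by (auto simp: affine_fun_def)
  have du: "differential l = u"
    using u by (auto simp: differential_def fun_eq_iff linear_0)
  define u1 u2 where "u1 = u (axis 1 1)" and "u2 = u (axis 2 1)"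
  have ux: "u x = x$1 * u1 + x$2 * u2" for x
  proof -
    have "x = x$1 *\<^sub>R axis 1 1 + x$2 *\<^sub>R axis 2 1"
      by (auto simp: vec_eq_iff forall_2 axis_def)
    then have "u x = u (x$1 *\<^sub>R axis 1 1 + x$2 *\<^sub>R axis 2 1)" by simp
    then show ?thesis using u(1) by (simp add: linear_add linear_scale u1_def u2_def)
  qed
  have "u (P - a) = l P" using l(2) u by (simp add: linear_diff)
  then have "u1 \<noteq> 0 \<or> u2 \<noteq> 0" using P by (auto simp: ux)
  then have n: "u1\<^sup>2 + u2\<^sup>2 \<noteq> 0" by (simp add: sum_power2_eq_zero_iff)
  define \<beta> where "\<beta> x = c * (u2 * x$1 - u1 * x$2) / (u1\<^sup>2 + u2\<^sup>2)" for x :: "real^2"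
  have "linear \<beta>"
    unfolding \<beta>_def by (rule linearI) (auto simp: algebra_simps add_divide_distrib diff_divide_distrib)
  moreover have "wedge u \<beta> x y = - volume_form c x y" for x y
  proof -
    define n where "n = u1\<^sup>2 + u2\<^sup>2"
    have \<beta>n: "\<beta> z * n = c * (u2 * z$1 - u1 * z$2)" for z
      using n by (simp add: \<beta>_def n_def)
    have "wedge u \<beta> x y * n = u x * (\<beta> y * n) - u y * (\<beta> x * n)"
      by (simp add: wedge_def algebra_simps)
    also have "\<dots> = - volume_form c x y * n"
      by (simp only: \<beta>n) (simp add: ux volume_form_def det_2 n_def power2_eq_square algebra_simps)
    finally have "wedge u \<beta> x y * n = - volume_form c x y * n" .
    moreover have n0: "n \<noteq> 0" using n by (simp add: n_def)
    ultimately show ?thesis by (rule_tac iffD1[OF mult_right_cancel[OF n0]])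
  qed
  ultimately have ex: "\<exists>\<beta>. linear \<beta> \<and> (\<forall>x y. wedge u \<beta> x y = - volume_form c x y)" by blast
  have "linear \<alpha> \<and> (\<forall>x y. wedge u \<alpha> x y = - volume_form c x y)"
    unfolding \<alpha>_def conormal_form_def du by (rule someI_ex[OF ex])
  then have \<alpha>: "linear \<alpha>" "\<And>x y. wedge u \<alpha> x y = - volume_form c x y" by blast+
  show "linear \<alpha>" by fact
  have "u (b - a) = 0" using l(2,3) u by (simp add: linear_diff)
  then have "l P * \<alpha> (b - a) = c * det2 (b - a) (P - a)"
    using \<alpha>(2)[of "b - a" "P - a"] \<open>u (P - a) = l P\<close>
    by (simp add: wedge_def volume_form_def det_2 det2_def)
  also have "det2 (b - a) (P - a) = det2 (a - P) (b - P)"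
    by (simp add: det2_def algebra_simps)
  finally show "\<alpha> b - \<alpha> a = c * det2 (a - P) (b - P) / l P"
    using P \<alpha>(1) by (simp add: field_simps linear_diff)
qed

definition segment_mean :: "real^2 \<Rightarrow> real^2 \<Rightarrow> (real^2 \<Rightarrow> real) \<Rightarrow> real" where
  "segment_mean a b f = integral {0..1} (\<lambda>t. f (linepath a b t))"

definition segment_measure :: "real \<Rightarrow> real^2 \<Rightarrow> real^2 \<Rightarrow> (real^2) measure" where
  "segment_measure r a b =
     distr (density lborel (\<lambda>t. ennreal (r * indicator {0..1} t))) borel (linepath a b)"

lemma linepath_measurable [measurable]: "linepath a b \<in> borel_measurable borel"
  for a :: "'a::euclidean_space"
  unfolding linepath_def by measurable

lemma emeasure_segment_measure:
  assumes "A \<in> sets borel" "0 \<le> r"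
  shows "emeasure (segment_measure r a b) A = ennreal r * emeasure lborel ({0..1} \<inter> linepath a b -` A)"
proof -
  have m: "linepath a b -` A \<in> sets borel"
    using measurable_sets[OF linepath_measurable assms(1), of a b] by simp
  have "emeasure (segment_measure r a b) A
     = (\<integral>\<^sup>+t. ennreal (r * indicator {0..1} t) * indicator (linepath a b -` A) t \<partial>lborel)"
    using assms m unfolding segment_measure_def
    by (subst emeasure_distr) (auto simp: emeasure_density)
  also have "\<dots> = (\<integral>\<^sup>+t. ennreal r * indicator ({0..1} \<inter> linepath a b -` A) t \<partial>lborel)"
    by (intro nn_integral_cong) (auto simp: indicator_def)
  also have "\<dots> = ennreal r * emeasure lborel ({0..1} \<inter> linepath a b -` A)"
    using m by (simp add: nn_integral_cmult_indicator)
  finally show ?thesis .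
qed

text \<open>
  A linear function that separates the end points is an affine coordinate on the segment, with
  constant speed relative to the parameter of \<open>linepath\<close>.
\<close>

lemma emeasure_linear_image_segment:
  assumes \<alpha>: "linear \<alpha>" "\<alpha> b \<noteq> \<alpha> a" and A: "A \<in> sets borel"
  shows "emeasure lborel (\<alpha> ` (closed_segment a b \<inter> A)) = emeasure (segment_measure \<bar>\<alpha> b - \<alpha> a\<bar> a b) A"
proof -
  define k where "k = \<alpha> b - \<alpha> a"
  define T where "T = {0..1} \<inter> linepath a b -` A"
  have k: "k \<noteq> 0" using \<alpha> by (simp add: k_def)
  have T: "T \<in> sets borel"
    using measurable_sets[OF linepath_measurable A, of a b] by (simp add: T_def)
  have lin: "\<alpha> (linepath a b t) = \<alpha> a + k * t" for t
    unfolding linepath_def linear_add[OF \<alpha>(1)] linear_scale[OF \<alpha>(1)] k_def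
    by (simp add: algebra_simps)
  have img: "\<alpha> ` (closed_segment a b \<inter> A) = (\<lambda>t. \<alpha> a + k * t) ` T"
  proof -
    have "closed_segment a b \<inter> A = linepath a b ` T"
      unfolding path_image_linepath[symmetric] path_image_def T_def by blast
    then show ?thesis by (simp add: image_image lin)
  qed
  have "(\<lambda>t. \<alpha> a + k * t) ` T = (\<lambda>y. (y - \<alpha> a) / k) -` T"
  proof (intro equalityI subsetI)
    fix y assume "y \<in> (\<lambda>y. (y - \<alpha> a) / k) -` T"
    then show "y \<in> (\<lambda>t. \<alpha> a + k * t) ` T"
      using k by (intro image_eqI[of _ _ "(y - \<alpha> a) / k"]) auto
  qed (use k in auto)
  also have "\<dots> \<in> sets borel"
    using measurable_sets[OF _ T, of "\<lambda>y. (y - \<alpha> a) / k" borel] by simp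
  finally have S: "(\<lambda>t. \<alpha> a + k * t) ` T \<in> sets borel" .
  have pre: "(\<lambda>t. \<alpha> a + k * t) -` ((\<lambda>t. \<alpha> a + k * t) ` T) = T"
    using k by (intro inj_vimage_image_eq) (auto simp: inj_on_def)
  have "emeasure lborel ((\<lambda>t. \<alpha> a + k * t) ` T) = ennreal \<bar>k\<bar> * emeasure lborel T"
    using S T pre
    by (subst lborel_real_affine[OF k, of "\<alpha> a"]) (simp add: emeasure_density nn_integral_cmult_indicator emeasure_distr)
  then show ?thesis
    using A by (simp add: img emeasure_segment_measure T_def k_def)
qed

lemma integral_segment_measure:
  fixes f :: "real^2 \<Rightarrow> real"
  assumes S: "closed_segment a b \<subseteq> S" "compact S" and f: "continuous_on S f" and r: "0 \<le> r"
  shows "integrable (segment_measure r a b) (\<lambda>x. indicator S x * f x)"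
    "(\<integral>x. indicator S x * f x \<partial>segment_measure r a b) = r * segment_mean a b f"
proof -
  have fm: "(\<lambda>x. indicator S x * f x) \<in> borel_measurable borel"
    using borel_measurable_continuous_on_indicator[OF _ f] S(2) by (simp add: compact_imp_closed borel_closed)
  have lm: "linepath a b \<in> measurable (density lborel (\<lambda>t. ennreal (r * indicator {0..1} t))) borel"
    by simp
  have cont: "continuous_on {0..1} (\<lambda>t. f (linepath a b t))"
    by (intro continuous_on_compose2[OF f]) (use S path_image_linepath[of a b] in \<open>auto simp: path_image_def linepath_def intro!: continuous_intros\<close>)
  have in_S: "linepath a b t \<in> S" if "t \<in> {0..1}" for t
    using that S(1) path_image_linepath[of a b] by (auto simp: path_image_def)
  have eq: "(r * indicator {0..1} t) *\<^sub>R (indicator S (linepath a b t) * f (linepath a b t))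
     = r * (indicator {0..1} t * f (linepath a b t))" for t
    using in_S by (auto simp: indicator_def)
  have "integrable lborel (\<lambda>t. r * (indicator {0..1} t * f (linepath a b t)))"
    using borel_integrable_atLeastAtMost'[OF cont] by (simp add: set_integrable_def)
  then have "integrable (density lborel (\<lambda>t. ennreal (r * indicator {0..1} t))) (\<lambda>t. indicator S (linepath a b t) * f (linepath a b t))"
    using r fm by (subst integrable_density) (auto simp: eq[unfolded real_scaleR_def] measurable_compose[OF linepath_measurable fm])
  then show "integrable (segment_measure r a b) (\<lambda>x. indicator S x * f x)"
    unfolding segment_measure_def using fm lm by (subst integrable_distr_eq) auto
  have "(\<integral>x. indicator S x * f x \<partial>segment_measure r a b)
      = (\<integral>t. (r * indicator {0..1} t) *\<^sub>R (indicator S (linepath a b t) * f (linepath a b t)) \<partial>lborel)"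
    unfolding segment_measure_def integral_distr[OF lm fm]
  proof (rule integral_density)
    show "(\<lambda>t. indicator S (linepath a b t) * f (linepath a b t)) \<in> borel_measurable lborel"
      using measurable_compose[OF linepath_measurable fm, of a b] by simp
    show "(\<lambda>t::real. r * indicator {0..1} t) \<in> borel_measurable lborel" by simp
    show "AE t::real in lborel. 0 \<le> r * indicator {0..1} t" using r by (intro AE_I2) simp
  qed
  also have "\<dots> = r * segment_mean a b f"
    unfolding eq segment_mean_def using LINT_interval_eq_integral[OF cont] by simp
  finally show "(\<integral>x. indicator S x * f x \<partial>segment_measure r a b) = r * segment_mean a b f" .
qed

lemma sigma_sets_borel: "sigma_sets UNIV (sets (borel :: 'a::topological_space measure)) = sets borel"
  using sets.sigma_sets_eq[of "borel :: 'a measure"] by (simp only: space_borel)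

lemma sets_measure_of_borel: "sets (measure_of UNIV (sets (borel :: 'a::topological_space measure)) \<mu>) = sets borel"
  by (simp add: sets_measure_of_conv sigma_sets_borel)

text \<open>
  If \<open>a - P\<close> and \<open>b - P\<close> were dependent, \<open>P\<close> would lie on the line through \<open>a\<close> and \<open>b\<close>, where \<open>l\<close>
  vanishes.
\<close>

lemma det2_nonzero_off_line:
  assumes l: "affine_fun l" "l a = 0" "l b = 0" and P: "l P \<noteq> 0" and ab: "a \<noteq> b"
  shows "det2 (a - P) (b - P) \<noteq> 0"
proof
  assume d0: "det2 (a - P) (b - P) = 0"
  obtain u k where u: "linear u" "l = (\<lambda>x. u x + k)"
    using l(1) by (auto simp: affine_fun_def)
  have e: "det2 (b - P) z *\<^sub>R (a - P) - det2 (a - P) z *\<^sub>R (b - P) = - det2 (a - P) (b - P) *\<^sub>R z" for z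
    by (simp add: vec_eq_iff forall_2 det2_def algebra_simps)
  have uu: "u a - u P = - l P" "u b - u P = - l P"
    using l u by auto
  have "(det2 (a - P) z - det2 (b - P) z) * l P = 0" for z
  proof -
    have "u (det2 (b - P) z *\<^sub>R (a - P) - det2 (a - P) z *\<^sub>R (b - P)) = 0"
      using e[of z] d0 u(1) by (simp add: linear_0)
    then have "det2 (b - P) z * - l P - det2 (a - P) z * - l P = 0"
      by (simp only: linear_diff[OF u(1)] linear_scale[OF u(1)] uu real_scaleR_def)
    then show ?thesis by (simp add: algebra_simps)
  qed
  then have "det2 (a - b) z = 0" for z
    using P by (simp add: det2_simps)
  from this[of "axis 1 1"] this[of "axis 2 1"] have "a = b"
    by (simp add: det2_def axis_def vec_eq_iff forall_2)
  then show False using ab by simp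
qed

text \<open>
  The set function in the definition of the boundary measure is countably additive because it agrees
  on Borel sets with a finite sum of measures. Only then does \<open>measure_of\<close> return it.
\<close>

lemma emeasure_boundary_measure:
  fixes \<Delta> :: "(real^2) set"
  assumes c: "c > 0" and fin: "finite {F. F facet_of \<Delta>}"
    and seg: "\<And>F. F facet_of \<Delta> \<Longrightarrow> F = closed_segment (A F) (B F) \<and> A F \<noteq> B F"
    and L: "affine_normals \<Delta> L" and P: "\<And>F. F facet_of \<Delta> \<Longrightarrow> L F P \<noteq> 0"
    and X: "X \<in> sets borel"
  shows "emeasure (boundary_measure c \<Delta> L) X = (\<Sum>F | F facet_of \<Delta>.
     emeasure (segment_measure (c * \<bar>det2 (A F - P) (B F - P)\<bar> / \<bar>L F P\<bar>) (A F) (B F)) X)"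
proof -
  define \<alpha> where "\<alpha> F = conormal_form c (differential (L F))" for F
  define r where "r F = c * \<bar>det2 (A F - P) (B F - P)\<bar> / \<bar>L F P\<bar>" for F
  define \<mu> where "\<mu> X = (\<Sum>F | F facet_of \<Delta>. emeasure (segment_measure (r F) (A F) (B F)) X)" for X
  have part: "emeasure lborel (\<alpha> F ` (F \<inter> X)) = emeasure (segment_measure (r F) (A F) (B F)) X"
    if F: "F facet_of \<Delta>" and X: "X \<in> sets borel" for F X
  proof -
    have Fs: "F = closed_segment (A F) (B F)" "A F \<noteq> B F" using seg[OF F] by auto
    have "A F \<in> F" "B F \<in> F" using Fs by auto
    then have l: "affine_fun (L F)" "L F (A F) = 0" "L F (B F) = 0"
      using L F by (auto simp: affine_normals_def)
    note conorm = conormal_form_properties[OF l P[OF F], of c]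
    have "det2 (A F - P) (B F - P) \<noteq> 0"
      using det2_nonzero_off_line[OF l P[OF F] Fs(2)] .
    then have ne: "\<alpha> F (B F) \<noteq> \<alpha> F (A F)" and ab: "\<bar>\<alpha> F (B F) - \<alpha> F (A F)\<bar> = r F"
      using conorm(2) c P[OF F] by (auto simp: \<alpha>_def r_def abs_mult)
    have "emeasure lborel (\<alpha> F ` (closed_segment (A F) (B F) \<inter> X)) = emeasure (segment_measure (r F) (A F) (B F)) X"
      using emeasure_linear_image_segment[of "\<alpha> F" "B F" "A F" X] conorm(1) ne ab X by (simp add: \<alpha>_def)
    then show ?thesis using Fs(1) by simp
  qed
  have "boundary_measure c \<Delta> L = measure_of UNIV (sets borel) \<mu>"
    unfolding boundary_measure_def
  proof (rule measure_of_eq)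
    show "sets (borel :: (real^2) measure) \<subseteq> Pow UNIV" by simp
    fix X :: "(real^2) set" assume "X \<in> sigma_sets UNIV (sets borel)"
    then have "X \<in> sets borel" by (simp add: sigma_sets_borel)
    then show "(\<Sum>F | F facet_of \<Delta>. emeasure lborel (conormal_form c (differential (L F)) ` (F \<inter> X))) = \<mu> X"
      using part by (simp add: \<mu>_def \<alpha>_def)
  qed
  moreover have "emeasure (measure_of UNIV (sets borel) \<mu>) X = \<mu> X"
  proof (rule emeasure_measure_of[OF refl])
    show "sets (borel :: (real^2) measure) \<subseteq> Pow UNIV" by simp
    show "X \<in> sets (measure_of UNIV (sets borel) \<mu>)"
      using X by (simp add: sets_measure_of_borel)
    show "positive (sets (measure_of UNIV (sets borel) \<mu>)) \<mu>"
      by (simp add: positive_def \<mu>_def)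
    show "countably_additive (sets (measure_of UNIV (sets borel) \<mu>)) \<mu>"
    proof (rule countably_additiveI)
      fix D :: "nat \<Rightarrow> (real^2) set"
      assume D: "range D \<subseteq> sets (measure_of UNIV (sets borel) \<mu>)" "disjoint_family D"
      have Ds: "range D \<subseteq> sets (segment_measure (r F) (A F) (B F))" for F
        using D(1) by (simp add: segment_measure_def sets_measure_of_borel)
      have "(\<Sum>i. \<mu> (D i)) = (\<Sum>F | F facet_of \<Delta>. \<Sum>i. emeasure (segment_measure (r F) (A F) (B F)) (D i))"
        unfolding \<mu>_def by (intro suminf_sum) auto
      also have "\<dots> = \<mu> (\<Union>i. D i)"
        unfolding \<mu>_def using Ds D(2) by (intro sum.cong refl suminf_emeasure) auto
      finally show "(\<Sum>i. \<mu> (D i)) = \<mu> (\<Union>i. D i)" .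
    qed
  qed
  ultimately show ?thesis by (simp add: \<mu>_def r_def)
qed

lemma LINT_boundary_measure:
  fixes \<Delta> :: "(real^2) set"
  assumes c: "c > 0" and fin: "finite {F. F facet_of \<Delta>}"
    and seg: "\<And>F. F facet_of \<Delta> \<Longrightarrow> F = closed_segment (A F) (B F) \<and> A F \<noteq> B F"
    and L: "affine_normals \<Delta> L" and P: "\<And>F. F facet_of \<Delta> \<Longrightarrow> L F P \<noteq> 0"
    and fr: "frontier \<Delta> = \<Union>{F. F facet_of \<Delta>}" and bd: "bounded \<Delta>"
    and f: "continuous_on (frontier \<Delta>) f"
  shows "(LINT x:frontier \<Delta>|boundary_measure c \<Delta> L. f x) = (\<Sum>F | F facet_of \<Delta>.
     c * \<bar>det2 (A F - P) (B F - P)\<bar> / \<bar>L F P\<bar> * segment_mean (A F) (B F) f)"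
proof -
  define r where "r F = c * \<bar>det2 (A F - P) (B F - P)\<bar> / \<bar>L F P\<bar>" for F
  have r: "0 \<le> r F" for F using c by (simp add: r_def)
  have comp: "compact (frontier \<Delta>)" using bd by (rule compact_frontier_bounded)
  have sets: "sets (boundary_measure c \<Delta> L) = sets borel"
    by (simp add: boundary_measure_def sets_measure_of_borel)
  have sub: "closed_segment (A F) (B F) \<subseteq> frontier \<Delta>" if "F facet_of \<Delta>" for F
    using seg[OF that] fr that by auto
  have fm: "(\<lambda>x. indicator (frontier \<Delta>) x * f x) \<in> borel_measurable borel"
    using borel_measurable_continuous_on_indicator[OF _ f] comp by (simp add: compact_imp_closed borel_closed)
  have "(LINT x:frontier \<Delta>|boundary_measure c \<Delta> L. f x)
     = (\<integral>x. indicator (frontier \<Delta>) x * f x \<partial>boundary_measure c \<Delta> L)"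
    by (simp add: set_lebesgue_integral_def)
  also have "\<dots> = (\<Sum>F | F facet_of \<Delta>. \<integral>x. indicator (frontier \<Delta>) x * f x \<partial>segment_measure (r F) (A F) (B F))"
  proof (rule integral_sum_measure[OF fin])
    show "sets (segment_measure (r F) (A F) (B F)) = sets (boundary_measure c \<Delta> L)" for F
      by (simp add: sets segment_measure_def)
    show "emeasure (boundary_measure c \<Delta> L) X = (\<Sum>F | F facet_of \<Delta>. emeasure (segment_measure (r F) (A F) (B F)) X)"
      if "X \<in> sets (boundary_measure c \<Delta> L)" for X
      unfolding r_def by (rule emeasure_boundary_measure[OF c fin seg L P]) (use that sets in auto)
    show "(\<lambda>x. indicator (frontier \<Delta>) x * f x) \<in> borel_measurable (boundary_measure c \<Delta> L)"
      using fm measurable_cong_sets[OF sets refl] by blast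
    show "integrable (segment_measure (r F) (A F) (B F)) (\<lambda>x. indicator (frontier \<Delta>) x * f x)"
      if "F \<in> {F. F facet_of \<Delta>}" for F
      using integral_segment_measure(1)[OF sub comp f r] that by simp
  qed
  also have "\<dots> = (\<Sum>F | F facet_of \<Delta>. r F * segment_mean (A F) (B F) f)"
    using integral_segment_measure(2)[OF sub comp f r] by simp
  finally show ?thesis by (simp add: r_def)
qed

section \<open>Polygons and their fans\<close>

lemma compact_negligible_null_sets:
  fixes S :: "'a::euclidean_space set"
  assumes "closed S" "negligible S"
  shows "S \<in> null_sets lborel"
  using assms by (simp add: negligible_iff_null_sets null_sets_completion_iff borel_closed)

lemma closed_segment_null_sets: "closed_segment a b \<in> null_sets lborel"
  for a b :: "real^2"
proof -
  have "frontier (closed_segment a b) = closed_segment a b"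
    using interior_closed_segment_ge2[of a b] by (simp add: frontier_def)
  then have "negligible (closed_segment a b)"
    using negligible_convex_frontier[of "closed_segment a b"] by simp
  then show ?thesis by (intro compact_negligible_null_sets) auto
qed

text \<open>
  Everything up to the combinatorics of quadrilaterals holds for convex polygons with any number of
  sides.
\<close>

locale polygon =
  fixes \<Delta> :: "(real^2) set"
  assumes polytope: "polytope \<Delta>" and dim2: "aff_dim \<Delta> = 2"
begin

lemma compact: "compact \<Delta>" and convex: "convex \<Delta>" and closed: "closed \<Delta>" and bounded: "bounded \<Delta>"
  using polytope polytope_imp_compact polytope_imp_convex polytope_imp_closed polytope_imp_bounded by auto

lemma affine_hull_UNIV: "affine hull \<Delta> = UNIV"
  using dim2 aff_dim_eq_full[of \<Delta>] by simp

lemma interior_nonempty: "interior \<Delta> \<noteq> {}"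
proof -
  have "\<Delta> \<noteq> {}" using dim2 by auto
  then show ?thesis
    using rel_interior_interior[OF affine_hull_UNIV] rel_interior_eq_empty[OF convex] by simp
qed

lemma finite_facets: "finite {F. F facet_of \<Delta>}"
  using polytope by (rule finite_polytope_facets)

lemma frontier_eq: "frontier \<Delta> = \<Union>{F. F facet_of \<Delta>}"
  using rel_frontier_of_polyhedron[OF polytope_imp_polyhedron[OF polytope]]
    rel_frontier_frontier[OF affine_hull_UNIV] by simp

lemma facet_subset: "F facet_of \<Delta> \<Longrightarrow> F \<subseteq> \<Delta>"
  by (simp add: facet_of_imp_subset)

lemma facet_subset_frontier: "F facet_of \<Delta> \<Longrightarrow> F \<subseteq> frontier \<Delta>"
  using frontier_eq by auto

lemma aff_dim_facet: "F facet_of \<Delta> \<Longrightarrow> aff_dim F = 1"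
  using dim2 by (simp add: facet_of_def)

lemma facet_is_segment:
  assumes "F facet_of \<Delta>"
  shows "\<exists>a b. F = closed_segment a b \<and> a \<noteq> b"
proof -
  have "F face_of \<Delta>" "F \<noteq> {}" "aff_dim F = 1"
    using assms aff_dim_facet by (auto simp: facet_of_def)
  moreover have "polytope F" using \<open>F face_of \<Delta>\<close> polytope face_of_polytope_polytope by blast
  ultimately have "compact F" "convex F" "collinear F" "F \<noteq> {}" "aff_dim F = 1"
    using polytope_imp_compact polytope_imp_convex collinear_aff_dim[of F] by auto
  then obtain a b where "F = closed_segment a b"
    by (metis compact_convex_collinear_segment)
  moreover from this have "a \<noteq> b" using \<open>aff_dim F = 1\<close> by auto
  ultimately show ?thesis by blast
qed

text \<open>
  An arbitrary labelling of the end points of each side; integrals over a side do not depend on it.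
\<close>

definition endA :: "(real^2) set \<Rightarrow> real^2" where
  "endA F = (SOME a. \<exists>b. F = closed_segment a b \<and> a \<noteq> b)"
definition endB :: "(real^2) set \<Rightarrow> real^2" where
  "endB F = (SOME b. F = closed_segment (endA F) b \<and> endA F \<noteq> b)"

lemma facet_ends: "F = closed_segment (endA F) (endB F) \<and> endA F \<noteq> endB F" if "F facet_of \<Delta>"
proof -
  have "\<exists>b. F = closed_segment (endA F) b \<and> endA F \<noteq> b"
    unfolding endA_def by (rule someI_ex) (rule facet_is_segment[OF that])
  then show ?thesis unfolding endB_def by (rule someI_ex)
qed

text \<open>
  The intersection is a proper face of at least one of the two segments.
\<close>

lemma facets_Int:
  assumes F: "F facet_of \<Delta>" and G: "G facet_of \<Delta>" and "F \<noteq> G"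
  shows "\<exists>z. F \<inter> G \<subseteq> {z}"
proof -
  have fF: "F face_of \<Delta>" and fG: "G face_of \<Delta>" using F G by (auto simp: facet_of_def)
  have i: "F \<inter> G face_of \<Delta>" using fF fG by (rule face_of_Int)
  have iF: "F \<inter> G face_of F" and iG: "F \<inter> G face_of G"
    using face_of_subset[OF i] facet_subset[OF F] facet_subset[OF G] by auto
  have "aff_dim (F \<inter> G) < 1"
  proof (cases "F \<inter> G = F")
    case True
    then have "F \<inter> G \<noteq> G" using \<open>F \<noteq> G\<close> by auto
    then show ?thesis
      using face_of_aff_dim_lt[OF face_of_imp_convex[OF fG] iG] aff_dim_facet[OF G] by simp
  next
    case False
    then show ?thesis
      using face_of_aff_dim_lt[OF face_of_imp_convex[OF fF] iF] aff_dim_facet[OF F] by simp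
  qed
  then have "aff_dim (F \<inter> G) = 0 \<or> aff_dim (F \<inter> G) = -1"
    using aff_dim_geq[of "F \<inter> G"] by linarith
  then show ?thesis using aff_dim_eq_0[of "F \<inter> G"] aff_dim_empty[of "F \<inter> G"] by auto
qed

lemma cone_over_facet:
  assumes P: "P \<in> \<Delta>" and F: "F facet_of \<Delta>"
  shows "convex hull (insert P F) = (\<Union>y\<in>F. closed_segment P y)"
proof -
  have "F \<noteq> {}" "convex F" using F by (auto simp: facet_of_def face_of_imp_convex)
  then show ?thesis
    by (simp add: convex_hull_insert_segments hull_same)
qed

lemma cone_subset:
  assumes P: "P \<in> \<Delta>" and F: "F facet_of \<Delta>"
  shows "convex hull (insert P F) \<subseteq> \<Delta>"
  using P facet_subset[OF F] convex by (intro hull_minimal) auto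

text \<open>
  A point \<open>x\<close> of the interior lies on the ray from \<open>P\<close> through \<open>x\<close>, which leaves the polygon through
  some facet.
\<close>

lemma cones_cover:
  assumes P: "P \<in> \<Delta>"
  shows "\<Delta> = (\<Union>F\<in>{F. F facet_of \<Delta>}. convex hull (insert P F))"
proof
  show "(\<Union>F\<in>{F. F facet_of \<Delta>}. convex hull (insert P F)) \<subseteq> \<Delta>"
    using cone_subset[OF P] by auto
  show "\<Delta> \<subseteq> (\<Union>F\<in>{F. F facet_of \<Delta>}. convex hull (insert P F))"
  proof
    fix x assume x: "x \<in> \<Delta>"
    have ex: "\<exists>y\<in>frontier \<Delta>. x \<in> closed_segment P y"
    proof (cases "x \<in> frontier \<Delta>")
      case True then show ?thesis by auto
    next
      case False
      then have xi: "x \<in> interior \<Delta>"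
        using x closed by (simp add: frontier_def)
      \<comment> \<open>If \<open>x = P\<close>, the ray may point in any direction.\<close>
      obtain l :: "real^2" where l: "l \<noteq> 0" "x = P \<or> l = x - P"
        using that[of "x - P"] that[of "axis 1 1"] by (cases "x = P") (auto simp: axis_eq_0_iff)
      obtain d where d: "0 < d" "x + d *\<^sub>R l \<in> frontier \<Delta>"
        using ray_to_frontier[OF bounded xi l(1)] by metis
      have "x \<in> closed_segment P (x + d *\<^sub>R l)"
      proof (cases "x = P")
        case False
        then have lx: "l = x - P" using l by auto
        define q where "q = 1 / (1 + d)"
        have q: "q * (1 + d) = 1" "0 \<le> q" "q \<le> 1" using d by (auto simp: q_def)
        have "(1 - q) *\<^sub>R P + q *\<^sub>R (x + d *\<^sub>R l) = P + (q * (1 + d)) *\<^sub>R (x - P)"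
          by (simp add: lx algebra_simps)
        then have "x = (1 - q) *\<^sub>R P + q *\<^sub>R (x + d *\<^sub>R l)" using q(1) by simp
        then show ?thesis using q unfolding closed_segment_def by blast
      qed auto
      then show ?thesis using d by blast
    qed
    then obtain y F where "F facet_of \<Delta>" "y \<in> F" "x \<in> closed_segment P y"
      using frontier_eq by auto
    then show "x \<in> (\<Union>F\<in>{F. F facet_of \<Delta>}. convex hull (insert P F))"
      using cone_over_facet[OF P] by auto
  qed
qed

text \<open>
  If \<open>y\<close> came strictly before \<open>z\<close> on the ray, then \<open>y\<close> would lie between the interior point \<open>x\<close> and the
  point \<open>z\<close> of the closure, hence in the interior.
\<close>

lemma ray_meets_frontier_once:
  assumes x: "x \<in> interior \<Delta>" "x \<noteq> P"
    and y: "y \<in> frontier \<Delta>" "x \<in> closed_segment P y" and z: "z \<in> frontier \<Delta>" "x \<in> closed_segment P z"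
  shows "y = z"
proof -
  have main: "\<not> s > t" if s: "x - P = s *\<^sub>R (y - P)" "y \<in> frontier \<Delta>" "0 < s" "s \<le> 1"
      and t: "x - P = t *\<^sub>R (z - P)" "z \<in> frontier \<Delta>" "0 < t" "t \<le> 1" for s t y z
  proof
    assume st: "s > t"
    have "(1/s) *\<^sub>R (x - P) = y - P" using s(1,3) by simp
    moreover have "(1/t) *\<^sub>R (x - P) = z - P" using t(1,3) by simp
    ultimately have yz: "y = P + (1/s) *\<^sub>R (x - P)" "z = P + (1/t) *\<^sub>R (x - P)" by simp_all
    have "y \<noteq> x" using s(2) x(1) by (auto simp: frontier_def)
    then have "s \<noteq> 1" using s(1) by auto
    then have s1: "s < 1" using s(4) by simp
    define u where "u = (1/s - 1) / (1/t - 1)"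
    have it: "1/t > 1/s" "1/s > 1" using s(3) t(3) st s1 by (simp_all add: frac_less2)
    have "u = p / q \<Longrightarrow> 0 < p \<Longrightarrow> p < q \<Longrightarrow> 0 < u \<and> u < 1 \<and> u * q = p" for p q by simp
    from this[OF u_def] it have u: "0 < u" "u < 1" "u * (1/t - 1) = 1/s - 1" by linarith+
    have "(1 - u) *\<^sub>R x + u *\<^sub>R z = P + (1 + u * (1/t - 1)) *\<^sub>R (x - P)"
      unfolding yz by (simp add: algebra_simps)
    also have "\<dots> = y" unfolding u(3) yz by simp
    finally have "y = (1 - u) *\<^sub>R x + u *\<^sub>R z" by (rule sym)
    moreover have "x \<noteq> z" using t(2) x(1) by (auto simp: frontier_def)
    ultimately have "y \<in> open_segment x z"
      unfolding in_segment using u by blast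
    moreover have "z \<in> closure \<Delta>" using t(2) by (simp add: frontier_def)
    ultimately have "y \<in> interior \<Delta>"
      using in_interior_closure_convex_segment[OF convex x(1)] by blast
    then show False using s(2) by (simp add: frontier_def)
  qed
  obtain s where s: "x = (1 - s) *\<^sub>R P + s *\<^sub>R y" "0 \<le> s" "s \<le> 1"
    using y unfolding closed_segment_def by auto
  obtain t where t: "x = (1 - t) *\<^sub>R P + t *\<^sub>R z" "0 \<le> t" "t \<le> 1"
    using z unfolding closed_segment_def by auto
  have s': "x - P = s *\<^sub>R (y - P)" unfolding s(1) by (simp add: algebra_simps)
  have t': "x - P = t *\<^sub>R (z - P)" unfolding t(1) by (simp add: algebra_simps)
  have "s \<noteq> 0" using s' x(2) by (intro notI) simp
  have "t \<noteq> 0" using t' x(2) by (intro notI) simp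
  have st: "0 < s" "0 < t" using \<open>s \<noteq> 0\<close> \<open>t \<noteq> 0\<close> s(2) t(2) by auto
  have "\<not> s > t" using main[OF s' y(1) st(1) s(3) t' z(1) st(2) t(3)] .
  moreover have "\<not> t > s" using main[OF t' z(1) st(2) t(3) s' y(1) st(1) s(3)] .
  ultimately have "s = t" by auto
  then have "s *\<^sub>R (y - P) = s *\<^sub>R (z - P)" using s' t' by auto
  then show ?thesis using \<open>s \<noteq> 0\<close> by auto
qed

text \<open>
  The cones from \<open>P\<close> over the facets cover the polygon. A point common to two of them lies on the
  frontier, or is \<open>P\<close>, or lies on the segment from \<open>P\<close> to the common point of the two facets, so the
  overlaps are null sets. The center \<open>P\<close> may be a boundary point; then some cones are degenerate.
\<close>

lemma LINT_fan:
  fixes g :: "real^2 \<Rightarrow> real"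
  assumes P: "P \<in> \<Delta>" and g: "continuous_on \<Delta> g"
  shows "(LINT x:\<Delta>|lborel. g x) = (\<Sum>F | F facet_of \<Delta>. LINT x:convex hull (insert P F)|lborel. g x)"
proof -
  define I where "I = {F. F facet_of \<Delta>}"
  define T where "T F = convex hull (insert P F)" for F
  have comp: "compact (T F)" if "F \<in> I" for F
  proof -
    have "compact F"
      using facet_ends[of F] that compact_segment[of "endA F" "endB F"] by (simp add: I_def)
    then show ?thesis unfolding T_def by (intro compact_convex_hull) auto
  qed
  have fr: "frontier \<Delta> \<in> null_sets lborel"
    by (rule compact_negligible_null_sets) (simp_all add: negligible_convex_frontier convex)
  have "(LINT x:(\<Union>F\<in>I. T F)|lborel. g x) = (\<Sum>F\<in>I. LINT x:T F|lborel. g x)"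
  proof (rule set_integral_finite_UN_AE)
    show "finite I" using finite_facets by (simp add: I_def)
    show "T F \<in> sets lborel" if "F \<in> I" for F
      using comp[OF that] by (simp add: borel_compact)
    show "set_integrable lborel (T F) g" if "F \<in> I" for F
    proof -
      have "T F \<subseteq> \<Delta>" using cone_subset[OF P] that by (simp add: T_def I_def)
      then show ?thesis unfolding set_integrable_def
        by (intro borel_integrable_compact comp[OF that] continuous_on_subset[OF g])
    qed
    fix F G assume F: "F \<in> I" and G: "G \<in> I"
    show "AE x in lborel. x \<in> T F \<and> x \<in> T G \<longrightarrow> F = G"
    proof (cases "F = G")
      case False
      obtain z where z: "F \<inter> G \<subseteq> {z}"
        using facets_Int[of F G] F G False by (auto simp: I_def)
      define N where "N = frontier \<Delta> \<union> closed_segment P P \<union> closed_segment P z"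
      have "N \<in> null_sets lborel"
        unfolding N_def using fr closed_segment_null_sets by (intro null_sets.Un)
      then have "AE x in lborel. x \<notin> N" by (rule AE_not_in)
      then show ?thesis
      proof (rule eventually_mono)
        fix x assume xN: "x \<notin> N"
        show "x \<in> T F \<and> x \<in> T G \<longrightarrow> F = G"
        proof
          assume "x \<in> T F \<and> x \<in> T G"
          moreover have "T F = (\<Union>y\<in>F. closed_segment P y)" "T G = (\<Union>y\<in>G. closed_segment P y)"
            using cone_over_facet[OF P] F G by (auto simp: T_def I_def)
          ultimately obtain y y' where y: "y \<in> F" "x \<in> closed_segment P y" "y' \<in> G" "x \<in> closed_segment P y'"
            by blast
          have "x \<in> \<Delta>" using \<open>x \<in> T F \<and> x \<in> T G\<close> cone_subset[OF P] F by (auto simp: T_def I_def)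
          then have "x \<in> interior \<Delta>" using xN closed by (auto simp: N_def frontier_def)
          moreover have "x \<noteq> P" using xN by (auto simp: N_def)
          ultimately have "y = y'"
            using ray_meets_frontier_once[of x P y y'] y facet_subset_frontier F G by (auto simp: I_def)
          then have "y = z" using y z by auto
          then show "F = G" using y xN by (simp add: N_def)
        qed
      qed
    qed simp
  qed
  then show ?thesis using cones_cover[OF P] by (simp add: I_def T_def)
qed

end

section \<open>Affine and piecewise linear functions\<close>

lemma affine_funE:
  assumes "affine_fun f"
  obtains l b where "linear l" "f = (\<lambda>x. l x + b)"
  using assms by (auto simp: affine_fun_def)

lemma affine_fun_const: "affine_fun (\<lambda>x. k)"
  unfolding affine_fun_def by (intro exI[of _ "\<lambda>x. 0"] exI[of _ k]) (auto simp: linear_iff)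

lemma affine_fun_add:
  assumes "affine_fun f" "affine_fun g"
  shows "affine_fun (\<lambda>x. f x + g x)"
proof -
  obtain l b where "linear l" "f = (\<lambda>x. l x + b)" using affine_funE[OF assms(1)] .
  moreover obtain m d where "linear m" "g = (\<lambda>x. m x + d)" using affine_funE[OF assms(2)] .
  ultimately show ?thesis unfolding affine_fun_def
    by (intro exI[of _ "\<lambda>x. l x + m x"] exI[of _ "b + d"]) (auto simp: linear_compose_add)
qed

lemma affine_fun_cmult:
  assumes "affine_fun f"
  shows "affine_fun (\<lambda>x. k * f x)"
proof -
  obtain l b where "linear l" "f = (\<lambda>x. l x + b)" using affine_funE[OF assms(1)] .
  then show ?thesis unfolding affine_fun_def
    by (intro exI[of _ "\<lambda>x. k * l x"] exI[of _ "k * b"])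
       (auto simp: linear_compose_scale_right[of l k, simplified] algebra_simps)
qed

lemma affine_fun_diff:
  assumes "affine_fun f" "affine_fun g"
  shows "affine_fun (\<lambda>x. f x - g x)"
  using affine_fun_add[OF assms(1) affine_fun_cmult[OF assms(2), of "-1"]] by simp

lemma affine_fun_det2: "affine_fun (\<lambda>x. det2 (x - z) w / k)" "affine_fun (\<lambda>x. det2 w (x - z) / k)"
proof -
  have l: "linear (\<lambda>x. det2 x w / k)" "linear (\<lambda>x. det2 w x / k)"
    by (auto intro!: linearI simp: det2_simps add_divide_distrib)
  show "affine_fun (\<lambda>x. det2 (x - z) w / k)"
    unfolding affine_fun_def using l(1)
    by (intro exI[of _ "\<lambda>x. det2 x w / k"] exI[of _ "- det2 z w / k"]) (auto simp: det2_simps diff_divide_distrib)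
  show "affine_fun (\<lambda>x. det2 w (x - z) / k)"
    unfolding affine_fun_def using l(2)
    by (intro exI[of _ "\<lambda>x. det2 w x / k"] exI[of _ "- det2 w z / k"]) (auto simp: det2_simps diff_divide_distrib)
qed

lemma affine_fun_continuous: "affine_fun f \<Longrightarrow> continuous_on S f"
proof -
  assume "affine_fun f"
  then obtain l b where l: "linear l" "f = (\<lambda>x. l x + b)" by (rule affine_funE)
  have "continuous_on S l" using l(1) by (simp add: linear_continuous_on linear_conv_bounded_linear)
  then show ?thesis unfolding l(2) by (intro continuous_intros)
qed

lemma affine_fun_combination:
  assumes "affine_fun f" "u + v = 1"
  shows "f (u *\<^sub>R x + v *\<^sub>R y) = u * f x + v * f y"
proof -
  obtain l b where l: "linear l" "f = (\<lambda>x. l x + b)" using affine_funE[OF assms(1)] .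
  have "b = (u + v) * b" using assms(2) by simp
  then show ?thesis unfolding l(2) linear_add[OF l(1)] linear_scale[OF l(1)]
    by (simp add: algebra_simps)
qed

lemma affine_fun_ray:
  assumes "affine_fun f"
  shows "f (x + s *\<^sub>R (y - x)) = (1 - s) * f x + s * f y"
  using affine_fun_combination[OF assms, of "1 - s" s x y] by (simp add: algebra_simps)

lemma affine_fun_vanishes:
  assumes f: "affine_fun f" and S: "open S" "S \<noteq> {}" and z: "\<And>x. x \<in> S \<Longrightarrow> f x = 0"
  shows "f = (\<lambda>x. 0)"
proof -
  have "affine {x. f x = 0}"
    unfolding affine_def using affine_fun_combination[OF f] by simp
  then have "affine hull S \<subseteq> {x. f x = 0}" using z by (intro hull_minimal) auto
  then show ?thesis using affine_hull_open[OF S] by auto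
qed

lemma segment_mean_continuous:
  fixes f :: "real^2 \<Rightarrow> real"
  assumes "continuous_on S f" "closed_segment a b \<subseteq> S"
  shows "continuous_on {0..1} (\<lambda>t. f (linepath a b t))"
  using assms path_image_linepath[of a b]
  by (intro continuous_on_compose2[OF assms(1)]) (auto simp: path_image_def linepath_def intro!: continuous_intros)

lemma segment_mean_integrable:
  fixes f :: "real^2 \<Rightarrow> real"
  assumes "continuous_on S f" "closed_segment a b \<subseteq> S"
  shows "(\<lambda>t. f (linepath a b t)) integrable_on {0..1}"
  using segment_mean_continuous[OF assms] by (rule integrable_continuous_real)

lemma linepath_in_segment: "t \<in> {0..1} \<Longrightarrow> linepath a b t \<in> closed_segment a b"
  using path_image_linepath[of a b] by (auto simp: path_image_def)

lemma PL_E: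
  assumes "f \<in> PL \<Delta>"
  obtains S where "finite S" "S \<noteq> {}" "\<And>a. a \<in> S \<Longrightarrow> affine_fun a"
    "\<And>x. x \<in> \<Delta> \<Longrightarrow> f x = Max ((\<lambda>a. a x) ` S)"
  using assms by (auto simp: PL_def)

lemma continuous_on_Max_affine:
  assumes "finite S" "S \<noteq> {}" "\<And>a. a \<in> S \<Longrightarrow> affine_fun a"
  shows "continuous_on D (\<lambda>x. Max ((\<lambda>a. a x) ` S))"
  using assms
proof (induction rule: finite_ne_induct)
  case (singleton a)
  then show ?case by (simp add: affine_fun_continuous)
next
  case (insert a S)
  have "continuous_on D a" using insert.prems by (simp add: affine_fun_continuous)
  moreover have "continuous_on D (\<lambda>x. Max ((\<lambda>a. a x) ` S))" using insert by simp
  ultimately have "continuous_on D (\<lambda>x. max (a x) (Max ((\<lambda>a. a x) ` S)))"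
    by (rule continuous_on_max)
  then show ?case using insert by simp
qed

lemma PL_continuous:
  assumes "f \<in> PL \<Delta>"
  shows "continuous_on \<Delta> f"
proof -
  obtain S where S: "finite S" "S \<noteq> {}" "\<And>a. a \<in> S \<Longrightarrow> affine_fun a"
    "\<And>x. x \<in> \<Delta> \<Longrightarrow> f x = Max ((\<lambda>a. a x) ` S)" using PL_E[OF assms] by blast
  show ?thesis
    by (rule continuous_on_eq[OF continuous_on_Max_affine[OF S(1,2)]]) (use S in auto)
qed

lemma PL_convex:
  assumes f: "f \<in> PL \<Delta>" and \<Delta>: "convex \<Delta>" and "x \<in> \<Delta>" "y \<in> \<Delta>" "0 \<le> s" "s \<le> 1"
  shows "f (x + s *\<^sub>R (y - x)) \<le> (1 - s) * f x + s * f y"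
proof -
  obtain S where S: "finite S" "S \<noteq> {}" "\<And>a. a \<in> S \<Longrightarrow> affine_fun a"
    "\<And>x. x \<in> \<Delta> \<Longrightarrow> f x = Max ((\<lambda>a. a x) ` S)" using PL_E[OF f] by blast
  have in_\<Delta>: "x + s *\<^sub>R (y - x) \<in> \<Delta>"
    using convexD_alt[OF \<Delta> assms(3,4), of s] assms(5,6) by (simp add: algebra_simps)
  have le: "a z \<le> f z" if "a \<in> S" "z \<in> \<Delta>" for a z
    using S(4)[OF that(2)] S(1) that(1) by simp
  have "a (x + s *\<^sub>R (y - x)) \<le> (1 - s) * f x + s * f y" if a: "a \<in> S" for a
    unfolding affine_fun_ray[OF S(3)[OF a]] using le[OF a] assms(3-6)
    by (intro add_mono mult_left_mono) auto
  then show ?thesis unfolding S(4)[OF in_\<Delta>] using S(1,2) by (subst Max_le_iff) auto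
qed

text \<open>
  One of the affine functions whose maximum is \<open>f\<close> is active at \<open>P\<close>.
\<close>

lemma PL_support:
  assumes "f \<in> PL \<Delta>" "P \<in> \<Delta>"
  obtains a where "affine_fun a" "a P = f P" "\<And>x. x \<in> \<Delta> \<Longrightarrow> a x \<le> f x"
proof -
  obtain S where S: "finite S" "S \<noteq> {}" "\<And>a. a \<in> S \<Longrightarrow> affine_fun a"
    "\<And>x. x \<in> \<Delta> \<Longrightarrow> f x = Max ((\<lambda>a. a x) ` S)" using PL_E[OF assms(1)] by blast
  have "f P \<in> (\<lambda>a. a P) ` S" unfolding S(4)[OF assms(2)] using S by (intro Max_in) auto
  then obtain a where a: "a \<in> S" "a P = f P" by auto
  have "a x \<le> f x" if "x \<in> \<Delta>" for x using S(4)[OF that] S(1) a(1) by simp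
  then show thesis using that[of a] a S(3) by auto
qed

section \<open>The relative Futaki invariant of a polygon\<close>

context polygon
begin

definition area_integral :: "(real^2 \<Rightarrow> real) \<Rightarrow> real" where
  "area_integral g = (LINT x:\<Delta>|lborel. g x)"

definition boundary_integral :: "((real^2) set \<Rightarrow> real) \<Rightarrow> (real^2 \<Rightarrow> real) \<Rightarrow> real" where
  "boundary_integral r f = (\<Sum>F | F facet_of \<Delta>. r F * segment_mean (endA F) (endB F) f)"

text \<open>
  The density of the boundary measure with respect to the affine parameter of a side. Its value does
  not depend on the choice of \<open>P\<close> off the side.
\<close>

definition facet_density ::
    "real \<Rightarrow> ((real^2) set \<Rightarrow> real^2 \<Rightarrow> real) \<Rightarrow> real^2 \<Rightarrow> (real^2) set \<Rightarrow> real" where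
  "facet_density c L P F = c * \<bar>det2 (endA F - P) (endB F - P)\<bar> / \<bar>L F P\<bar>"

lemma set_integrable_continuous: "continuous_on \<Delta> g \<Longrightarrow> set_integrable lborel \<Delta> g"
  for g :: "real^2 \<Rightarrow> real"
  unfolding set_integrable_def by (rule borel_integrable_compact[OF compact])

lemma area_add:
  "continuous_on \<Delta> f \<Longrightarrow> continuous_on \<Delta> g \<Longrightarrow>
    area_integral (\<lambda>x. f x + g x) = area_integral f + area_integral g"
  unfolding area_integral_def by (intro set_integral_add(2) set_integrable_continuous)

lemma area_diff:
  "continuous_on \<Delta> f \<Longrightarrow> continuous_on \<Delta> g \<Longrightarrow>
    area_integral (\<lambda>x. f x - g x) = area_integral f - area_integral g"
  unfolding area_integral_def by (intro set_integral_diff(2) set_integrable_continuous)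

lemma area_cmult: "area_integral (\<lambda>x. k * f x) = k * area_integral f"
  unfolding area_integral_def by simp

lemma area_cong: "(\<And>x. x \<in> \<Delta> \<Longrightarrow> f x = g x) \<Longrightarrow> area_integral f = area_integral g"
  unfolding area_integral_def by (rule set_lebesgue_integral_cong) (use closed in \<open>auto simp: borel_closed\<close>)

lemma area_mono:
  "continuous_on \<Delta> f \<Longrightarrow> continuous_on \<Delta> g \<Longrightarrow> (\<And>x. x \<in> \<Delta> \<Longrightarrow> f x \<le> g x) \<Longrightarrow>
    area_integral f \<le> area_integral g"
  unfolding area_integral_def by (intro set_integral_mono set_integrable_continuous)

lemma LINT_volume_measure:
  assumes "c > 0" "continuous_on \<Delta> g"
  shows "(LINT x:\<Delta>|volume_measure c. g x) = c * area_integral g"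
proof -
  have m: "(\<lambda>x. indicator \<Delta> x *\<^sub>R g x) \<in> borel_measurable lborel"
    using set_integrable_continuous[OF assms(2)] by (simp add: set_integrable_def)
  show ?thesis
    using integral_density[OF m, of "\<lambda>x. c"] assms(1)
    by (simp add: set_lebesgue_integral_def volume_measure_def area_integral_def)
qed

lemma facet_segment_subset:
  assumes "F facet_of \<Delta>"
  shows "closed_segment (endA F) (endB F) \<subseteq> \<Delta>"
  using facet_ends[OF assms] facet_subset[OF assms] by simp

lemma boundary_add:
  assumes "continuous_on \<Delta> f" "continuous_on \<Delta> g"
  shows "boundary_integral r (\<lambda>x. f x + g x) = boundary_integral r f + boundary_integral r g"
proof -
  have "segment_mean (endA F) (endB F) (\<lambda>x. f x + g x) = segment_mean (endA F) (endB F) f + segment_mean (endA F) (endB F) g"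
    if "F facet_of \<Delta>" for F
    unfolding segment_mean_def
    by (intro integral_add segment_mean_integrable[OF _ facet_segment_subset[OF that]] assms)
  then show ?thesis
    unfolding boundary_integral_def sum.distrib[symmetric] by (intro sum.cong) (auto simp: algebra_simps)
qed

lemma boundary_cmult: "boundary_integral r (\<lambda>x. k * f x) = k * boundary_integral r f"
  unfolding boundary_integral_def segment_mean_def sum_distrib_left by (intro sum.cong) auto

lemma boundary_diff:
  assumes "continuous_on \<Delta> f" "continuous_on \<Delta> g"
  shows "boundary_integral r (\<lambda>x. f x - g x) = boundary_integral r f - boundary_integral r g"
  using boundary_add[OF assms(1) continuous_on_mult_left[OF assms(2), of "-1"], of r]
    boundary_cmult[of r "-1" g] by simp

lemma boundary_cong:
  assumes "\<And>x. x \<in> \<Delta> \<Longrightarrow> f x = g x"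
  shows "boundary_integral r f = boundary_integral r g"
  unfolding boundary_integral_def segment_mean_def
  using facet_segment_subset linepath_in_segment assms
  by (intro sum.cong arg_cong2[where f="(*)"] integral_cong refl) blast

lemma boundary_nonneg:
  assumes "continuous_on \<Delta> f" "\<And>x. x \<in> \<Delta> \<Longrightarrow> 0 \<le> f x" "\<And>F. F facet_of \<Delta> \<Longrightarrow> 0 \<le> r F"
  shows "0 \<le> boundary_integral r f"
  unfolding boundary_integral_def segment_mean_def
proof (intro sum_nonneg mult_nonneg_nonneg integral_nonneg)
  fix F t assume F: "F \<in> {F. F facet_of \<Delta>}"
  show "0 \<le> r F" using assms(3) F by simp
  show "(\<lambda>t. f (linepath (endA F) (endB F) t)) integrable_on {0..1}"
    using segment_mean_integrable[OF assms(1) facet_segment_subset] F by simp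
  show "0 \<le> f (linepath (endA F) (endB F) t)" if "t \<in> {0..1}"
    using assms(2) linepath_in_segment[OF that] facet_segment_subset F by blast
qed

lemma boundary_eq_0:
  assumes f: "continuous_on \<Delta> f" "\<And>x. x \<in> \<Delta> \<Longrightarrow> 0 \<le> f x" and r: "\<And>F. F facet_of \<Delta> \<Longrightarrow> 0 < r F"
    and 0: "boundary_integral r f = 0" and x: "x \<in> frontier \<Delta>"
  shows "f x = 0"
proof -
  have ge: "0 \<le> segment_mean (endA F) (endB F) f" if "F facet_of \<Delta>" for F
    unfolding segment_mean_def
    using segment_mean_integrable[OF f(1) facet_segment_subset[OF that]] f(2) linepath_in_segment facet_segment_subset[OF that]
    by (intro integral_nonneg) blast+
  obtain F where F: "F facet_of \<Delta>" "x \<in> F" using x frontier_eq by auto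
  have "r F * segment_mean (endA F) (endB F) f = 0"
    using sum_nonneg_eq_0_iff[OF finite_facets, of "\<lambda>F. r F * segment_mean (endA F) (endB F) f"] 0 ge r F
    by (auto simp: boundary_integral_def less_imp_le)
  then have "segment_mean (endA F) (endB F) f = 0" using r[OF F(1)] by simp
  then have z: "f (linepath (endA F) (endB F) t) = 0" if "t \<in> {0..1}" for t
    using integral_eq_0_iff[OF segment_mean_continuous[OF f(1) facet_segment_subset[OF F(1)]]] that
      f(2) linepath_in_segment facet_segment_subset[OF F(1)]
    unfolding segment_mean_def by (metis subsetD zero_less_one)
  have "x \<in> closed_segment (endA F) (endB F)" using F facet_ends by simp
  then have "x \<in> linepath (endA F) (endB F) ` {0..1}"
    using path_image_linepath[of "endA F" "endB F"] by (simp add: path_image_def)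
  then obtain t where "t \<in> {0..1}" "x = linepath (endA F) (endB F) t" by blast
  then show ?thesis using z by simp
qed

lemma LINT_boundary:
  assumes "c > 0" "affine_normals \<Delta> L" "\<And>F. F facet_of \<Delta> \<Longrightarrow> L F P \<noteq> 0" "continuous_on \<Delta> f"
  shows "(LINT x:frontier \<Delta>|boundary_measure c \<Delta> L. f x) = boundary_integral (facet_density c L P) f"
  unfolding boundary_integral_def facet_density_def
proof (rule LINT_boundary_measure[OF assms(1) finite_facets facet_ends assms(2) assms(3) frontier_eq bounded])
  show "continuous_on (frontier \<Delta>) f"
    using assms(4) closed by (auto intro: continuous_on_subset simp: frontier_def)
qed

lemma area_eq_0_interior:
  assumes g: "continuous_on \<Delta> g" "\<And>x. x \<in> \<Delta> \<Longrightarrow> 0 \<le> g x"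
    and 0: "area_integral g = 0" and x: "x \<in> interior \<Delta>"
  shows "g x = 0"
proof -
  define U where "U = interior \<Delta> \<inter> g -` (- {0})"
  have "AE x in lborel. 0 \<le> indicator \<Delta> x *\<^sub>R g x"
    using g(2) by (intro AE_I2) (auto simp: indicator_def)
  then have "AE x in lborel. indicator \<Delta> x *\<^sub>R g x = 0"
    using 0 integral_nonneg_eq_0_iff_AE[OF set_integrable_continuous[OF g(1), unfolded set_integrable_def]]
    by (simp add: area_integral_def set_lebesgue_integral_def)
  then have ae: "AE x in lborel. x \<notin> U"
    by (rule eventually_mono) (use interior_subset in \<open>auto simp: U_def indicator_def split: if_splits\<close>)
  have op: "open U" unfolding U_def
    using continuous_on_subset[OF g(1) interior_subset] by (intro continuous_open_preimage) auto
  have "negligible U"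
    using AE_iff_null_sets[of U lborel] op ae
    by (simp add: negligible_iff_null_sets null_sets_completion_iff borel_open)
  then have "U = {}" using open_not_negligible[OF op] by blast
  then show ?thesis using x by (auto simp: U_def)
qed

text \<open>
  The area pairing is definite on affine functions, which is why the extremal affine function is
  unique.
\<close>

lemma affine_orthogonal_zero:
  assumes f: "affine_fun f" and 0: "area_integral (\<lambda>x. f x * f x) = 0"
  shows "f = (\<lambda>x. 0)"
proof (rule affine_fun_vanishes[OF f open_interior interior_nonempty])
  have cont: "continuous_on \<Delta> (\<lambda>x. f x * f x)"
    using affine_fun_continuous[OF f] by (intro continuous_intros) auto
  show "f x = 0" if "x \<in> interior \<Delta>" for x
    using area_eq_0_interior[OF cont _ 0 that] by simp
qed

text \<open>
  The definite description in the definition of the extremal function is resolved by exhibiting a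
  solution of the moment equations.
\<close>

lemma extremal_affine_eqI:
  assumes c: "c > 0" and L: "affine_normals \<Delta> L" and P: "\<And>F. F facet_of \<Delta> \<Longrightarrow> L F P \<noteq> 0"
    and \<zeta>: "affine_fun \<zeta>"
    and eq: "\<And>A. affine_fun A \<Longrightarrow> c * area_integral (\<lambda>x. \<zeta> x * A x) = 2 * boundary_integral (facet_density c L P) A"
  shows "extremal_affine c \<Delta> L = \<zeta>"
  unfolding extremal_affine_def
proof (rule the_equality)
  have ct: "continuous_on \<Delta> (\<lambda>x. f x * g x)" if "affine_fun f" "affine_fun g" for f g
    using that affine_fun_continuous by (intro continuous_intros) auto
  show "affine_fun \<zeta> \<and> (\<forall>A. affine_fun A \<longrightarrow> (LINT x:\<Delta>|volume_measure c. \<zeta> x * A x) =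
      2 * (LINT x:frontier \<Delta>|boundary_measure c \<Delta> L. A x))"
    using \<zeta> eq LINT_volume_measure[OF c ct[OF \<zeta>]] LINT_boundary[OF c L P affine_fun_continuous] by simp
  fix \<xi>
  assume x: "affine_fun \<xi> \<and> (\<forall>A. affine_fun A \<longrightarrow> (LINT x:\<Delta>|volume_measure c. \<xi> x * A x) =
      2 * (LINT x:frontier \<Delta>|boundary_measure c \<Delta> L. A x))"
  then have \<xi>: "affine_fun \<xi>" by simp
  define \<eta> where "\<eta> = (\<lambda>x. \<xi> x - \<zeta> x)"
  have \<eta>: "affine_fun \<eta>" unfolding \<eta>_def using \<xi> \<zeta> by (rule affine_fun_diff)
  have "c * area_integral (\<lambda>x. \<xi> x * \<eta> x) = 2 * boundary_integral (facet_density c L P) \<eta>"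
    using x \<eta> LINT_volume_measure[OF c ct[OF \<xi> \<eta>]] LINT_boundary[OF c L P affine_fun_continuous[OF \<eta>]] by simp
  also have "\<dots> = c * area_integral (\<lambda>x. \<zeta> x * \<eta> x)" using eq[OF \<eta>] by simp
  finally have "area_integral (\<lambda>x. \<xi> x * \<eta> x) - area_integral (\<lambda>x. \<zeta> x * \<eta> x) = 0" using c by simp
  then have "area_integral (\<lambda>x. \<eta> x * \<eta> x) = 0"
    using area_diff[OF ct[OF \<xi> \<eta>] ct[OF \<zeta> \<eta>]] by (simp add: \<eta>_def algebra_simps)
  then have "\<eta> = (\<lambda>x. 0)" by (rule affine_orthogonal_zero[OF \<eta>])
  then show "\<xi> = \<zeta>" by (simp add: \<eta>_def fun_eq_iff)
qed

lemma futaki_eq: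
  assumes c: "c > 0" and L: "affine_normals \<Delta> L" and P: "\<And>F. F facet_of \<Delta> \<Longrightarrow> L F P \<noteq> 0"
    and \<zeta>: "affine_fun \<zeta>"
    and eq: "\<And>A. affine_fun A \<Longrightarrow> c * area_integral (\<lambda>x. \<zeta> x * A x) = 2 * boundary_integral (facet_density c L P) A"
    and f: "continuous_on \<Delta> f"
  shows "futaki c \<Delta> L f = boundary_integral (facet_density c L P) f - 1/2 * (c * area_integral (\<lambda>x. \<zeta> x * f x))"
proof -
  have "continuous_on \<Delta> (\<lambda>x. \<zeta> x * f x)"
    using f affine_fun_continuous[OF \<zeta>] by (intro continuous_intros)
  then show ?thesis
    using extremal_affine_eqI[OF c L P \<zeta> eq]
    by (simp add: futaki_def LINT_volume_measure[OF c] LINT_boundary[OF c L P f])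
qed

end

section \<open>Stable normals on every polygon\<close>

lemma has_integral_FTC:
  fixes f :: "real \<Rightarrow> real"
  assumes "a \<le> b" "\<And>x. (f has_real_derivative f' x) (at x)"
  shows "(f' has_integral (f b - f a)) {a..b}"
  using assms by (intro fundamental_theorem_of_calculus)
    (auto simp: has_real_derivative_iff_has_vector_derivative[symmetric] intro: has_field_derivative_at_within)

lemma cone_profile_integral:
  fixes k m :: real
  shows "((\<lambda>s. s * ((1 - s) * k + s * m)) has_integral (k / 6 + m / 3)) {0..1}"
proof -
  have "((\<lambda>s. s * ((1 - s) * k + s * m)) has_integral
     ((\<lambda>s. k * (s^2 / 2 - s^3 / 3) + m * (s^3 / 3)) 1 - (\<lambda>s. k * (s^2 / 2 - s^3 / 3) + m * (s^3 / 3)) 0)) {0..1}"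
    by (rule has_integral_FTC) (auto intro!: derivative_eq_intros simp: field_simps power2_eq_square)
  then show ?thesis by simp
qed

text \<open>
  Integrate the inequality over \<open>t\<close> and then over \<open>s\<close> against the weight \<open>s\<close> of polar coordinates. The
  constants are \<open>\<integral> s (1 - s) ds = 1/6\<close> and \<open>\<integral> s\<^sup>2 ds = 1/3\<close>.
\<close>

lemma LINT_triangle_convex_le:
  fixes g :: "real^2 \<Rightarrow> real"
  assumes g: "continuous_on (convex hull {P, a, b}) g"
    and conv: "\<And>s t. s \<in> {0..1} \<Longrightarrow> t \<in> {0..1} \<Longrightarrow>
      g (P + s *\<^sub>R (linepath a b t - P)) \<le> (1 - s) * g P + s * g (linepath a b t)"
  shows "(LINT x:convex hull {P, a, b}|lborel. g x)
    \<le> \<bar>det2 (a - P) (b - P)\<bar> * (g P / 6 + segment_mean a b g / 3)"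
proof -
  define T where "T = convex hull {P, a, b}"
  define m where "m = segment_mean a b g"
  have seg: "closed_segment a b \<subseteq> T"
    unfolding T_def segment_convex_hull by (rule hull_mono) auto
  have hT: "P + s *\<^sub>R (linepath a b t - P) \<in> T" if "s \<in> {0..1}" "t \<in> {0..1}" for s t
  proof -
    have "linepath a b t \<in> T" using linepath_in_segment[OF that(2)] seg by blast
    moreover have "P \<in> T" unfolding T_def by (simp add: hull_inc)
    moreover have "convex T" by (simp add: T_def)
    ultimately have "(1 - s) *\<^sub>R P + s *\<^sub>R linepath a b t \<in> T"
      using convexD_alt[of T P "linepath a b t" s] that by auto
    then show ?thesis by (simp add: algebra_simps)
  qed
  have cont: "continuous_on ({0..1} \<times> cbox 0 1) (\<lambda>(s, t). g (P + s *\<^sub>R (linepath a b t - P)))"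
    unfolding split_beta linepath_def
    by (intro continuous_on_compose2[OF g[folded T_def]] continuous_intros)
       (use hT in \<open>auto simp: linepath_def\<close>)
  have ch: "continuous_on {0..1} (\<lambda>t. g (P + s *\<^sub>R (linepath a b t - P)))" if "s \<in> {0..1}" for s
  proof -
    have "continuous_on {0..1} (\<lambda>t. (\<lambda>(s, t). g (P + s *\<^sub>R (linepath a b t - P))) (s, t))"
      by (rule continuous_on_compose2[OF cont]) (use that in \<open>auto intro!: continuous_intros\<close>)
    then show ?thesis by simp
  qed
  have gi: "((\<lambda>t. g (linepath a b t)) has_integral m) {0..1}"
    unfolding m_def segment_mean_def
    using segment_mean_integrable[OF g[folded T_def] seg] by (rule integrable_integral)
  have inner: "integral {0..1} (\<lambda>t. g (P + s *\<^sub>R (linepath a b t - P))) \<le> (1 - s) * g P + s * m"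
    if s: "s \<in> {0..1}" for s
  proof (rule has_integral_le)
    show "((\<lambda>t. g (P + s *\<^sub>R (linepath a b t - P))) has_integral
        integral {0..1} (\<lambda>t. g (P + s *\<^sub>R (linepath a b t - P)))) {0..1}"
      using integrable_continuous_real[OF ch[OF s]] by (rule integrable_integral)
    have "((\<lambda>t. (1 - s) * g P) has_integral (1 - s) * g P) {0..1::real}"
      using has_integral_const_real[of "(1 - s) * g P" 0 1] by simp
    then show "((\<lambda>t. (1 - s) * g P + s * g (linepath a b t)) has_integral ((1 - s) * g P + s * m)) {0..1}"
      by (rule has_integral_add[OF _ has_integral_mult_right[OF gi]])
  qed (use conv s in auto)
  have "integral {0..1} (\<lambda>s. s * integral {0..1} (\<lambda>t. g (P + s *\<^sub>R (linepath a b t - P))))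
     \<le> g P / 6 + m / 3"
  proof (rule has_integral_le[OF integrable_integral cone_profile_integral])
    show "(\<lambda>s. s * integral {0..1} (\<lambda>t. g (P + s *\<^sub>R (linepath a b t - P)))) integrable_on {0..1}"
      using integral_continuous_on_param[OF cont]
      by (intro integrable_continuous_real continuous_intros) auto
  qed (use inner in \<open>auto intro: mult_left_mono\<close>)
  then show ?thesis
    unfolding LINT_triangle[OF g] m_def by (intro mult_left_mono) auto
qed

text \<open>
  The inequality for \<open>A\<close> and the one for \<open>- A\<close>.
\<close>

lemma LINT_triangle_affine:
  assumes A: "affine_fun A"
  shows "(LINT x:convex hull {P, a, b}|lborel. A x)
    = \<bar>det2 (a - P) (b - P)\<bar> * (A P / 6 + segment_mean a b A / 3)"
proof (rule antisym)
  show "(LINT x:convex hull {P, a, b}|lborel. A x)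
    \<le> \<bar>det2 (a - P) (b - P)\<bar> * (A P / 6 + segment_mean a b A / 3)"
    by (rule LINT_triangle_convex_le) (auto simp: affine_fun_continuous[OF A] affine_fun_ray[OF A])
  have A': "affine_fun (\<lambda>x. - A x)" using affine_fun_cmult[OF A, of "-1"] by simp
  have "(LINT x:convex hull {P, a, b}|lborel. - A x)
    \<le> \<bar>det2 (a - P) (b - P)\<bar> * (- A P / 6 + segment_mean a b (\<lambda>x. - A x) / 3)"
    by (rule LINT_triangle_convex_le[of P a b "\<lambda>x. - A x"])
       (auto simp: affine_fun_continuous[OF A'] affine_fun_ray[OF A])
  moreover have "segment_mean a b (\<lambda>x. - A x) = - segment_mean a b A"
    by (simp add: segment_mean_def)
  moreover have "(LINT x:convex hull {P, a, b}|lborel. - A x) = - (LINT x:convex hull {P, a, b}|lborel. A x)"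
    using set_integral_uminus[of lborel "convex hull {P, a, b}" A]
       borel_integrable_compact[OF _ affine_fun_continuous[OF A], of "convex hull {P, a, b}"]
    by (simp add: set_integrable_def finite_imp_compact_convex_hull)
  ultimately show "\<bar>det2 (a - P) (b - P)\<bar> * (A P / 6 + segment_mean a b A / 3)
     \<le> (LINT x:convex hull {P, a, b}|lborel. A x)"
    by (simp add: algebra_simps)
qed

context polygon
begin

lemma normals_exist:
  "\<exists>L. affine_normals \<Delta> L \<and> (\<forall>F. F facet_of \<Delta> \<longrightarrow> (\<forall>x\<in>\<Delta>. 0 \<le> L F x))"
proof -
  have "\<exists>l. affine_fun l \<and> (\<forall>x\<in>F. l x = 0) \<and> (\<forall>x\<in>interior \<Delta>. l x > 0) \<and> (\<forall>x\<in>\<Delta>. 0 \<le> l x)"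
    if F: "F facet_of \<Delta>" for F
  proof -
    obtain a b where ab: "a \<noteq> 0" "\<Delta> \<subseteq> {x. a \<bullet> x \<le> b}" "F = \<Delta> \<inter> {x. a \<bullet> x = b}"
      using facet_of_polyhedron[OF polytope_imp_polyhedron[OF polytope] F] .
    have "linear (\<lambda>x. - (a \<bullet> x))" by (rule linearI) (auto simp: inner_add_right)
    then have "affine_fun (\<lambda>x. b - a \<bullet> x)"
      unfolding affine_fun_def by (intro exI[of _ "\<lambda>x. - (a \<bullet> x)"] exI[of _ b]) auto
    moreover have "interior \<Delta> \<subseteq> {x. a \<bullet> x < b}"
      using interior_mono[OF ab(2)] ab(1) by simp
    ultimately show ?thesis using ab by (intro exI[of _ "\<lambda>x. b - a \<bullet> x"]) auto
  qed
  then obtain L where "\<And>F. F facet_of \<Delta> \<Longrightarrow>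
     affine_fun (L F) \<and> (\<forall>x\<in>F. L F x = 0) \<and> (\<forall>x\<in>interior \<Delta>. L F x > 0) \<and> (\<forall>x\<in>\<Delta>. 0 \<le> L F x)"
    by metis
  then show ?thesis unfolding affine_normals_def by blast
qed

lemma normals_scale:
  assumes "affine_normals \<Delta> L" "\<And>F. F facet_of \<Delta> \<Longrightarrow> 0 < k F"
  shows "affine_normals \<Delta> (\<lambda>F x. k F * L F x)"
  using assms unfolding affine_normals_def by (auto simp: affine_fun_cmult)

lemma det2_facet_nonzero:
  assumes "affine_normals \<Delta> L" "F facet_of \<Delta>" "L F P \<noteq> 0"
  shows "det2 (endA F - P) (endB F - P) \<noteq> 0"
proof -
  have "endA F \<in> F" "endB F \<in> F" using facet_ends[OF assms(2)] by (metis ends_in_segment)+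
  then have "affine_fun (L F)" "L F (endA F) = 0" "L F (endB F) = 0"
    using assms(1,2) by (auto simp: affine_normals_def)
  then show ?thesis using det2_nonzero_off_line assms(3) facet_ends[OF assms(2)] by blast
qed

text \<open>
  Rescaling the normal of a side by \<open>k > 0\<close> divides the density there by \<open>k\<close>.
\<close>

lemma normals_with_density:
  assumes c: "c > 0" and r: "\<And>F. F facet_of \<Delta> \<Longrightarrow> 0 < r F"
  obtains L P where "affine_normals \<Delta> L" "\<And>F. F facet_of \<Delta> \<Longrightarrow> L F P \<noteq> 0"
    "\<And>F. F facet_of \<Delta> \<Longrightarrow> facet_density c L P F = r F"
proof -
  obtain L where L: "affine_normals \<Delta> L" using normals_exist by auto
  obtain P where "P \<in> interior \<Delta>" using interior_nonempty by auto
  then have LP: "0 < L F P" if "F facet_of \<Delta>" for F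
    using L that by (auto simp: affine_normals_def)
  \<comment> \<open>The given normals have density \<open>c |det| / L F P\<close>; this factor changes it to \<open>r F\<close>.\<close>
  define k where "k F = c * \<bar>det2 (endA F - P) (endB F - P)\<bar> / (r F * L F P)" for F
  have k: "0 < k F" if "F facet_of \<Delta>" for F
    using c r[OF that] LP[OF that] det2_facet_nonzero[OF L that, of P] by (simp add: k_def)
  show thesis
  proof (rule that)
    show "affine_normals \<Delta> (\<lambda>F x. k F * L F x)" by (rule normals_scale[OF L k])
    show "k F * L F P \<noteq> 0" if "F facet_of \<Delta>" for F using k[OF that] LP[OF that] by simp
    show "facet_density c (\<lambda>F x. k F * L F x) P F = r F" if "F facet_of \<Delta>" for F
      using c r[OF that] LP[OF that] det2_facet_nonzero[OF L that, of P]
      by (simp add: facet_density_def k_def abs_mult)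
  qed
qed

lemma cone_hull: "F facet_of \<Delta> \<Longrightarrow> convex hull (insert P F) = convex hull {P, endA F, endB F}"
  using facet_ends[of F] hull_insert[of convex P "{endA F, endB F}"] by (simp add: segment_convex_hull)

lemma area_fan_affine:
  assumes P: "P \<in> \<Delta>" and A: "affine_fun A"
  shows "area_integral A = (\<Sum>F | F facet_of \<Delta>.
    \<bar>det2 (endA F - P) (endB F - P)\<bar> * (A P / 6 + segment_mean (endA F) (endB F) A / 3))"
  unfolding area_integral_def LINT_fan[OF P affine_fun_continuous[OF A]]
  by (intro sum.cong refl) (simp add: cone_hull LINT_triangle_affine[OF A])

lemma area_fan_PL:
  assumes P: "P \<in> \<Delta>" and f: "f \<in> PL \<Delta>"
  shows "area_integral f \<le> (\<Sum>F | F facet_of \<Delta>.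
    \<bar>det2 (endA F - P) (endB F - P)\<bar> * (f P / 6 + segment_mean (endA F) (endB F) f / 3))"
  unfolding area_integral_def LINT_fan[OF P PL_continuous[OF f]]
proof (intro sum_mono)
  fix F assume "F \<in> {F. F facet_of \<Delta>}"
  then have F: "F facet_of \<Delta>" by simp
  have sub: "convex hull {P, endA F, endB F} \<subseteq> \<Delta>"
    using cone_subset[OF P F] by (simp add: cone_hull[OF F])
  show "(LINT x:convex hull (insert P F)|lborel. f x)
     \<le> \<bar>det2 (endA F - P) (endB F - P)\<bar> * (f P / 6 + segment_mean (endA F) (endB F) f / 3)"
    unfolding cone_hull[OF F]
  proof (rule LINT_triangle_convex_le)
    show "continuous_on (convex hull {P, endA F, endB F}) f"
      by (rule continuous_on_subset[OF PL_continuous[OF f] sub])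
    show "f (P + s *\<^sub>R (linepath (endA F) (endB F) t - P)) \<le> (1 - s) * f P + s * f (linepath (endA F) (endB F) t)"
      if "s \<in> {0..1}" "t \<in> {0..1}" for s t
      using that linepath_in_segment[OF that(2)] facet_segment_subset[OF F]
      by (intro PL_convex[OF f convex P]) auto
  qed
qed

lemma area_pos: "0 < area_integral (\<lambda>x. 1)"
proof -
  have "0 \<le> area_integral (\<lambda>x. 1)" 
    unfolding area_integral_def set_lebesgue_integral_def by (intro Bochner_Integration.integral_nonneg) simp
  moreover have "area_integral (\<lambda>x. 1) \<noteq> 0"
    using affine_orthogonal_zero[OF affine_fun_const[of 1]] by (auto simp: fun_eq_iff)
  ultimately show ?thesis by simp
qed

text \<open>
  The barycenter lies in the polygon, for otherwise it could be separated from it by an affine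
  function that is positive on the polygon and hence has positive mean.
\<close>

lemma barycenter_exists:
  obtains P where "P \<in> \<Delta>" "\<And>A. affine_fun A \<Longrightarrow> area_integral A = A P * area_integral (\<lambda>x. 1)"
proof -
  define P :: "real^2" where "P = (\<chi> i. area_integral (\<lambda>x. x$i) / area_integral (\<lambda>x. 1))"
  have area: "area_integral A = A P * area_integral (\<lambda>x. 1)" if A: "affine_fun A" for A
  proof -
    obtain l b where l: "linear l" "A = (\<lambda>x. l x + b)" using A by (rule affine_funE)
    have lx: "l x = l (axis 1 1) * x$1 + l (axis 2 1) * x$2" for x
    proof -
      have "x = x$1 *\<^sub>R axis 1 1 + x$2 *\<^sub>R axis 2 1"
        by (auto simp: vec_eq_iff forall_2 axis_def)
      then have "l x = l (x$1 *\<^sub>R axis 1 1 + x$2 *\<^sub>R axis 2 1)" by simp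
      then show ?thesis unfolding linear_add[OF l(1)] linear_scale[OF l(1)] by simp
    qed
    have Ax: "A x = (l (axis 1 1) * x$1 + l (axis 2 1) * x$2) + b * 1" for x by (simp add: l(2) lx[of x])
    have "area_integral A = l (axis 1 1) * area_integral (\<lambda>x. x$1) + l (axis 2 1) * area_integral (\<lambda>x. x$2)
        + b * area_integral (\<lambda>x. 1)"
      unfolding Ax[abs_def]
      by (subst area_add area_cmult; (intro continuous_intros)?)+ simp
    moreover have "P$i * area_integral (\<lambda>x. 1) = area_integral (\<lambda>x. x$i)" for i
      using area_pos by (simp add: P_def)
    ultimately show ?thesis unfolding Ax[of P] by (simp add: distrib_right mult.assoc)
  qed
  have "P \<in> \<Delta>"
  proof (rule ccontr)
    assume "P \<notin> \<Delta>"
    then obtain a b where ab: "a \<bullet> P < b" "\<forall>x\<in>\<Delta>. a \<bullet> x > b"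
      using separating_hyperplane_closed_point[OF convex closed] by blast
    have lin: "linear (\<lambda>x. a \<bullet> x)" by (rule linearI) (auto simp: inner_add_right)
    then have A: "affine_fun (\<lambda>x. a \<bullet> x - b)"
      unfolding affine_fun_def by (intro exI[of _ "\<lambda>x. a \<bullet> x"] exI[of _ "-b"]) auto
    have "0 \<le> area_integral (\<lambda>x. a \<bullet> x - b)"
      using area_mono[OF continuous_on_const affine_fun_continuous[OF A], of 0] area_cmult[of 0] ab
      by (auto simp: less_imp_le)
    moreover have "(a \<bullet> P - b) * area_integral (\<lambda>x. 1) < 0"
      using ab area_pos by (intro mult_neg_pos) auto
    ultimately show False using area[OF A] by simp
  qed
  then show thesis using area that by blast
qed

text \<open>
  Summing \<open>LINT_triangle_affine\<close> over the fan of the barycenter \<open>P\<close> gives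
  \<open>c \<integral> A = R A(P) / 6 + \<integral> A d\<nu> / 3\<close>, where \<open>R\<close> is the total boundary mass. The left-hand side is
  \<open>A(P)\<close> times its value for \<open>A = 1\<close>, and that value is \<open>R / 2\<close>. So \<open>P\<close> is the barycenter of the
  boundary measure as well, and the constant 4 solves the equations of the extremal function.
\<close>

lemma barycentric_normals:
  assumes c: "c > 0"
  obtains L P where "affine_normals \<Delta> L" "P \<in> \<Delta>" "\<And>F. F facet_of \<Delta> \<Longrightarrow> L F P = 1"
    "\<And>A. affine_fun A \<Longrightarrow> boundary_integral (facet_density c L P) A
        = A P * boundary_integral (facet_density c L P) (\<lambda>x. 1)"
    "\<And>A. affine_fun A \<Longrightarrow> c * area_integral (\<lambda>x. 4 * A x) = 2 * boundary_integral (facet_density c L P) A"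
    "\<And>f. f \<in> PL \<Delta> \<Longrightarrow> c * area_integral f \<le>
        f P / 6 * boundary_integral (facet_density c L P) (\<lambda>x. 1) + boundary_integral (facet_density c L P) f / 3"
proof -
  obtain P where P: "P \<in> \<Delta>" "\<And>A. affine_fun A \<Longrightarrow> area_integral A = A P * area_integral (\<lambda>x. 1)"
    using barycenter_exists by blast
  obtain L0 where L0: "affine_normals \<Delta> L0" "\<And>F x. F facet_of \<Delta> \<Longrightarrow> x \<in> \<Delta> \<Longrightarrow> 0 \<le> L0 F x"
    using normals_exist by blast
  have pos: "0 < L0 F P" if F: "F facet_of \<Delta>" for F
  proof (rule ccontr)
    have A: "affine_fun (L0 F)" using L0(1) F by (simp add: affine_normals_def)
    assume "\<not> 0 < L0 F P"
    then have "L0 F P = 0" using L0(2)[OF F P(1)] by simp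
    then have "area_integral (L0 F) = 0" using P(2)[OF A] by simp
    then have "L0 F x = 0" if "x \<in> interior \<Delta>" for x
      using area_eq_0_interior[OF affine_fun_continuous[OF A] L0(2)[OF F]] that by blast
    then show False using L0(1) F interior_nonempty by (force simp: affine_normals_def)
  qed
  define L where "L = (\<lambda>F x. (1 / L0 F P) * L0 F x)"
  have L: "affine_normals \<Delta> L" unfolding L_def by (rule normals_scale[OF L0(1)]) (simp add: pos)
  have LP: "L F P = 1" if "F facet_of \<Delta>" for F using pos[OF that] by (simp add: L_def)
  define r where "r = facet_density c L P"
  have r: "r F = c * \<bar>det2 (endA F - P) (endB F - P)\<bar>" if "F facet_of \<Delta>" for F
    by (simp add: r_def facet_density_def LP[OF that])
  have split: "c * (\<Sum>F | F facet_of \<Delta>. \<bar>det2 (endA F - P) (endB F - P)\<bar> * (k / 6 + segment_mean (endA F) (endB F) f / 3))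
     = k / 6 * boundary_integral r (\<lambda>x. 1) + boundary_integral r f / 3" for f k
  proof -
    have "k / 6 * boundary_integral r (\<lambda>x. 1) + boundary_integral r f / 3
       = (\<Sum>F | F facet_of \<Delta>. k / 6 * (r F * 1) + r F * segment_mean (endA F) (endB F) f / 3)"
      unfolding boundary_integral_def sum.distrib sum_distrib_left sum_divide_distrib
      by (simp add: segment_mean_def)
    also have "\<dots> = (\<Sum>F | F facet_of \<Delta>. c * (\<bar>det2 (endA F - P) (endB F - P)\<bar> * (k / 6 + segment_mean (endA F) (endB F) f / 3)))"
      by (intro sum.cong refl) (simp add: r algebra_simps)
    finally show ?thesis by (simp add: sum_distrib_left)
  qed
  define R where "R = boundary_integral r (\<lambda>x. 1)"
  have aff: "c * area_integral A = A P / 6 * R + boundary_integral r A / 3" if "affine_fun A" for A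
    unfolding area_fan_affine[OF P(1) that] split R_def ..
  have one: "c * area_integral (\<lambda>x. 1) = R / 2"
    using aff[OF affine_fun_const[of 1]] by (simp add: R_def)
  have bd: "boundary_integral r A = A P * R" if A: "affine_fun A" for A
  proof -
    have "c * area_integral A = (A P * R) / 2" using P(2)[OF A] one by (simp add: mult.left_commute)
    moreover have "c * area_integral A = (A P * R) / 6 + boundary_integral r A / 3" using aff[OF A] by simp
    ultimately show ?thesis by linarith
  qed
  show thesis
  proof (rule that[OF L P(1) LP], unfold r_def[symmetric] R_def[symmetric])
    show "boundary_integral r A = A P * R" if "affine_fun A" for A by (rule bd[OF that])
    show "c * area_integral (\<lambda>x. 4 * A x) = 2 * boundary_integral r A" if A: "affine_fun A" for A
      using aff[OF A] bd[OF A] by (simp add: area_cmult)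
    show "c * area_integral f \<le> f P / 6 * R + boundary_integral r f / 3" if "f \<in> PL \<Delta>" for f
      using mult_left_mono[OF area_fan_PL[OF P(1) that], of c] c split[of "f P" f] by (simp add: R_def)
  qed
qed

text \<open>
  With the constant extremal function 4, the fan inequality for convex functions leaves a third of
  the boundary integral of \<open>f - a\<close>, where \<open>a\<close> is an affine function below \<open>f\<close> that touches it at the
  barycenter.
\<close>

theorem K_polystable_normals_exist:
  assumes c: "c > 0"
  shows "\<exists>L. affine_normals \<Delta> L \<and> K_polystable c \<Delta> L"
proof -
  obtain L P where L: "affine_normals \<Delta> L" "P \<in> \<Delta>" "\<And>F. F facet_of \<Delta> \<Longrightarrow> L F P = 1"
    and bd: "\<And>A. affine_fun A \<Longrightarrow> boundary_integral (facet_density c L P) A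
        = A P * boundary_integral (facet_density c L P) (\<lambda>x. 1)"
    and ext: "\<And>A. affine_fun A \<Longrightarrow> c * area_integral (\<lambda>x. 4 * A x) = 2 * boundary_integral (facet_density c L P) A"
    and le: "\<And>f. f \<in> PL \<Delta> \<Longrightarrow> c * area_integral f \<le>
        f P / 6 * boundary_integral (facet_density c L P) (\<lambda>x. 1) + boundary_integral (facet_density c L P) f / 3"
    using barycentric_normals[OF c] by blast
  define r where "r = facet_density c L P"
  have L0: "L F P \<noteq> 0" if "F facet_of \<Delta>" for F using L(3)[OF that] by simp
  have rpos: "0 < r F" if "F facet_of \<Delta>" for F
    using c L(3)[OF that] det2_facet_nonzero[OF L(1) that L0[OF that]] by (simp add: r_def facet_density_def)
  have fut: "futaki c \<Delta> L f = boundary_integral r f - 2 * (c * area_integral f)" if "continuous_on \<Delta> f" for f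
    using futaki_eq[OF c L(1) L0 affine_fun_const ext that] by (simp add: area_cmult r_def)
  have affine0: "futaki c \<Delta> L f = 0" if a: "affine_fun a" "\<forall>x\<in>\<Delta>. f x = a x" and f: "f \<in> PL \<Delta>" for f a
    using fut[OF PL_continuous[OF f]] area_cong[of f a] boundary_cong[of f a r] a ext[OF a(1)]
    by (simp add: area_cmult r_def)
  have "futaki c \<Delta> L f \<ge> 0 \<and> (futaki c \<Delta> L f = 0 \<longrightarrow> (\<exists>a. affine_fun a \<and> (\<forall>x\<in>\<Delta>. f x = a x)))"
    if f: "f \<in> PL \<Delta>" for f
  proof -
    obtain a where a: "affine_fun a" "a P = f P" "\<And>x. x \<in> \<Delta> \<Longrightarrow> a x \<le> f x"
      using PL_support[OF f L(2)] by blast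
    note cf = PL_continuous[OF f] and ca = affine_fun_continuous[OF a(1), of \<Delta>]
    have cg: "continuous_on \<Delta> (\<lambda>x. f x - a x)" using cf ca by (intro continuous_intros)
    have ba: "boundary_integral r a = f P * boundary_integral r (\<lambda>x. 1)"
      using bd[OF a(1)] a(2) by (simp add: r_def)
    have "boundary_integral r (\<lambda>x. f x - a x) / 3 \<le> futaki c \<Delta> L f"
      using le[OF f, folded r_def] unfolding fut[OF cf] boundary_diff[OF cf ca] ba by simp
    moreover have nn: "0 \<le> boundary_integral r (\<lambda>x. f x - a x)"
      using a(3) rpos by (intro boundary_nonneg[OF cg]) (auto simp: less_imp_le)
    ultimately have ge: "0 \<le> futaki c \<Delta> L f" and
      eq: "futaki c \<Delta> L f = 0 \<Longrightarrow> boundary_integral r (\<lambda>x. f x - a x) = 0" by linarith+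
    have "\<forall>x\<in>\<Delta>. f x = a x" if "futaki c \<Delta> L f = 0"
    proof
      have fr: "f x = a x" if "x \<in> frontier \<Delta>" for x
        using boundary_eq_0[OF cg _ rpos eq[OF \<open>futaki c \<Delta> L f = 0\<close>] that] a(3) by simp
      fix x assume x: "x \<in> \<Delta>"
      obtain S where S: "finite S" "S \<noteq> {}" "\<And>b. b \<in> S \<Longrightarrow> affine_fun b"
        "\<And>x. x \<in> \<Delta> \<Longrightarrow> f x = Max ((\<lambda>a. a x) ` S)" using PL_E[OF f] by blast
      have "b x \<le> a x" if b: "b \<in> S" for b
      proof -
        have d: "affine_fun (\<lambda>x. a x - b x)" using a(1) S(3)[OF b] by (rule affine_fun_diff)
        have "convex {x. 0 \<le> a x - b x}"
          unfolding convex_def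
        proof (intro ballI allI impI CollectI)
          fix x y u v assume "x \<in> {x. 0 \<le> a x - b x}" "y \<in> {x. 0 \<le> a x - b x}"
            and uv: "0 \<le> (u::real)" "0 \<le> v" "u + v = 1"
          then have "0 \<le> u * (a x - b x) + v * (a y - b y)"
            by (intro add_nonneg_nonneg mult_nonneg_nonneg) auto
          then show "0 \<le> a (u *\<^sub>R x + v *\<^sub>R y) - b (u *\<^sub>R x + v *\<^sub>R y)"
            using affine_fun_combination[OF d uv(3)] by simp
        qed
        moreover have "frontier \<Delta> \<subseteq> {x. 0 \<le> a x - b x}"
        proof
          fix y assume y: "y \<in> frontier \<Delta>"
          then have "y \<in> \<Delta>" using closed by (simp add: frontier_def)
          then have "b y \<le> f y" using S(4) S(1) b by simp
          then show "y \<in> {x. 0 \<le> a x - b x}" using fr[OF y] by simp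
        qed
        ultimately have "convex hull (frontier \<Delta>) \<subseteq> {x. 0 \<le> a x - b x}" by (intro hull_minimal)
        then show ?thesis using x Krein_Milman_frontier[OF convex compact] by auto
      qed
      then have "f x \<le> a x" unfolding S(4)[OF x] using S(1,2) by simp
      then show "f x = a x" using a(3)[OF x] by simp
    qed
    then show ?thesis using ge a(1) by blast
  qed
  then have "K_polystable c \<Delta> L" unfolding K_polystable_def using affine0 by blast
  then show ?thesis using L(1) by blast
qed

end

section \<open>Vertices and facets of a quadrilateral\<close>

context polygon
begin

text \<open>
  In the plane the functional defining the facet is a multiple of \<open>det2 (x - v)\<close>, and it has the same
  strict sign at all points of the polygon off the facet.
\<close>

lemma facet_side:
  assumes F: "closed_segment v x facet_of \<Delta>" and y: "y \<in> \<Delta>" "y \<notin> closed_segment v x"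
    and z: "z \<in> \<Delta>" "z \<notin> closed_segment v x"
  shows "0 < det2 (x - v) (y - v) * det2 (x - v) (z - v)"
proof -
  obtain a b where ab: "a \<noteq> 0" "\<Delta> \<subseteq> {x. a \<bullet> x \<le> b}" "closed_segment v x = \<Delta> \<inter> {x. a \<bullet> x = b}"
    using facet_of_polyhedron[OF polytope_imp_polyhedron[OF polytope] F] by blast
  define X where "X = x - v"
  have "v \<in> closed_segment v x" "x \<in> closed_segment v x" by auto
  then have vx: "a \<bullet> v = b" "a \<bullet> x = b" using ab(3) by auto
  have neg: "a \<bullet> (y - v) < 0" "a \<bullet> (z - v) < 0"
    using ab(2,3) y z vx(1) by (force simp: inner_diff_right less_le)+
  have aX: "a \<bullet> X = 0" using vx by (simp add: X_def inner_diff_right)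
  have X: "X \<bullet> X > 0" 
  proof -
    have "aff_dim (closed_segment v x) = 1" by (rule aff_dim_facet[OF F])
    then have "x \<noteq> v" by auto
    then show ?thesis by (simp add: X_def)
  qed
  have key: "(a \<bullet> u) * (X \<bullet> X) = det2 X u * det2 X a" for u
  proof -
    have "(a \<bullet> u) * (X \<bullet> X) - det2 X u * det2 X a = (a \<bullet> X) * (u \<bullet> X)"
      by (simp add: inner_vec_def sum_2 det2_def algebra_simps)
    then show ?thesis using aX by simp
  qed
  have "0 < ((a \<bullet> (y - v)) * (X \<bullet> X)) * ((a \<bullet> (z - v)) * (X \<bullet> X))"
    using neg X by (intro mult_neg_neg mult_neg_pos)
  also have "\<dots> = (det2 X (y - v) * det2 X (z - v)) * (det2 X a)\<^sup>2"
    unfolding key by (simp add: power2_eq_square)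
  finally show ?thesis by (simp add: X_def zero_less_mult_iff)
qed

lemma extreme_point_of_facet:
  assumes "closed_segment x y facet_of \<Delta>"
  shows "v extreme_point_of \<Delta> \<and> v \<in> closed_segment x y \<longleftrightarrow> v = x \<or> v = y"
  using extreme_point_of_face[of "closed_segment x y" \<Delta> v] assms
  by (auto simp: facet_of_def extreme_point_of_segment)

lemma facet_from_vertex:
  assumes F: "F facet_of \<Delta>" and v: "v extreme_point_of \<Delta>" "v \<in> F"
  obtains x where "F = closed_segment v x" "x \<noteq> v" "x extreme_point_of \<Delta>"
proof -
  obtain s t where st: "F = closed_segment s t" "s \<noteq> t" using facet_is_segment[OF F] by auto
  have vst: "v = s \<or> v = t" and ext: "s extreme_point_of \<Delta>" "t extreme_point_of \<Delta>"
    using extreme_point_of_facet[of s t] F v st by auto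
  show thesis
  proof (cases "v = s")
    case True then show thesis using that[of t] st ext by auto
  next
    case False then show thesis using that[of s] st ext vst closed_segment_commute by auto
  qed
qed

lemma facets_sharing_two_points:
  assumes "F facet_of \<Delta>" "G facet_of \<Delta>" "x \<in> F" "x \<in> G" "y \<in> F" "y \<in> G" "x \<noteq> y"
  shows "F = G"
  using facets_Int[of F G] assms by blast

lemma vertex_facets:
  assumes v: "v extreme_point_of \<Delta>"
  shows "\<Inter>{F. F facet_of \<Delta> \<and> v \<in> F} = {v}"
proof -
  have "{v} face_of \<Delta>" using v by (simp add: face_of_singleton)
  moreover have "{v} \<noteq> \<Delta>" using dim2 by auto
  ultimately show ?thesis
    using face_of_polyhedron[OF polytope_imp_polyhedron[OF polytope], of "{v}"] by auto
qed

lemma vertex_in_facet: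
  assumes v: "v extreme_point_of \<Delta>"
  shows "\<exists>F. F facet_of \<Delta> \<and> v \<in> F"
proof (rule ccontr)
  assume "\<not> (\<exists>F. F facet_of \<Delta> \<and> v \<in> F)"
  then have "{F. F facet_of \<Delta> \<and> v \<in> F} = {}" by auto
  then have "UNIV = {v}" using vertex_facets[OF v] by (simp only: Inter_empty)
  then have "v + axis 1 1 \<in> {v}" by blast
  then have "v + axis 1 1 = v" by simp
  then show False by (simp add: axis_eq_0_iff)
qed

lemma second_facet_at_vertex:
  assumes F: "F facet_of \<Delta>" and v: "v extreme_point_of \<Delta>" "v \<in> F"
  shows "\<exists>G. G facet_of \<Delta> \<and> G \<noteq> F \<and> v \<in> G"
proof (rule ccontr)
  assume "\<not> (\<exists>G. G facet_of \<Delta> \<and> G \<noteq> F \<and> v \<in> G)"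
  then have "{F. F facet_of \<Delta> \<and> v \<in> F} = {F}" using F v by auto
  then have "F = {v}" using vertex_facets[OF v(1)] by simp
  then show False using aff_dim_facet[OF F] by simp
qed

text \<open>
  Suppose three facets end at \<open>v\<close>. By \<open>facet_side\<close> each of the three directions has the other two on
  one side. The product of the three positive quantities so obtained is minus a square.
\<close>

lemma no_third_facet_at_vertex:
  assumes FGH: "F facet_of \<Delta>" "G facet_of \<Delta>" "H facet_of \<Delta>"
    and v: "v extreme_point_of \<Delta>" "v \<in> F" "v \<in> G" "v \<in> H" and FG: "F \<noteq> G" "F \<noteq> H"
  shows "G = H"
proof (rule ccontr)
  assume GH: "G \<noteq> H"
  obtain x where x: "F = closed_segment v x" "x \<noteq> v" using facet_from_vertex[OF FGH(1) v(1,2)] by blast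
  obtain y where y: "G = closed_segment v y" "y \<noteq> v" using facet_from_vertex[OF FGH(2) v(1,3)] by blast
  obtain z where z: "H = closed_segment v z" "z \<noteq> v" using facet_from_vertex[OF FGH(3) v(1,4)] by blast
  have mem: "x \<in> F" "y \<in> G" "z \<in> H" using x y z by auto
  then have \<Delta>: "x \<in> \<Delta>" "y \<in> \<Delta>" "z \<in> \<Delta>" using facet_subset FGH by blast+
  have no: "w \<notin> A" if "A facet_of \<Delta>" "B facet_of \<Delta>" "v \<in> A" "v \<in> B" "w \<in> B" "w \<noteq> v" "A \<noteq> B" for A B w
    using facets_sharing_two_points[OF that(1,2), of v w] that by auto
  have "y \<notin> F" "z \<notin> F" "x \<notin> G" "z \<notin> G" "x \<notin> H" "y \<notin> H"
    using no[of F G y] no[of F H z] no[of G F x] no[of G H z] no[of H F x] no[of H G y]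
      FGH v FG GH mem x y z by auto
  then have "0 < det2 (x - v) (y - v) * det2 (x - v) (z - v)"
    "0 < det2 (y - v) (x - v) * det2 (y - v) (z - v)"
    "0 < det2 (z - v) (x - v) * det2 (z - v) (y - v)"
    using facet_side[of v x y z] facet_side[of v y x z] facet_side[of v z x y] FGH x y z \<Delta> by auto
  then have pos: "0 < (det2 (x - v) (y - v) * det2 (x - v) (z - v)) *
     (det2 (y - v) (x - v) * det2 (y - v) (z - v)) * (det2 (z - v) (x - v) * det2 (z - v) (y - v))"
    by simp
  have "(det2 (x - v) (y - v) * det2 (x - v) (z - v)) *
     (det2 (y - v) (x - v) * det2 (y - v) (z - v)) * (det2 (z - v) (x - v) * det2 (z - v) (y - v))
     = - (det2 (x - v) (y - v) * det2 (x - v) (z - v) * det2 (y - v) (z - v))\<^sup>2"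
    unfolding det2_swap[of "y - v" "x - v"] det2_swap[of "z - v" "x - v"] det2_swap[of "z - v" "y - v"]
    by (simp add: power2_eq_square)
  then show False using pos by (metis less_le_not_le neg_le_0_iff_le zero_le_power2)
qed

text \<open>
  Walk along the boundary: at each vertex there is exactly one other facet. It cannot return
  to the start after three steps, since the fourth facet would then have to end at a vertex where two
  other facets already meet.
\<close>

lemma four_facets_cycle:
  assumes card: "card {F. F facet_of \<Delta>} = 4"
  obtains a b c d where "distinct [a, b, c, d]"
    "{F. F facet_of \<Delta>} = {closed_segment a b, closed_segment b c, closed_segment c d, closed_segment d a}"
    "{x. x extreme_point_of \<Delta>} = {a, b, c, d}"
proof -
  define E where "E x \<longleftrightarrow> x extreme_point_of \<Delta>" for x
  define M where "M F \<longleftrightarrow> F facet_of \<Delta>" for F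
  have next_facet: "\<exists>G x. M G \<and> G \<noteq> F \<and> G = closed_segment v x \<and> x \<noteq> v \<and> E x"
    if "M F" "E v" "v \<in> F" for F v
    using second_facet_at_vertex[of F v] facet_from_vertex[of _ v] that unfolding E_def M_def by metis
  have ends: "v = x \<or> v = y" if "M (closed_segment x y)" "E v" "v \<in> closed_segment x y" for v x y
    using extreme_point_of_facet[of x y v] that by (auto simp: E_def M_def)
  have two: "F = G" if "M F" "M G" "x \<in> F" "x \<in> G" "y \<in> F" "y \<in> G" "x \<noteq> y" for F G x y
    using facets_sharing_two_points that by (auto simp: M_def)
  have three: "G = H" if "M F" "M G" "M H" "E v" "v \<in> F" "v \<in> G" "v \<in> H" "F \<noteq> G" "F \<noteq> H" for F G H v
    using no_third_facet_at_vertex that unfolding E_def M_def by blast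
  obtain F1 where F1: "M F1" using card by (auto simp: M_def) (metis Collect_empty_eq card.empty zero_neq_numeral)
  obtain a b where ab: "F1 = closed_segment a b" "a \<noteq> b" using facet_is_segment[of F1] F1 by (auto simp: M_def)
  have Eab: "E a" "E b" using extreme_point_of_facet[of a b] F1 ab by (auto simp: E_def M_def)
  have abF: "a \<in> F1" "b \<in> F1" using ab by auto
  obtain F2 c where F2: "M F2" "F2 \<noteq> F1" "F2 = closed_segment b c" "c \<noteq> b" "E c"
    using next_facet[OF F1 Eab(2) abF(2)] by blast
  have bcF: "b \<in> F2" "c \<in> F2" using F2 by auto
  obtain F3 d where F3: "M F3" "F3 \<noteq> F2" "F3 = closed_segment c d" "d \<noteq> c" "E d"
    using next_facet[OF F2(1) F2(5) bcF(2)] by blast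
  have cdF: "c \<in> F3" "d \<in> F3" using F3 by auto
  obtain F4 e where F4: "M F4" "F4 \<noteq> F3" "F4 = closed_segment d e" "e \<noteq> d" "E e"
    using next_facet[OF F3(1) F3(5) cdF(2)] by blast
  have deF: "d \<in> F4" "e \<in> F4" using F4 by auto
  have ca: "c \<noteq> a" using two[OF F1 F2(1), of a b] abF bcF ab F2 by auto
  have db: "d \<noteq> b" using two[OF F2(1) F3(1), of b c] bcF cdF F2 F3 by auto
  have cF1: "c \<notin> F1" using ends[of a b c] F1 ab F2 ca by auto
  have F31: "F3 \<noteq> F1" using cF1 cdF by auto
  have da: "d \<noteq> a"
  proof
    assume da: "d = a"
    have ne: "F1 \<noteq> F2" "F1 \<noteq> F3" "F2 \<noteq> F3" using F2(2) F3(2) F31 by blast+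
    then have "card {F1, F2, F3} = 3" by simp
    then obtain H where H: "M H" "H \<notin> {F1, F2, F3}"
      using card card_mono[of "{F1, F2, F3}" "{F. F facet_of \<Delta>}"] unfolding M_def
      by (metis (no_types, lifting) Suc_n_not_le_n eval_nat_numeral(2) eval_nat_numeral(3) finite.emptyI finite_insert mem_Collect_eq semiring_norm(26) semiring_norm(27) subsetI)
    have all: "{F. M F} = {F1, F2, F3, H}"
    proof (rule sym, rule card_subset_eq)
      show "finite {F. M F}" using finite_facets by (simp add: M_def)
      show "{F1, F2, F3, H} \<subseteq> {F. M F}" using F1 F2 F3 H by auto
      show "card {F1, F2, F3, H} = card {F. M F}" 
      proof -
        have "F1 \<noteq> H" "F2 \<noteq> H" "F3 \<noteq> H" using H(2) by blast+
        then show ?thesis using card ne unfolding M_def by simp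
      qed
    qed
    obtain x y where xy: "H = closed_segment x y" "x \<noteq> y" using facet_is_segment[of H] H by (auto simp: M_def)
    have Ex: "E x" "x \<in> H" using extreme_point_of_facet[of x y] H xy by (auto simp: E_def M_def)
    obtain G z where G: "M G" "G \<noteq> H" "G = closed_segment x z" using next_facet[OF H(1) Ex] by blast
    have "x \<in> G" using G by auto
    have "G \<in> {F1, F2, F3}" using all G by auto
    then have "x \<in> {a, b, c}"
      using ends[of a b x] ends[of b c x] ends[of c d x] Ex \<open>x \<in> G\<close> F1 F2 F3 ab da by auto
    then consider "x = a" | "x = b" | "x = c" by auto
    then show False
    proof cases
      case 1 then show False using three[OF H(1) F1 F3(1) Ex(1,2)] abF cdF da H F31 by auto
    next
      case 2 then show False using three[OF H(1) F1 F2(1) Ex(1,2)] abF bcF H F2 by auto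
    next
      case 3 then show False using three[OF H(1) F2(1) F3(1) Ex(1,2)] bcF cdF H F3 by auto
    qed
  qed
  have dF1: "d \<notin> F1" using ends[of a b d] F1 ab F3 da db by auto
  have dF2: "d \<notin> F2" using ends[of b c d] F2 F3 db by auto
  have F4n: "F4 \<noteq> F1" "F4 \<noteq> F2" using dF1 dF2 deF by auto
  have all: "{F. M F} = {F1, F2, F3, F4}"
  proof (rule sym, rule card_subset_eq)
    show "finite {F. M F}" using finite_facets by (simp add: M_def)
    show "{F1, F2, F3, F4} \<subseteq> {F. M F}" using F1 F2 F3 F4 by auto
    show "card {F1, F2, F3, F4} = card {F. M F}" 
    proof -
      have "F1 \<noteq> F2" "F1 \<noteq> F3" "F2 \<noteq> F3" "F1 \<noteq> F4" "F2 \<noteq> F4" "F3 \<noteq> F4"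
        using F2(2) F3(2) F31 F4n F4(2) by blast+
      then show ?thesis using card unfolding M_def by simp
    qed
  qed
  obtain G z where G: "M G" "G \<noteq> F1" "G = closed_segment a z" using next_facet[OF F1 Eab(1) abF(1)] by blast
  have "a \<notin> F2" using ends[of b c a] F2 Eab ca ab by auto
  moreover have "a \<notin> F3" using ends[of c d a] F3 Eab ca da by auto
  ultimately have "G = F4" using all G by auto
  then have "a \<in> closed_segment d e" using G F4 by auto
  then have ea: "e = a" using ends[of d e a] F4 Eab da by auto
  have facets: "{F. F facet_of \<Delta>} = {closed_segment a b, closed_segment b c, closed_segment c d, closed_segment d a}"
    using all F4 F3 F2 ab ea by (simp add: M_def)
  have ext: "{x. x extreme_point_of \<Delta>} = {a, b, c, d}"
  proof
    show "{a, b, c, d} \<subseteq> {x. x extreme_point_of \<Delta>}" using Eab F2 F3 by (auto simp: E_def)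
    show "{x. x extreme_point_of \<Delta>} \<subseteq> {a, b, c, d}"
    proof
      fix x assume "x \<in> {x. x extreme_point_of \<Delta>}"
      then have x: "E x" by (simp add: E_def)
      obtain F where F: "M F" "x \<in> F" using vertex_in_facet[of x] x by (auto simp: E_def M_def)
      then consider "F = F1" | "F = F2" | "F = F3" | "F = F4" using all by blast
      then show "x \<in> {a, b, c, d}"
      proof cases
        case 1 then show ?thesis using ends[of a b x] F x ab(1) by blast
      next
        case 2 then show ?thesis using ends[of b c x] F x F2(3) by blast
      next
        case 3 then show ?thesis using ends[of c d x] F x F3(3) by blast
      next
        case 4 then show ?thesis using ends[of d e x] F x F4(3) ea by blast
      qed
    qed
  qed
  have "distinct [a, b, c, d]"
  proof -
    have "a \<noteq> b" "a \<noteq> c" "a \<noteq> d" "b \<noteq> c" "b \<noteq> d" "c \<noteq> d"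
      using ab(2) F2(4) F3(4) ca db da by blast+
    then show ?thesis by simp
  qed
  from that[OF this facets ext] show thesis .
qed

end

text \<open>
  Corners \<open>z0\<close>, \<open>z0 + e1\<close>, \<open>z0 + p e1 + q e2\<close>, \<open>z0 + e2\<close> in cyclic order. The conditions on \<open>p\<close>, \<open>q\<close>
  express strict convexity.
\<close>

locale framed_quadrilateral = polygon \<Delta> for \<Delta> :: "(real^2) set" +
  fixes z0 e1 e2 :: "real^2" and p q :: real
  assumes frame: "det2 e1 e2 \<noteq> 0" and pq: "0 < p" "0 < q" "1 < p + q"
    and hull: "\<Delta> = convex hull {z0, z0 + e1, z0 + p *\<^sub>R e1 + q *\<^sub>R e2, z0 + e2}"
    and facets: "{F. F facet_of \<Delta>} = {closed_segment z0 (z0 + e1),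
       closed_segment (z0 + e1) (z0 + p *\<^sub>R e1 + q *\<^sub>R e2),
       closed_segment (z0 + p *\<^sub>R e1 + q *\<^sub>R e2) (z0 + e2), closed_segment (z0 + e2) z0}"

lemma framed_quadrilateral_swap:
  assumes "framed_quadrilateral \<Delta> z0 e1 e2 p q"
  shows "framed_quadrilateral \<Delta> z0 e2 e1 q p"
proof -
  interpret framed_quadrilateral \<Delta> z0 e1 e2 p q by fact
  have eq: "z0 + q *\<^sub>R e2 + p *\<^sub>R e1 = z0 + p *\<^sub>R e1 + q *\<^sub>R e2" by simp
  show ?thesis
  proof
    show "det2 e2 e1 \<noteq> 0" using frame det2_swap[of e1 e2] by simp
    show "\<Delta> = convex hull {z0, z0 + e2, z0 + q *\<^sub>R e2 + p *\<^sub>R e1, z0 + e1}"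
      unfolding eq using hull by (simp add: insert_commute)
    show "{F. F facet_of \<Delta>} = {closed_segment z0 (z0 + e2),
       closed_segment (z0 + e2) (z0 + q *\<^sub>R e2 + p *\<^sub>R e1),
       closed_segment (z0 + q *\<^sub>R e2 + p *\<^sub>R e1) (z0 + e1), closed_segment (z0 + e1) z0}"
      unfolding eq facets
      by (simp add: closed_segment_commute insert_commute)
  qed (use pq in auto)
qed

text \<open>
  The three inequalities for \<open>p\<close>, \<open>q\<close> are \<open>facet_side\<close> for the sides from \<open>z0\<close> to \<open>z0 + e2\<close>, from
  \<open>z0\<close> to \<open>z0 + e1\<close>, and from \<open>z0 + e1\<close> to the opposite corner.
\<close>

lemma convex_quadrilateral_framed:
  assumes "convex_quadrilateral \<Delta>"
  obtains z0 e1 e2 p q where "framed_quadrilateral \<Delta> z0 e1 e2 p q"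
    "{x. x extreme_point_of \<Delta>} = {z0, z0 + e1, z0 + p *\<^sub>R e1 + q *\<^sub>R e2, z0 + e2}"
    "card {x. x extreme_point_of \<Delta>} = 4"
proof -
  interpret polygon \<Delta> using assms by unfold_locales (auto simp: convex_quadrilateral_def)
  obtain a b c d where dist: "distinct [a, b, c, d]"
    and fac: "{F. F facet_of \<Delta>} = {closed_segment a b, closed_segment b c, closed_segment c d, closed_segment d a}"
    and ext: "{x. x extreme_point_of \<Delta>} = {a, b, c, d}"
  proof -
    have "card {F. F facet_of \<Delta>} = 4" using assms by (simp add: convex_quadrilateral_def)
    then show thesis using four_facets_cycle that by blast
  qed
  have f: "closed_segment a b facet_of \<Delta>" "closed_segment b c facet_of \<Delta>" "closed_segment d a facet_of \<Delta>"
    using fac by auto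
  have E: "a extreme_point_of \<Delta>" "b extreme_point_of \<Delta>" "c extreme_point_of \<Delta>" "d extreme_point_of \<Delta>"
    using ext by auto
  then have \<Delta>: "a \<in> \<Delta>" "b \<in> \<Delta>" "c \<in> \<Delta>" "d \<in> \<Delta>" by (auto simp: extreme_point_of_def)
  have f3: "closed_segment a d facet_of \<Delta>" using f(3) by (simp add: closed_segment_commute)
  have nin: "v \<notin> closed_segment x y"
    if "closed_segment x y facet_of \<Delta>" "v extreme_point_of \<Delta>" "v \<noteq> x" "v \<noteq> y" for v x y
    using extreme_point_of_facet[OF that(1), of v] that by blast
  have ds: "a \<noteq> b" "b \<noteq> a" "a \<noteq> c" "c \<noteq> a" "a \<noteq> d" "d \<noteq> a" "b \<noteq> c" "c \<noteq> b" "b \<noteq> d" "d \<noteq> b" "c \<noteq> d" "d \<noteq> c"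
    using dist by auto
  have no: "c \<notin> closed_segment a b" "d \<notin> closed_segment a b" "a \<notin> closed_segment b c" "d \<notin> closed_segment b c"
    "b \<notin> closed_segment a d" "c \<notin> closed_segment a d"
    using nin[OF f(1) E(3)] nin[OF f(1) E(4)] nin[OF f(2) E(1)] nin[OF f(2) E(4)] nin[OF f3 E(2)] nin[OF f3 E(3)] ds
    by blast+
  define e1 e2 where "e1 = b - a" and "e2 = d - a"
  have s1: "0 < det2 e1 (c - a) * det2 e1 e2"
    using facet_side[OF f(1) \<Delta>(3) no(1) \<Delta>(4) no(2)] by (simp add: e1_def e2_def)
  then have J: "det2 e1 e2 \<noteq> 0" by auto
  define p q where "p = det2 (c - a) e2 / det2 e1 e2" and "q = det2 e1 (c - a) / det2 e1 e2"
  have c: "c = a + p *\<^sub>R e1 + q *\<^sub>R e2"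
    unfolding p_def q_def by (rule frame_coordinates[OF J])
  have "q * (det2 e1 e2)\<^sup>2 > 0" using s1 J by (simp add: q_def power2_eq_square)
  then have q: "q > 0" by (simp add: zero_less_mult_iff)
  have "0 < det2 e2 e1 * det2 e2 (c - a)"
    using facet_side[OF f3 \<Delta>(2) no(5) \<Delta>(3) no(6)] by (simp add: e1_def e2_def)
  then have "p * (det2 e1 e2)\<^sup>2 > 0" using J
    by (simp add: p_def power2_eq_square det2_swap[of e1 e2] det2_swap[of "c - a" e2] mult.commute)
  then have p: "p > 0" by (simp add: zero_less_mult_iff)
  have "0 < det2 (c - b) (a - b) * det2 (c - b) (d - b)"
    by (rule facet_side[OF f(2) \<Delta>(1) no(3) \<Delta>(4) no(4)])
  moreover have "c - b = (p - 1) *\<^sub>R e1 + q *\<^sub>R e2" using c by (simp add: e1_def algebra_simps)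
  moreover have "a - b = - e1" "d - b = e2 - e1" by (simp_all add: e1_def e2_def)
  ultimately have "0 < (q * det2 e1 e2) * ((p - 1) * det2 e1 e2 + q * det2 e1 e2)"
    by (simp add: det2_simps det2_swap[of e1 e2])
  also have "\<dots> = q * (p + q - 1) * (det2 e1 e2)\<^sup>2" by (simp add: algebra_simps power2_eq_square)
  finally have pq: "1 < p + q" using q by (simp add: zero_less_mult_iff)
  have pts: "a + e1 = b" "a + e2 = d" "a + p *\<^sub>R e1 + q *\<^sub>R e2 = c" using c by (auto simp: e1_def e2_def)
  have "framed_quadrilateral \<Delta> a e1 e2 p q"
  proof
    show "\<Delta> = convex hull {a, a + e1, a + p *\<^sub>R e1 + q *\<^sub>R e2, a + e2}"
      unfolding pts using Krein_Milman_Minkowski[OF compact convex] ext by simp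
    show "{F. F facet_of \<Delta>} = {closed_segment a (a + e1),
       closed_segment (a + e1) (a + p *\<^sub>R e1 + q *\<^sub>R e2),
       closed_segment (a + p *\<^sub>R e1 + q *\<^sub>R e2) (a + e2), closed_segment (a + e2) a}"
      unfolding pts by (rule fac)
  qed (use p q pq J in auto)
  moreover have "{x. x extreme_point_of \<Delta>} = {a, a + e1, a + p *\<^sub>R e1 + q *\<^sub>R e2, a + e2}"
    unfolding pts by (rule ext)
  moreover have "card {x. x extreme_point_of \<Delta>} = 4" unfolding ext using dist by auto
  ultimately show thesis using that by blast
qed

text \<open>
  In a parallelogram two pairs of corners have the same sum. Of the three ways to split the corners
  of the frame into pairs, only the one into opposite corners is compatible with \<open>p > 0\<close> and \<open>q > 0\<close>.
\<close>

lemma framed_parallelogram_iff: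
  assumes fq: "framed_quadrilateral \<Delta> z0 e1 e2 p q"
    and ext: "{x. x extreme_point_of \<Delta>} = {z0, z0 + e1, z0 + p *\<^sub>R e1 + q *\<^sub>R e2, z0 + e2}"
    and card: "card {x. x extreme_point_of \<Delta>} = 4"
  shows "parallelogram \<Delta> \<longleftrightarrow> p = 1 \<and> q = 1"
proof
  interpret framed_quadrilateral \<Delta> z0 e1 e2 p q by fact
  assume "p = 1 \<and> q = 1"
  then have "\<Delta> = convex hull {z0, z0 + e1, z0 + e1 + e2, z0 + e2}" using hull by simp
  moreover have "e1 \<noteq> e2" using frame by (auto simp: det2_def)
  moreover have "independent {e1, e2}"
  proof -
    have "e2 \<noteq> 0" using frame by (auto simp: det2_simps)
    moreover have "e1 \<notin> span {e2}"
      using frame by (auto simp: span_singleton det2_simps)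
    ultimately show ?thesis by (simp add: independent_insert)
  qed
  ultimately show "parallelogram \<Delta>" unfolding parallelogram_def by blast
next
  interpret framed_quadrilateral \<Delta> z0 e1 e2 p q by fact
  assume "parallelogram \<Delta>"
  then obtain x v w where "\<Delta> = convex hull {x, x + v, x + v + w, x + w}"
    unfolding parallelogram_def by blast
  then have "{x. x extreme_point_of \<Delta>} \<subseteq> {x, x + v, x + v + w, x + w}"
    using extreme_points_of_convex_hull by blast
  moreover have "card {x, x + v, x + v + w, x + w} \<le> 4" by (simp add: card_insert_if)
  ultimately have eq: "{z0, z0 + e1, z0 + p *\<^sub>R e1 + q *\<^sub>R e2, z0 + e2} = {x, x + v, x + v + w, x + w}"
    using card card_seteq[of "{x, x + v, x + v + w, x + w}"] ext by simp
  define a b c d where "a = z0" and "b = z0 + e1" and "c = z0 + p *\<^sub>R e1 + q *\<^sub>R e2" and "d = z0 + e2"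
  have dist: "distinct [a, b, c, d]"
    using card unfolding ext a_def b_def c_def d_def
    by (intro card_distinct) simp
  have set: "{a, b, c, d} = {x, x + v, x + v + w, x + w}" using eq by (simp add: a_def b_def c_def d_def)
  have "a + b = c + d \<or> a + c = b + d \<or> a + d = b + c"
  proof -
    have sum: "x + (x + v + w) = (x + v) + (x + w)" by simp
    have set': "{a, b, c, d} = {x, x + v + w, x + v, x + w}" unfolding set by blast
    have P: "(a + b = c + d \<or> a + c = b + d \<or> a + d = b + c)"
      if "{a, b, c, d} = {r, s, y, z}" "r + s = y + z" for r s y z
    proof -
      have drs: "distinct [r, s, y, z]"
      proof (rule card_distinct)
        have "card (set [r, s, y, z]) = card (set [a, b, c, d])" using that(1) by simp
        also have "\<dots> = 4" using distinct_card[OF dist] by simp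
        finally show "card (set [r, s, y, z]) = length [r, s, y, z]" by simp
      qed
      have "\<Sum>{a, b, c, d} = \<Sum>{r, s, y, z}" using that(1) by simp
      moreover have "\<Sum>{a, b, c, d} = a + b + c + d" using dist by (simp add: add.assoc)
      moreover have "\<Sum>{r, s, y, z} = r + s + (y + z)" using drs by (simp add: add.assoc)
      ultimately have T: "a + b + c + d = (r + s) + (r + s)" using that(2) by simp
      have "r \<in> {a, b, c, d}" "s \<in> {a, b, c, d}" "r \<noteq> s" using that(1) drs by auto
      then have "r + s \<in> {a + b, c + d, a + c, b + d, a + d, b + c}"
        by (elim insertE emptyE) (simp_all add: add.commute)
      then consider "r + s = a + b" | "r + s = c + d" | "r + s = a + c" | "r + s = b + d" | "r + s = a + d" | "r + s = b + c"
        by blast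
      then show ?thesis using T by cases (simp_all add: algebra_simps)
    qed
    show ?thesis by (rule P[OF set' sum])
  qed
  moreover have coeff: "s = 0 \<and> t = 0" if "s *\<^sub>R e1 + t *\<^sub>R e2 = 0" for s t
  proof -
    have "s * det2 e1 e2 = det2 (s *\<^sub>R e1 + t *\<^sub>R e2) e2" "t * det2 e1 e2 = det2 e1 (s *\<^sub>R e1 + t *\<^sub>R e2)"
      by (simp_all add: det2_simps)
    then have "s * det2 e1 e2 = 0" "t * det2 e1 e2 = 0" unfolding that by (simp_all only: det2_simps(10,11))
    then show ?thesis using frame by simp
  qed
  moreover have "a + b = c + d \<Longrightarrow> (p - 1) *\<^sub>R e1 + (q + 1) *\<^sub>R e2 = 0"
    by (simp add: a_def b_def c_def d_def algebra_simps)
  moreover have "a + d = b + c \<Longrightarrow> (p + 1) *\<^sub>R e1 + (q - 1) *\<^sub>R e2 = 0"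
    by (simp add: a_def b_def c_def d_def algebra_simps)
  moreover have "a + c = b + d \<Longrightarrow> (p - 1) *\<^sub>R e1 + (q - 1) *\<^sub>R e2 = 0"
    by (simp add: a_def b_def c_def d_def algebra_simps)
  ultimately show "p = 1 \<and> q = 1" using pq by force
qed

section \<open>Parallelograms\<close>

lemma integral_reflect_unit:
  fixes g :: "real \<Rightarrow> real"
  assumes g: "continuous_on {0..1} g"
  shows "integral {0..1} (\<lambda>t. g (1 - t)) = integral {0..1} g"
proof -
  have g': "continuous_on {0..1} (\<lambda>t. g (1 - t))"
    by (intro continuous_on_compose2[OF g] continuous_intros) auto
  have "integral {0..1} g = (\<integral>x. indicator {0..1} x * g x \<partial>lborel)"
    using LINT_interval_eq_integral[OF g] by simp
  also have "\<dots> = (\<integral>x. indicator {0..1} (1 - x) * g (1 - x) \<partial>lborel)"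
    using lborel_integral_real_affine[of "-1" "\<lambda>x. indicator {0..1} x * g x" 1] by simp
  also have "\<dots> = (\<integral>x. indicator {0..1} x * g (1 - x) \<partial>lborel)"
    by (intro Bochner_Integration.integral_cong) (auto simp: indicator_def)
  also have "\<dots> = integral {0..1} (\<lambda>t. g (1 - t))"
    by (rule LINT_interval_eq_integral[OF g'])
  finally show ?thesis ..
qed

text \<open>
  The one-dimensional relative Futaki invariant of the unit interval with unit mass at 0, whose
  extremal function is \<open>2 (4 - 6 s)\<close>.
\<close>

definition endpoint_defect :: "(real \<Rightarrow> real) \<Rightarrow> real" where
  "endpoint_defect g = g 0 - integral {0..1} (\<lambda>s. (4 - 6 * s) * g s)"

lemma endpoint_weight_affine: "((\<lambda>s. (4 - 6 * s) * (k + l * s)) has_integral k) {0..1::real}"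
proof -
  have "((\<lambda>s. (4 - 6 * s) * (k + l * s)) has_integral
     ((\<lambda>s. 4 * k * s + (2 * l - 3 * k) * s^2 - 2 * l * s^3) 1
       - (\<lambda>s. 4 * k * s + (2 * l - 3 * k) * s^2 - 2 * l * s^3) 0)) {0..1}"
    by (rule has_integral_FTC) (auto intro!: derivative_eq_intros simp: algebra_simps power2_eq_square)
  then show ?thesis by simp
qed

lemma endpoint_defect_affine: "(\<And>s. s \<in> {0..1} \<Longrightarrow> g s = k + l * s) \<Longrightarrow> endpoint_defect g = 0"
proof -
  assume g: "\<And>s. s \<in> {0..1} \<Longrightarrow> g s = k + l * s"
  have "integral {0..1} (\<lambda>s. (4 - 6 * s) * g s) = integral {0..1} (\<lambda>s. (4 - 6 * s) * (k + l * s))"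
    using g by (intro integral_cong) simp
  also have "\<dots> = k" using endpoint_weight_affine by (rule integral_unique)
  finally show ?thesis using g[of 0] by (simp add: endpoint_defect_def)
qed

text \<open>
  The chord through the points of the graph at 0 and 2/3 lies above \<open>g\<close> between these points and
  below \<open>g\<close> beyond 2/3, where the weight \<open>4 - 6 s\<close> is negative. So the weight times chord minus \<open>g\<close> is
  nonnegative, and the weighted integral of the chord is its value \<open>g 0\<close>.
\<close>

lemma endpoint_defect_convex:
  assumes g: "continuous_on {0..1} g" and conv: "convex_on {0..1} g"
  shows "0 \<le> endpoint_defect g"
    and "endpoint_defect g = 0 \<Longrightarrow> s \<in> {0..1} \<Longrightarrow> g s = (1 - s) * g 0 + s * g 1"
proof -
  \<comment> \<open>The slope of the chord through 0 and 2/3.\<close>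
  define l where "l = 3/2 * (g (2/3) - g 0)"
  define h where "h s = (4 - 6 * s) * ((g 0 + l * s) - g s)" for s
  have hc: "continuous_on {0..1} h"
    unfolding h_def using g by (intro continuous_intros)
  have h0: "0 \<le> h s" if s: "s \<in> {0..1}" for s
  proof (cases "s \<le> 2/3")
    case True
    have "g ((1 - 3/2 * s) *\<^sub>R 0 + (3/2 * s) *\<^sub>R (2/3)) \<le> (1 - 3/2 * s) * g 0 + (3/2 * s) * g (2/3)"
      using s True by (intro convex_onD[OF conv]) auto
    also have "\<dots> = g 0 + l * s" by (simp add: l_def algebra_simps)
    finally have "g s \<le> g 0 + l * s" by simp
    then show ?thesis unfolding h_def using True by (intro mult_nonneg_nonneg) auto
  next
    case False
    then have s0: "0 < s" by simp
    have "g ((1 - 2/(3 * s)) *\<^sub>R 0 + (2/(3 * s)) *\<^sub>R s) \<le> (1 - 2/(3 * s)) * g 0 + (2/(3 * s)) * g s"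
      using s False by (intro convex_onD[OF conv]) auto
    then have "g (2/3) \<le> (1 - 2/(3 * s)) * g 0 + (2/(3 * s)) * g s" using s0 by simp
    then have "(3 * s/2) * g (2/3) \<le> (3 * s/2) * ((1 - 2/(3 * s)) * g 0 + (2/(3 * s)) * g s)"
      using s0 by (intro mult_left_mono) auto
    also have "\<dots> = (3 * s/2 - 1) * g 0 + g s" using s0 by (simp add: field_simps)
    finally have "g 0 + l * s \<le> g s" by (simp add: l_def algebra_simps)
    then show ?thesis unfolding h_def using False by (intro mult_nonpos_nonpos) auto
  qed
  have wi: "((\<lambda>s. (4 - 6 * s) * g s) has_integral integral {0..1} (\<lambda>s. (4 - 6 * s) * g s)) {0..1}"
    using g by (intro integrable_integral integrable_continuous_real continuous_intros)
  have "((\<lambda>s. (4 - 6 * s) * (g 0 + l * s) - (4 - 6 * s) * g s) has_integral endpoint_defect g) {0..1}"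
    unfolding endpoint_defect_def by (rule has_integral_diff[OF endpoint_weight_affine wi])
  then have hi: "integral {0..1} h = endpoint_defect g"
    unfolding h_def right_diff_distrib by (rule integral_unique)
  show "0 \<le> endpoint_defect g"
    unfolding hi[symmetric] using h0 hc by (intro integral_nonneg integrable_continuous_real)
  assume 0: "endpoint_defect g = 0" and s: "s \<in> {0..1}"
  have hx: "h x = 0" if "x \<in> {0..1}" for x
    using integral_eq_0_iff[OF hc] h0 hi 0 that by auto
  then have "g x = g 0 + l * x" if "x \<in> {0..1}" for x
  proof (cases "x = 2/3")
    case True show ?thesis unfolding True l_def by (simp add: diff_divide_distrib)
  next
    case False
    then have "4 - 6 * x \<noteq> 0" by simp
    then show ?thesis using hx[OF that] unfolding h_def by simp
  qed
  from this[OF s] this[of 1] show "g s = (1 - s) * g 0 + s * g 1"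
    by (simp add: algebra_simps)
qed

lemma LINT_parallelogram:
  fixes g :: "real^2 \<Rightarrow> real"
  assumes d: "det2 v w \<noteq> 0" and g: "continuous_on (convex hull {P, P + v, P + v + w, P + w}) g"
  shows "(LINT x:convex hull {P, P + v, P + v + w, P + w}|lborel. g x) = \<bar>det2 v w\<bar> *
     integral {0..1} (\<lambda>s. integral {0..1} (\<lambda>t. g (P + s *\<^sub>R v + t *\<^sub>R w)))"
proof -
  define S where "S = convex hull {P, P + v, P + v + w, P + w}"
  define \<sigma> \<tau> where "\<sigma> x = det2 (x - P) w / det2 v w" and "\<tau> x = det2 v (x - P) / det2 v w" for x
  have coords: "\<sigma> (P + s *\<^sub>R v + t *\<^sub>R w) = s" "\<tau> (P + s *\<^sub>R v + t *\<^sub>R w) = t" for s t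
    using d by (simp_all add: \<sigma>_def \<tau>_def det2_simps)
  have inS: "P + s *\<^sub>R v + t *\<^sub>R w \<in> S \<longleftrightarrow> s \<in> {0..1} \<and> t \<in> {0..1}" for s t
  proof
    assume st: "s \<in> {0..1} \<and> t \<in> {0..1}"
    have S: "convex S" "P \<in> S" "P + v \<in> S" "P + v + w \<in> S" "P + w \<in> S"
      by (auto simp: S_def hull_inc)
    have "(1 - s) *\<^sub>R P + s *\<^sub>R (P + v) \<in> S" "(1 - s) *\<^sub>R (P + w) + s *\<^sub>R (P + v + w) \<in> S"
      using st S by (auto intro: convexD_alt)
    then have "(1 - t) *\<^sub>R ((1 - s) *\<^sub>R P + s *\<^sub>R (P + v)) + t *\<^sub>R ((1 - s) *\<^sub>R (P + w) + s *\<^sub>R (P + v + w)) \<in> S"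
      using st S by (intro convexD_alt) auto
    then show "P + s *\<^sub>R v + t *\<^sub>R w \<in> S" by (simp add: algebra_simps)
  next
    have aff: "affine_fun \<sigma>" "affine_fun \<tau>"
      unfolding \<sigma>_def[abs_def] \<tau>_def[abs_def] by (rule affine_fun_det2)+
    note comb = affine_fun_combination[OF aff(1)] affine_fun_combination[OF aff(2)]
    have cv: "convex {x. \<sigma> x \<in> {0..1} \<and> \<tau> x \<in> {0..1}}"
      unfolding convex_def using comb by (auto intro!: add_nonneg_nonneg mult_nonneg_nonneg convex_bound_le)
    have "S \<subseteq> {x. \<sigma> x \<in> {0..1} \<and> \<tau> x \<in> {0..1}}"
      unfolding S_def using coords[of 0 0] coords[of 1 0] coords[of 0 1] coords[of 1 1]
      by (intro hull_minimal cv) auto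
    moreover assume "P + s *\<^sub>R v + t *\<^sub>R w \<in> S"
    ultimately have "P + s *\<^sub>R v + t *\<^sub>R w \<in> {x. \<sigma> x \<in> {0..1} \<and> \<tau> x \<in> {0..1}}" by blast
    then show "s \<in> {0..1} \<and> t \<in> {0..1}" by (simp add: coords)
  qed
  have cont: "continuous_on ({0..1} \<times> cbox 0 1) (\<lambda>(s, t). g (P + s *\<^sub>R v + t *\<^sub>R w))"
    unfolding split_beta
    by (intro continuous_on_compose2[OF g[folded S_def]] continuous_intros) (use inS in auto)
  have ch: "continuous_on {0..1} (\<lambda>t. g (P + s *\<^sub>R v + t *\<^sub>R w))" if "s \<in> {0..1}" for s
    by (intro continuous_on_compose2[OF g[folded S_def]] continuous_intros) (use inS that in auto)
  define F where "F = (\<lambda>s t. indicator S (P + s *\<^sub>R v + t *\<^sub>R w) * g (P + s *\<^sub>R v + t *\<^sub>R w))"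
  have "integrable lborel (\<lambda>x. indicator S x *\<^sub>R g x)"
    by (rule borel_integrable_compact) (use g in \<open>auto simp: S_def finite_imp_compact_convex_hull\<close>)
  then have "(LINT x:S|lborel. g x) = \<bar>det2 v w\<bar> * (\<integral>s. (\<integral>t. F s t \<partial>lborel) \<partial>lborel)"
    unfolding set_lebesgue_integral_def
    by (subst integral_frame_iterated[where v=v and w=w and p=P]) (use d in \<open>auto simp: F_def\<close>)
  also have "(\<lambda>s. (\<integral>t. F s t \<partial>lborel)) = (\<lambda>s. indicator {0..1} s * integral {0..1} (\<lambda>t. g (P + s *\<^sub>R v + t *\<^sub>R w)))"
  proof
    fix s :: real
    have "F s = (\<lambda>t. indicator {0..1} s * (indicator {0..1} t * g (P + s *\<^sub>R v + t *\<^sub>R w)))"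
      unfolding F_def using inS by (auto simp: indicator_def fun_eq_iff)
    then have "(\<integral>t. F s t \<partial>lborel) = indicator {0..1} s * (\<integral>t. indicator {0..1} t * g (P + s *\<^sub>R v + t *\<^sub>R w) \<partial>lborel)"
      by simp
    then show "(\<integral>t. F s t \<partial>lborel) = indicator {0..1} s * integral {0..1} (\<lambda>t. g (P + s *\<^sub>R v + t *\<^sub>R w))"
      using LINT_interval_eq_integral[OF ch] by (cases "s \<in> {0..1}") auto
  qed
  also have "(\<integral>s. indicator {0..1} s * integral {0..1} (\<lambda>t. g (P + s *\<^sub>R v + t *\<^sub>R w)) \<partial>lborel)
     = integral {0..1} (\<lambda>s. integral {0..1} (\<lambda>t. g (P + s *\<^sub>R v + t *\<^sub>R w)))"
    using integral_continuous_on_param[OF cont] by (intro LINT_interval_eq_integral) auto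
  finally show ?thesis by (simp add: S_def)
qed

lemma segment_mean_commute:
  assumes "continuous_on S f" "closed_segment a b \<subseteq> S"
  shows "segment_mean b a f = segment_mean a b f"
proof -
  have "linepath b a t = linepath a b (1 - t)" for t by (simp add: linepath_def)
  then show ?thesis
    unfolding segment_mean_def using integral_reflect_unit[OF segment_mean_continuous[OF assms]] by simp
qed

context polygon
begin

lemma facet_mean_eq:
  assumes F: "closed_segment a b facet_of \<Delta>" and f: "continuous_on \<Delta> f"
  shows "segment_mean (endA (closed_segment a b)) (endB (closed_segment a b)) f = segment_mean a b f"
proof -
  have "closed_segment a b = closed_segment (endA (closed_segment a b)) (endB (closed_segment a b))"
    using facet_ends[OF F] by blast
  then have "{endA (closed_segment a b), endB (closed_segment a b)} = {a, b}"
    by (metis closed_segment_eq)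
  then show ?thesis
    using segment_mean_commute[OF f, of a b] facet_subset[OF F] by (auto simp: doubleton_eq_iff)
qed

end

context framed_quadrilateral
begin

text \<open>
  Cramer's rule for the coordinates \<open>s\<close>, \<open>t\<close> of \<open>x = z0 + s e1 + t e2\<close>.
\<close>

definition sc :: "real^2 \<Rightarrow> real" where "sc x = det2 (x - z0) e2 / det2 e1 e2"
definition tc :: "real^2 \<Rightarrow> real" where "tc x = det2 e1 (x - z0) / det2 e1 e2"

lemma coords: "x = z0 + sc x *\<^sub>R e1 + tc x *\<^sub>R e2"
  unfolding sc_def tc_def by (rule frame_coordinates[OF frame])

lemma sc_frame: "sc (z0 + s *\<^sub>R e1 + t *\<^sub>R e2) = s" and tc_frame: "tc (z0 + s *\<^sub>R e1 + t *\<^sub>R e2) = t"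
  using frame by (simp_all add: sc_def tc_def det2_simps)

lemma affine_sc: "affine_fun sc" and affine_tc: "affine_fun tc"
  unfolding sc_def[abs_def] tc_def[abs_def] by (rule affine_fun_det2)+

lemma corner_coords: "sc z0 = 0" "tc z0 = 0" "sc (z0 + e1) = 1" "tc (z0 + e1) = 0"
   "sc (z0 + e2) = 0" "tc (z0 + e2) = 1"
  using sc_frame[of 0 0] tc_frame[of 0 0] sc_frame[of 1 0] tc_frame[of 1 0] sc_frame[of 0 1] tc_frame[of 0 1]
  by auto

lemma boundary_integral_frame:
  assumes f: "continuous_on \<Delta> f"
  shows "boundary_integral r f =
     r (closed_segment z0 (z0 + e1)) * segment_mean z0 (z0 + e1) f
   + r (closed_segment (z0 + e1) (z0 + p *\<^sub>R e1 + q *\<^sub>R e2)) * segment_mean (z0 + e1) (z0 + p *\<^sub>R e1 + q *\<^sub>R e2) f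
   + r (closed_segment (z0 + p *\<^sub>R e1 + q *\<^sub>R e2) (z0 + e2)) * segment_mean (z0 + p *\<^sub>R e1 + q *\<^sub>R e2) (z0 + e2) f
   + r (closed_segment (z0 + e2) z0) * segment_mean (z0 + e2) z0 f"
proof -
  define b where "b = z0 + e1" define c where "c = z0 + p *\<^sub>R e1 + q *\<^sub>R e2" define d where "d = z0 + e2"
  have tcs: "tc z0 = 0" "tc b = 0" "tc c = q" "tc d = 1" and scs: "sc z0 = 0" "sc b = 1" "sc c = p" "sc d = 0"
    using corner_coords by (auto simp: b_def c_def d_def tc_frame sc_frame)
  have ne: "z0 \<noteq> b" "z0 \<noteq> c" "z0 \<noteq> d" "b \<noteq> c" "b \<noteq> d" "c \<noteq> d"
    using tcs scs pq by auto
  define G where "G F = r F * segment_mean (endA F) (endB F) f" for F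
  have fs: "{F. F facet_of \<Delta>} = {closed_segment z0 b, closed_segment b c, closed_segment c d, closed_segment d z0}"
    using facets by (simp add: b_def c_def d_def)
  have dist: "closed_segment z0 b \<noteq> closed_segment b c" "closed_segment z0 b \<noteq> closed_segment c d"
    "closed_segment z0 b \<noteq> closed_segment d z0" "closed_segment b c \<noteq> closed_segment c d"
    "closed_segment b c \<noteq> closed_segment d z0" "closed_segment c d \<noteq> closed_segment d z0"
    unfolding closed_segment_eq doubleton_eq_iff using ne by blast+
  have "boundary_integral r f = (\<Sum>F\<in>{closed_segment z0 b, closed_segment b c, closed_segment c d, closed_segment d z0}. G F)"
    unfolding boundary_integral_def fs G_def ..
  also have "\<dots> = G (closed_segment z0 b) + G (closed_segment b c) + G (closed_segment c d) + G (closed_segment d z0)"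
    using dist by simp
  also have "\<dots> = r (closed_segment z0 b) * segment_mean z0 b f + r (closed_segment b c) * segment_mean b c f
     + r (closed_segment c d) * segment_mean c d f + r (closed_segment d z0) * segment_mean d z0 f"
  proof -
    have "closed_segment z0 b facet_of \<Delta>" "closed_segment b c facet_of \<Delta>"
      "closed_segment c d facet_of \<Delta>" "closed_segment d z0 facet_of \<Delta>"
      using fs by blast+
    from this[THEN facet_mean_eq[OF _ f]] show ?thesis unfolding G_def by simp
  qed
  finally show ?thesis by (simp add: b_def c_def d_def)
qed

end

context framed_quadrilateral
begin

definition \<phi> :: "real \<Rightarrow> real \<Rightarrow> real^2" where "\<phi> s t = z0 + s *\<^sub>R e1 + t *\<^sub>R e2"

lemma sc_\<phi>: "sc (\<phi> s t) = s" and tc_\<phi>: "tc (\<phi> s t) = t" and \<phi>_coords: "\<phi> (sc x) (tc x) = x"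
  using sc_frame tc_frame coords[of x] by (simp_all add: \<phi>_def)

lemma \<phi>_hull: "\<Delta> = convex hull {\<phi> 0 0, \<phi> 1 0, \<phi> p q, \<phi> 0 1}"
  using hull by (simp add: \<phi>_def)

lemma \<phi>_combination: "(1 - u) *\<^sub>R \<phi> s t + u *\<^sub>R \<phi> s' t' = \<phi> ((1 - u) * s + u * s') ((1 - u) * t + u * t')"
  by (simp add: \<phi>_def algebra_simps)

lemma \<phi>_ray: "\<phi> s t + u *\<^sub>R (\<phi> s' t' - \<phi> s t) = \<phi> ((1 - u) * s + u * s') ((1 - u) * t + u * t')"
  by (simp add: \<phi>_def algebra_simps)

lemma linepath_\<phi>: "linepath (\<phi> s t) (\<phi> s' t') u = \<phi> ((1 - u) * s + u * s') ((1 - u) * t + u * t')"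
  unfolding linepath_def by (rule \<phi>_combination)

lemma continuous_\<phi>: "continuous_on S (\<lambda>x. \<phi> (f x) (g x))" if "continuous_on S f" "continuous_on S g"
  unfolding \<phi>_def using that by (intro continuous_intros)

end

locale framed_parallelogram = framed_quadrilateral \<Delta> z0 e1 e2 1 1
  for \<Delta> :: "(real^2) set" and z0 e1 e2 :: "real^2"
begin

lemma square_subset: "s \<in> {0..1} \<Longrightarrow> t \<in> {0..1} \<Longrightarrow> \<phi> s t \<in> \<Delta>"
proof -
  assume st: "s \<in> {0..1}" "t \<in> {0..1}"
  have v: "\<phi> 0 0 \<in> \<Delta>" "\<phi> 1 0 \<in> \<Delta>" "\<phi> 1 1 \<in> \<Delta>" "\<phi> 0 1 \<in> \<Delta>"
    by (subst \<phi>_hull, rule hull_inc, simp)+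
  have "\<phi> s 0 \<in> \<Delta>" "\<phi> s 1 \<in> \<Delta>"
    using convexD_alt[OF convex v(1,2), of s] convexD_alt[OF convex v(4,3), of s] st
    by (simp_all add: \<phi>_combination)
  then have "\<phi> ((1 - t) * s + t * s) ((1 - t) * 0 + t * 1) \<in> \<Delta>"
    unfolding \<phi>_combination[symmetric] using st by (intro convexD_alt[OF convex]) auto
  moreover have "(1 - t) * s + t * s = s" by (simp add: algebra_simps)
  ultimately show "\<phi> s t \<in> \<Delta>" by simp
qed

lemma in_square: "x \<in> \<Delta> \<Longrightarrow> sc x \<in> {0..1} \<and> tc x \<in> {0..1}"
proof -
  have "affine_fun f \<Longrightarrow> convex {x. f x \<in> {0..1}}" for f
    unfolding convex_def using affine_fun_combination[of f]
    by (auto intro!: add_nonneg_nonneg mult_nonneg_nonneg convex_bound_le)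
  then have "convex ({x. sc x \<in> {0..1}} \<inter> {x. tc x \<in> {0..1}})"
    using affine_sc affine_tc by (intro convex_Int) blast+
  then have "\<Delta> \<subseteq> {x. sc x \<in> {0..1}} \<inter> {x. tc x \<in> {0..1}}"
    by (subst \<phi>_hull, intro hull_minimal) (auto simp: sc_\<phi> tc_\<phi>)
  then show "x \<in> \<Delta> \<Longrightarrow> sc x \<in> {0..1} \<and> tc x \<in> {0..1}" by blast
qed

lemma area_square:
  assumes g: "continuous_on \<Delta> g"
  shows "area_integral g = \<bar>det2 e1 e2\<bar> * integral {0..1} (\<lambda>s. integral {0..1} (\<lambda>t. g (\<phi> s t)))"
    and "area_integral g = \<bar>det2 e1 e2\<bar> * integral {0..1} (\<lambda>t. integral {0..1} (\<lambda>s. g (\<phi> s t)))"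
proof -
  have h1: "\<Delta> = convex hull {z0, z0 + e1, z0 + e1 + e2, z0 + e2}" using hull by simp
  have h2: "\<Delta> = convex hull {z0, z0 + e2, z0 + e2 + e1, z0 + e1}"
    unfolding h1 by (simp add: insert_commute algebra_simps)
  have d2: "det2 e2 e1 \<noteq> 0" "\<bar>det2 e2 e1\<bar> = \<bar>det2 e1 e2\<bar>" using frame det2_swap[of e1 e2] by auto
  show "area_integral g = \<bar>det2 e1 e2\<bar> * integral {0..1} (\<lambda>s. integral {0..1} (\<lambda>t. g (\<phi> s t)))"
    using LINT_parallelogram[OF frame, of z0 g] g by (simp add: area_integral_def h1[symmetric] \<phi>_def)
  show "area_integral g = \<bar>det2 e1 e2\<bar> * integral {0..1} (\<lambda>t. integral {0..1} (\<lambda>s. g (\<phi> s t)))"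
  proof -
    have "\<phi> s t = z0 + t *\<^sub>R e2 + s *\<^sub>R e1" for s t by (simp add: \<phi>_def)
    then show ?thesis
      using LINT_parallelogram[OF d2(1), of z0 g, folded h2] g
      by (simp only: area_integral_def d2(2))
  qed
qed

definition side_defect :: "(real \<Rightarrow> real \<Rightarrow> real^2) \<Rightarrow> (real^2 \<Rightarrow> real) \<Rightarrow> real" where
  "side_defect \<psi> f = integral {0..1} (\<lambda>t. endpoint_defect (\<lambda>s. f (\<psi> s t)))"

text \<open>
  The four parametrizations of the square for which the first parameter measures the distance from
  one of the four sides. They allow the sides to be treated alike.
\<close>

definition square_map :: "(real \<Rightarrow> real \<Rightarrow> real^2) \<Rightarrow> bool" where
  "square_map \<psi> \<longleftrightarrow> \<psi> \<in> {\<phi>, \<lambda>s t. \<phi> (1 - s) t, \<lambda>s t. \<phi> t s, \<lambda>s t. \<phi> t (1 - s)}"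

lemma square_map_mem: "square_map \<psi> \<Longrightarrow> s \<in> {0..1} \<Longrightarrow> t \<in> {0..1} \<Longrightarrow> \<psi> s t \<in> \<Delta>"
  unfolding square_map_def by (auto intro!: square_subset)

lemma square_map_continuous:
  "square_map \<psi> \<Longrightarrow> continuous_on S f \<Longrightarrow> continuous_on S g \<Longrightarrow> continuous_on S (\<lambda>x. \<psi> (f x) (g x))"
  unfolding square_map_def by (auto intro!: continuous_\<phi> continuous_intros)

lemma square_map_ray:
  "square_map \<psi> \<Longrightarrow> \<psi> s t + u *\<^sub>R (\<psi> s' t - \<psi> s t) = \<psi> ((1 - u) * s + u * s') t"
  unfolding square_map_def by (auto simp: \<phi>_def algebra_simps)

context
  fixes \<psi> and f :: "real^2 \<Rightarrow> real"
  assumes \<psi>: "square_map \<psi>" and f: "continuous_on \<Delta> f"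
begin

lemma continuous_slice: "t \<in> {0..1} \<Longrightarrow> continuous_on {0..1} (\<lambda>s. f (\<psi> s t))"
  by (intro continuous_on_compose2[OF f] square_map_continuous[OF \<psi>] continuous_intros)
     (use square_map_mem[OF \<psi>] in auto)

lemma continuous_slice0: "continuous_on {0..1} (\<lambda>t. f (\<psi> 0 t))"
  by (intro continuous_on_compose2[OF f] square_map_continuous[OF \<psi>] continuous_intros)
     (use square_map_mem[OF \<psi>] in auto)

lemma continuous_weighted: "continuous_on {0..1} (\<lambda>t. integral {0..1} (\<lambda>s. (4 - 6 * s) * f (\<psi> s t)))"
proof -
  have "continuous_on ({0..1} \<times> cbox 0 1) (\<lambda>(t, s). (4 - 6 * s) * f (\<psi> s t))"
    unfolding split_beta
    by (intro continuous_on_mult continuous_on_compose2[OF f] square_map_continuous[OF \<psi>] continuous_intros)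
       (use square_map_mem[OF \<psi>] in auto)
  from integral_continuous_on_param[OF this] show ?thesis by simp
qed

lemma continuous_defect: "continuous_on {0..1} (\<lambda>t. endpoint_defect (\<lambda>s. f (\<psi> s t)))"
  unfolding endpoint_defect_def by (intro continuous_on_diff continuous_slice0 continuous_weighted)

lemma side_defect_eq:
  "side_defect \<psi> f = integral {0..1} (\<lambda>t. f (\<psi> 0 t))
     - integral {0..1} (\<lambda>t. integral {0..1} (\<lambda>s. (4 - 6 * s) * f (\<psi> s t)))"
  unfolding side_defect_def endpoint_defect_def
  by (intro integral_diff integrable_continuous_real continuous_slice0 continuous_weighted)

end

lemma convex_slice:
  assumes \<psi>: "square_map \<psi>" and f: "f \<in> PL \<Delta>" and t: "t \<in> {0..1}"
  shows "convex_on {0..1} (\<lambda>s. f (\<psi> s t))"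
proof (rule convex_onI)
  fix u x y :: real assume u: "0 < u" "u < 1" and xy: "x \<in> {0..1}" "y \<in> {0..1}"
  show "f (\<psi> ((1 - u) *\<^sub>R x + u *\<^sub>R y) t) \<le> (1 - u) * f (\<psi> x t) + u * f (\<psi> y t)"
    using PL_convex[OF f convex square_map_mem[OF \<psi> xy(1) t] square_map_mem[OF \<psi> xy(2) t], of u] u
    by (simp add: square_map_ray[OF \<psi>])
qed simp

lemma side_defect_nonneg:
  assumes "square_map \<psi>" "f \<in> PL \<Delta>"
  shows "0 \<le> side_defect \<psi> f"
  unfolding side_defect_def
  using endpoint_defect_convex(1)[OF continuous_slice[OF assms(1) PL_continuous[OF assms(2)]] convex_slice[OF assms]]
  by (intro integral_nonneg integrable_continuous_real continuous_defect[OF assms(1) PL_continuous[OF assms(2)]])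

lemma side_defect_eq_0:
  assumes \<psi>: "square_map \<psi>" and f: "f \<in> PL \<Delta>" and 0: "side_defect \<psi> f = 0"
    and s: "s \<in> {0..1}" and t: "t \<in> {0..1}"
  shows "f (\<psi> s t) = (1 - s) * f (\<psi> 0 t) + s * f (\<psi> 1 t)"
proof -
  note cont = continuous_slice[OF \<psi> PL_continuous[OF f]] and conv = convex_slice[OF \<psi> f]
  have "endpoint_defect (\<lambda>s. f (\<psi> s t)) = 0"
    using integral_eq_0_iff[OF continuous_defect[OF \<psi> PL_continuous[OF f]]]
      endpoint_defect_convex(1)[OF cont conv] 0 t
    by (auto simp: side_defect_def)
  then show ?thesis using endpoint_defect_convex(2)[OF cont[OF t] conv[OF t] _ s] by simp
qed

lemma side_defect_affine:
  assumes \<psi>: "square_map \<psi>" and f: "affine_fun f"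
  shows "side_defect \<psi> f = 0"
proof -
  have "f (\<psi> s t) = f (\<psi> 0 t) + (f (\<psi> 1 t) - f (\<psi> 0 t)) * s" for s t
    using affine_fun_ray[OF f, of "\<psi> 0 t" s "\<psi> 1 t"] square_map_ray[OF \<psi>, of 0 t s 1]
    by (simp add: algebra_simps)
  then have "endpoint_defect (\<lambda>s. f (\<psi> s t)) = 0" for t
    by (intro endpoint_defect_affine) blast
  then show ?thesis by (simp add: side_defect_def)
qed

context
  fixes c :: real and r1 r2 r3 r4 :: real
  assumes c: "c > 0"
begin

text \<open>
  Superposition of the extremal functions of the four sides; the density \<open>r1\<close> belongs to the side
  \<open>t = 0\<close>, and the numbering follows the boundary from there.
\<close>

definition parallelogram_extremal :: "real^2 \<Rightarrow> real" where
  "parallelogram_extremal x = 2 / (c * \<bar>det2 e1 e2\<bar>) *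
     (r1 * (4 - 6 * tc x) + (r2 * (6 * sc x - 2) + (r3 * (6 * tc x - 2) + r4 * (4 - 6 * sc x))))"

lemma affine_extremal: "affine_fun parallelogram_extremal"
proof -
  have "affine_fun (\<lambda>x. 4 - 6 * tc x)" "affine_fun (\<lambda>x. 4 - 6 * sc x)"
    "affine_fun (\<lambda>x. 6 * tc x - 2)" "affine_fun (\<lambda>x. 6 * sc x - 2)"
    by (intro affine_fun_diff affine_fun_cmult affine_fun_const affine_sc affine_tc)+
  then show ?thesis unfolding parallelogram_extremal_def[abs_def]
    by (intro affine_fun_add affine_fun_cmult)
qed

text \<open>
  The weight depends on one coordinate only, so the inner integral along that coordinate is the
  weighted integral of a slice of \<open>f\<close>. For the sides \<open>s = 1\<close> and \<open>t = 1\<close> the reflection of the unit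
  interval turns the weight \<open>6 s - 2\<close> into \<open>4 - 6 s\<close>.
\<close>

lemma area_weight:
  assumes f: "continuous_on \<Delta> f"
  shows "area_integral (\<lambda>x. (4 - 6 * tc x) * f x) = \<bar>det2 e1 e2\<bar> *
       (integral {0..1} (\<lambda>s. f (\<phi> s 0)) - side_defect (\<lambda>s t. \<phi> t s) f)"
    "area_integral (\<lambda>x. (6 * sc x - 2) * f x) = \<bar>det2 e1 e2\<bar> *
       (integral {0..1} (\<lambda>t. f (\<phi> 1 t)) - side_defect (\<lambda>s t. \<phi> (1 - s) t) f)"
    "area_integral (\<lambda>x. (6 * tc x - 2) * f x) = \<bar>det2 e1 e2\<bar> *
       (integral {0..1} (\<lambda>s. f (\<phi> s 1)) - side_defect (\<lambda>s t. \<phi> t (1 - s)) f)"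
    "area_integral (\<lambda>x. (4 - 6 * sc x) * f x) = \<bar>det2 e1 e2\<bar> *
       (integral {0..1} (\<lambda>t. f (\<phi> 0 t)) - side_defect \<phi> f)"
proof -
  have sm: "square_map \<phi>" "square_map (\<lambda>s t. \<phi> (1 - s) t)" "square_map (\<lambda>s t. \<phi> t s)" "square_map (\<lambda>s t. \<phi> t (1 - s))"
    by (auto simp: square_map_def)
  have cw: "continuous_on \<Delta> (\<lambda>x. (4 - 6 * tc x) * f x)" "continuous_on \<Delta> (\<lambda>x. (6 * sc x - 2) * f x)"
     "continuous_on \<Delta> (\<lambda>x. (6 * tc x - 2) * f x)" "continuous_on \<Delta> (\<lambda>x. (4 - 6 * sc x) * f x)"
    using f affine_fun_continuous[OF affine_sc] affine_fun_continuous[OF affine_tc] by (auto intro!: continuous_intros)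
  have refl: "integral {0..1} (\<lambda>s. (6 * s - 2) * h s) = integral {0..1} (\<lambda>s. (4 - 6 * s) * h (1 - s))"
    if "continuous_on {0..1} h" for h :: "real \<Rightarrow> real"
  proof -
    have "continuous_on {0..1} (\<lambda>s. (6 * s - 2) * h s)" using that by (intro continuous_intros)
    from integral_reflect_unit[OF this] show ?thesis by (simp add: algebra_simps)
  qed
  have sl: "continuous_on {0..1} (\<lambda>s. f (\<phi> s t))" "continuous_on {0..1} (\<lambda>s. f (\<phi> t s))" if "t \<in> {0..1}" for t
    using continuous_slice[OF sm(1) f that] continuous_slice[OF sm(3) f that] by auto
  show "area_integral (\<lambda>x. (4 - 6 * tc x) * f x) = \<bar>det2 e1 e2\<bar> *
       (integral {0..1} (\<lambda>s. f (\<phi> s 0)) - side_defect (\<lambda>s t. \<phi> t s) f)"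
    unfolding area_square(1)[OF cw(1)] side_defect_eq[OF sm(3) f] by (simp add: tc_\<phi>)
  show "area_integral (\<lambda>x. (4 - 6 * sc x) * f x) = \<bar>det2 e1 e2\<bar> *
       (integral {0..1} (\<lambda>t. f (\<phi> 0 t)) - side_defect \<phi> f)"
    unfolding area_square(2)[OF cw(4)] side_defect_eq[OF sm(1) f] by (simp add: sc_\<phi>)
  have "integral {0..1} (\<lambda>t. integral {0..1} (\<lambda>s. (6 * s - 2) * f (\<phi> s t)))
      = integral {0..1} (\<lambda>t. integral {0..1} (\<lambda>s. (4 - 6 * s) * f (\<phi> (1 - s) t)))"
    using refl[OF sl(1)] by (rule_tac integral_cong)
  then show "area_integral (\<lambda>x. (6 * sc x - 2) * f x) = \<bar>det2 e1 e2\<bar> *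
       (integral {0..1} (\<lambda>t. f (\<phi> 1 t)) - side_defect (\<lambda>s t. \<phi> (1 - s) t) f)"
    unfolding area_square(2)[OF cw(2)] side_defect_eq[OF sm(2) f] by (simp add: sc_\<phi>)
  have "integral {0..1} (\<lambda>t. integral {0..1} (\<lambda>s. (6 * s - 2) * f (\<phi> t s)))
      = integral {0..1} (\<lambda>t. integral {0..1} (\<lambda>s. (4 - 6 * s) * f (\<phi> t (1 - s))))"
    using refl[OF sl(2)] by (rule_tac integral_cong)
  then show "area_integral (\<lambda>x. (6 * tc x - 2) * f x) = \<bar>det2 e1 e2\<bar> *
       (integral {0..1} (\<lambda>s. f (\<phi> s 1)) - side_defect (\<lambda>s t. \<phi> t (1 - s)) f)"
    unfolding area_square(1)[OF cw(3)] side_defect_eq[OF sm(4) f] by (simp add: tc_\<phi>)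
qed

lemma area_extremal:
  assumes f: "continuous_on \<Delta> f"
  shows "1/2 * (c * area_integral (\<lambda>x. parallelogram_extremal x * f x)) =
      r1 * (integral {0..1} (\<lambda>s. f (\<phi> s 0)) - side_defect (\<lambda>s t. \<phi> t s) f)
    + r2 * (integral {0..1} (\<lambda>t. f (\<phi> 1 t)) - side_defect (\<lambda>s t. \<phi> (1 - s) t) f)
    + r3 * (integral {0..1} (\<lambda>s. f (\<phi> s 1)) - side_defect (\<lambda>s t. \<phi> t (1 - s)) f)
    + r4 * (integral {0..1} (\<lambda>t. f (\<phi> 0 t)) - side_defect \<phi> f)"
proof -
  define J where "J = \<bar>det2 e1 e2\<bar>"
  have J: "J > 0" using frame by (simp add: J_def)
  have cw: "continuous_on \<Delta> (\<lambda>x. (4 - 6 * tc x) * f x)" "continuous_on \<Delta> (\<lambda>x. (6 * sc x - 2) * f x)"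
     "continuous_on \<Delta> (\<lambda>x. (6 * tc x - 2) * f x)" "continuous_on \<Delta> (\<lambda>x. (4 - 6 * sc x) * f x)"
    using f affine_fun_continuous[OF affine_sc] affine_fun_continuous[OF affine_tc] by (auto intro!: continuous_intros)
  have "(\<lambda>x. parallelogram_extremal x * f x) = (\<lambda>x. 2 / (c * J) *
     (r1 * ((4 - 6 * tc x) * f x) + (r2 * ((6 * sc x - 2) * f x) + (r3 * ((6 * tc x - 2) * f x) + r4 * ((4 - 6 * sc x) * f x)))))"
    unfolding parallelogram_extremal_def J_def by (simp add: fun_eq_iff algebra_simps)
  then have "area_integral (\<lambda>x. parallelogram_extremal x * f x) = 2 / (c * J) *
     (r1 * area_integral (\<lambda>x. (4 - 6 * tc x) * f x) + (r2 * area_integral (\<lambda>x. (6 * sc x - 2) * f x)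
      + (r3 * area_integral (\<lambda>x. (6 * tc x - 2) * f x) + r4 * area_integral (\<lambda>x. (4 - 6 * sc x) * f x))))"
    by (simp only: area_cmult area_add continuous_on_mult_left continuous_on_add cw)
  also have "\<dots> = 2 / (c * J) * (J * (r1 * (integral {0..1} (\<lambda>s. f (\<phi> s 0)) - side_defect (\<lambda>s t. \<phi> t s) f)
    + r2 * (integral {0..1} (\<lambda>t. f (\<phi> 1 t)) - side_defect (\<lambda>s t. \<phi> (1 - s) t) f)
    + r3 * (integral {0..1} (\<lambda>s. f (\<phi> s 1)) - side_defect (\<lambda>s t. \<phi> t (1 - s)) f)
    + r4 * (integral {0..1} (\<lambda>t. f (\<phi> 0 t)) - side_defect \<phi> f)))"
    unfolding area_weight[OF f] J_def[symmetric] by (simp add: algebra_simps)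
  finally show ?thesis using c J by simp
qed

end

lemma boundary_integral_square:
  assumes f: "continuous_on \<Delta> f"
  shows "boundary_integral r f =
     r (closed_segment (\<phi> 0 0) (\<phi> 1 0)) * integral {0..1} (\<lambda>s. f (\<phi> s 0))
   + r (closed_segment (\<phi> 1 0) (\<phi> 1 1)) * integral {0..1} (\<lambda>t. f (\<phi> 1 t))
   + r (closed_segment (\<phi> 1 1) (\<phi> 0 1)) * integral {0..1} (\<lambda>s. f (\<phi> s 1))
   + r (closed_segment (\<phi> 0 1) (\<phi> 0 0)) * integral {0..1} (\<lambda>t. f (\<phi> 0 t))"
proof -
  have v: "\<phi> 0 0 \<in> \<Delta>" "\<phi> 1 0 \<in> \<Delta>" "\<phi> 1 1 \<in> \<Delta>" "\<phi> 0 1 \<in> \<Delta>" by (auto intro: square_subset)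
  have seg: "closed_segment (\<phi> 0 1) (\<phi> 1 1) \<subseteq> \<Delta>" "closed_segment (\<phi> 0 0) (\<phi> 0 1) \<subseteq> \<Delta>"
    using v closed_segment_subset[OF _ _ convex] by auto
  have m: "segment_mean (\<phi> 0 0) (\<phi> 1 0) f = integral {0..1} (\<lambda>s. f (\<phi> s 0))"
    "segment_mean (\<phi> 1 0) (\<phi> 1 1) f = integral {0..1} (\<lambda>t. f (\<phi> 1 t))"
    "segment_mean (\<phi> 1 1) (\<phi> 0 1) f = integral {0..1} (\<lambda>s. f (\<phi> s 1))"
    "segment_mean (\<phi> 0 1) (\<phi> 0 0) f = integral {0..1} (\<lambda>t. f (\<phi> 0 t))"
    unfolding segment_mean_commute[OF f seg(1)] segment_mean_commute[OF f seg(2)]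
    by (simp_all add: segment_mean_def linepath_\<phi>)
  have pts: "z0 = \<phi> 0 0" "z0 + e1 = \<phi> 1 0" "z0 + 1 *\<^sub>R e1 + 1 *\<^sub>R e2 = \<phi> 1 1" "z0 + e2 = \<phi> 0 1"
    by (simp_all add: \<phi>_def)
  show ?thesis
    using boundary_integral_frame[OF f, of r] unfolding pts(2,3,4) pts(1)[symmetric] m[unfolded pts(1)[symmetric]]
    by simp
qed

text \<open>
  Since the invariant is the sum of the side defects with positive weights, its vanishing makes \<open>f\<close>
  affine in each of the two coordinates. The remaining mixed term is nonnegative by convexity on one
  diagonal and nonpositive by convexity on the other.
\<close>

theorem parallelogram_K_polystable:
  assumes c: "c > 0" and L: "affine_normals \<Delta> L"
  shows "K_polystable c \<Delta> L"
proof -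
  obtain P where "P \<in> interior \<Delta>" using interior_nonempty by auto
  then have LP: "L F P \<noteq> 0" if "F facet_of \<Delta>" for F
    using L that by (force simp: affine_normals_def)
  define r where "r = facet_density c L P"
  have rpos: "0 < r F" if "F facet_of \<Delta>" for F
    using c LP[OF that] det2_facet_nonzero[OF L that LP[OF that]] by (simp add: r_def facet_density_def)
  define r1 r2 r3 r4 where "r1 = r (closed_segment (\<phi> 0 0) (\<phi> 1 0))" and "r2 = r (closed_segment (\<phi> 1 0) (\<phi> 1 1))"
    and "r3 = r (closed_segment (\<phi> 1 1) (\<phi> 0 1))" and "r4 = r (closed_segment (\<phi> 0 1) (\<phi> 0 0))"
  have fs: "{F. F facet_of \<Delta>} = {closed_segment (\<phi> 0 0) (\<phi> 1 0), closed_segment (\<phi> 1 0) (\<phi> 1 1),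
     closed_segment (\<phi> 1 1) (\<phi> 0 1), closed_segment (\<phi> 0 1) (\<phi> 0 0)}"
    using facets by (simp add: \<phi>_def)
  have rs: "0 < r1" "0 < r2" "0 < r3" "0 < r4"
    unfolding r1_def r2_def r3_def r4_def using fs by (intro rpos; blast)+
  define \<zeta> where "\<zeta> = parallelogram_extremal c r1 r2 r3 r4"
  define D where "D f = r1 * side_defect (\<lambda>s t. \<phi> t s) f + r2 * side_defect (\<lambda>s t. \<phi> (1 - s) t) f
     + r3 * side_defect (\<lambda>s t. \<phi> t (1 - s)) f + r4 * side_defect \<phi> f" for f
  have sm: "square_map \<phi>" "square_map (\<lambda>s t. \<phi> (1 - s) t)" "square_map (\<lambda>s t. \<phi> t s)" "square_map (\<lambda>s t. \<phi> t (1 - s))"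
    by (auto simp: square_map_def)
  have main: "boundary_integral r f - 1/2 * (c * area_integral (\<lambda>x. \<zeta> x * f x)) = D f"
    if f: "continuous_on \<Delta> f" for f
    unfolding \<zeta>_def area_extremal[OF c f] boundary_integral_square[OF f] D_def r1_def r2_def r3_def r4_def
    by (simp add: algebra_simps)
  have D_aff: "D A = 0" if "affine_fun A" for A
    unfolding D_def using sm that by (simp add: side_defect_affine)
  have ext: "c * area_integral (\<lambda>x. \<zeta> x * A x) = 2 * boundary_integral (facet_density c L P) A" if "affine_fun A" for A
    using main[OF affine_fun_continuous[OF that]] D_aff[OF that] by (simp add: r_def)
  have fut: "futaki c \<Delta> L f = D f" if "continuous_on \<Delta> f" for f
    using futaki_eq[OF c L LP affine_extremal[OF c, of r1 r2 r3 r4, folded \<zeta>_def] ext that] main[OF that] by (simp add: r_def)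
  show ?thesis unfolding K_polystable_def
  proof (intro ballI conjI iffI)
    fix f assume f: "f \<in> PL \<Delta>"
    note cf = PL_continuous[OF f]
    have nn: "0 \<le> side_defect (\<lambda>s t. \<phi> t s) f" "0 \<le> side_defect (\<lambda>s t. \<phi> (1 - s) t) f"
      "0 \<le> side_defect (\<lambda>s t. \<phi> t (1 - s)) f" "0 \<le> side_defect \<phi> f"
      using sm f by (simp_all add: side_defect_nonneg)
    then have terms: "0 \<le> r1 * side_defect (\<lambda>s t. \<phi> t s) f" "0 \<le> r2 * side_defect (\<lambda>s t. \<phi> (1 - s) t) f"
      "0 \<le> r3 * side_defect (\<lambda>s t. \<phi> t (1 - s)) f" "0 \<le> r4 * side_defect \<phi> f"
      using rs by simp_all
    then show "0 \<le> futaki c \<Delta> L f" unfolding fut[OF cf] D_def by linarith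
    {
      assume "futaki c \<Delta> L f = 0"
      then have "r1 * side_defect (\<lambda>s t. \<phi> t s) f = 0" "r4 * side_defect \<phi> f = 0"
        using terms unfolding fut[OF cf] D_def by linarith+
      then have z: "side_defect (\<lambda>s t. \<phi> t s) f = 0" "side_defect \<phi> f = 0" using rs by simp_all
      define G where "G s t = f (\<phi> s t)" for s t
      have lin_s: "G s t = (1 - s) * G 0 t + s * G 1 t" if "s \<in> {0..1}" "t \<in> {0..1}" for s t
        using side_defect_eq_0[OF sm(1) f z(2) that] by (simp add: G_def)
      have lin_t: "G s t = (1 - t) * G s 0 + t * G s 1" if "s \<in> {0..1}" "t \<in> {0..1}" for s t
        using side_defect_eq_0[OF sm(3) f z(1) that(2,1)] by (simp add: G_def)
      have v: "\<phi> 0 0 \<in> \<Delta>" "\<phi> 1 0 \<in> \<Delta>" "\<phi> 1 1 \<in> \<Delta>" "\<phi> 0 1 \<in> \<Delta>" by (auto intro: square_subset)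
      \<comment> \<open>Convexity on both diagonals; by bilinearity the value at the center is the mean of all corners.\<close>
      have "G (1/2) (1/2) \<le> (G 0 0 + G 1 1) / 2" "G (1/2) (1/2) \<le> (G 1 0 + G 0 1) / 2"
        using PL_convex[OF f convex v(1,3), of "1/2"] PL_convex[OF f convex v(2,4), of "1/2"]
        by (simp_all add: \<phi>_ray G_def)
      moreover have "G (1/2) (1/2) = (G 0 0 + G 1 0 + G 0 1 + G 1 1) / 4"
        using lin_s[of "1/2" "1/2"] lin_t[of 0 "1/2"] lin_t[of 1 "1/2"] by (simp add: add_divide_distrib)
      ultimately have "G 0 0 + G 1 1 \<le> G 1 0 + G 0 1" "G 1 0 + G 0 1 \<le> G 0 0 + G 1 1"
        by (simp_all add: field_simps)
      then have corner: "G 1 1 = G 1 0 + G 0 1 - G 0 0" by simp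
      define a where "a x = G 0 0 + ((G 1 0 - G 0 0) * sc x + (G 0 1 - G 0 0) * tc x)" for x
      have "affine_fun a" unfolding a_def[abs_def]
        by (intro affine_fun_add affine_fun_cmult affine_fun_const affine_sc affine_tc)
      moreover have "f x = a x" if "x \<in> \<Delta>" for x
      proof -
        have st: "sc x \<in> {0..1}" "tc x \<in> {0..1}" using in_square[OF that] by auto
        have "f x = G (sc x) (tc x)" by (simp add: G_def \<phi>_coords)
        also have "\<dots> = (1 - sc x) * ((1 - tc x) * G 0 0 + tc x * G 0 1) + sc x * ((1 - tc x) * G 1 0 + tc x * G 1 1)"
          using lin_s[OF st] lin_t[of 0 "tc x"] lin_t[of 1 "tc x"] st by simp
        also have "\<dots> = a x" unfolding corner a_def by (simp add: algebra_simps)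
        finally show ?thesis .
      qed
      ultimately show "\<exists>a. affine_fun a \<and> (\<forall>x\<in>\<Delta>. f x = a x)" by blast
    }
    assume "\<exists>a. affine_fun a \<and> (\<forall>x\<in>\<Delta>. f x = a x)"
    then obtain a where a: "affine_fun a" "\<forall>x\<in>\<Delta>. f x = a x" by blast
    have "futaki c \<Delta> L f = boundary_integral r f - 1/2 * (c * area_integral (\<lambda>x. \<zeta> x * f x))"
      unfolding fut[OF cf] main[OF cf] ..
    also have "\<dots> = boundary_integral r a - 1/2 * (c * area_integral (\<lambda>x. \<zeta> x * a x))"
      using a(2) boundary_cong[of f a r] area_cong[of "\<lambda>x. \<zeta> x * f x" "\<lambda>x. \<zeta> x * a x"] by simp
    also have "\<dots> = 0" using ext[OF a(1)] by (simp add: r_def)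
    finally show "futaki c \<Delta> L f = 0" .
  qed
qed

end

section \<open>Moments over a quadrilateral\<close>

text \<open>
  The quadratic form for which \<open>|T| / 12\<close> times it is the integral of \<open>A B\<close> over the triangle \<open>T\<close> with
  vertices \<open>x\<close>, \<open>y\<close>, \<open>z\<close>.
\<close>

definition moment_form :: "(real^2 \<Rightarrow> real) \<Rightarrow> (real^2 \<Rightarrow> real) \<Rightarrow> real^2 \<Rightarrow> real^2 \<Rightarrow> real^2 \<Rightarrow> real" where
  "moment_form A B x y z = A x * B x + A y * B y + A z * B z + (A x + A y + A z) * (B x + B y + B z)"

lemma LINT_triangle_product:
  assumes A: "affine_fun A" and B: "affine_fun B"
  shows "(LINT x:convex hull {P, a, b}|lborel. A x * B x)
    = \<bar>det2 (a - P) (b - P)\<bar> / 24 * moment_form A B P a b"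
proof -
  define d e d' e' where "d = A a - A P" and "e = A b - A a" and "d' = B a - B P" and "e' = B b - B a"
  have val: "A (P + s *\<^sub>R (linepath a b t - P)) = (A P + s * d) + (s * e) * t"
    "B (P + s *\<^sub>R (linepath a b t - P)) = (B P + s * d') + (s * e') * t" for s t
    unfolding affine_fun_ray[OF A] affine_fun_ray[OF B] linepath_def
      affine_fun_combination[OF A, of "1 - t" t, simplified] affine_fun_combination[OF B, of "1 - t" t, simplified]
    by (simp_all add: d_def e_def d'_def e'_def algebra_simps)
  have inner: "integral {0..1} (\<lambda>t. (x + y * t) * (x' + y' * t)) = x * x' + (x * y' + x' * y) / 2 + y * y' / 3"
    for x y x' y' :: real
  proof (rule integral_unique)
    have "((\<lambda>t. (x + y * t) * (x' + y' * t)) has_integral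
      ((\<lambda>t. x * x' * t + (x * y' + x' * y) / 2 * t^2 + y * y' / 3 * t^3) 1
       - (\<lambda>t. x * x' * t + (x * y' + x' * y) / 2 * t^2 + y * y' / 3 * t^3) 0)) {0..1}"
      by (rule has_integral_FTC) (auto intro!: derivative_eq_intros simp: algebra_simps power2_eq_square)
    then show "((\<lambda>t. (x + y * t) * (x' + y' * t)) has_integral (x * x' + (x * y' + x' * y) / 2 + y * y' / 3)) {0..1}"
      by simp
  qed
  have in1: "integral {0..1} (\<lambda>t. A (P + s *\<^sub>R (linepath a b t - P)) * B (P + s *\<^sub>R (linepath a b t - P)))
    = (A P + s * d) * (B P + s * d') + ((A P + s * d) * (s * e') + (B P + s * d') * (s * e)) / 2 + (s * e) * (s * e') / 3" for s
    unfolding val by (rule inner)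
  define k1 k2 k3 where "k1 = A P * B P" and "k2 = A P * d' + B P * d + (A P * e' + B P * e) / 2"
    and "k3 = d * d' + (d * e' + d' * e) / 2 + e * e' / 3"
  have "integral {0..1} (\<lambda>s. s * integral {0..1} (\<lambda>t. A (P + s *\<^sub>R (linepath a b t - P)) * B (P + s *\<^sub>R (linepath a b t - P))))
    = integral {0..1} (\<lambda>s. k1 * s + k2 * s^2 + k3 * s^3)"
    unfolding in1 by (rule integral_cong)
      (simp add: k1_def k2_def k3_def algebra_simps add_divide_distrib power2_eq_square power3_eq_cube)
  also have "\<dots> = k1 / 2 + k2 / 3 + k3 / 4"
  proof (rule integral_unique)
    have "((\<lambda>s. k1 * s + k2 * s^2 + k3 * s^3) has_integral
      ((\<lambda>s. k1 / 2 * s^2 + k2 / 3 * s^3 + k3 / 4 * s^4) 1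
       - (\<lambda>s. k1 / 2 * s^2 + k2 / 3 * s^3 + k3 / 4 * s^4) 0)) {0..1}"
      by (rule has_integral_FTC) (auto intro!: derivative_eq_intros)
    then show "((\<lambda>s. k1 * s + k2 * s^2 + k3 * s^3) has_integral (k1 / 2 + k2 / 3 + k3 / 4)) {0..1}"
      by simp
  qed
  also have "\<dots> = moment_form A B P a b / 24"
    unfolding k1_def k2_def k3_def d_def e_def d'_def e'_def moment_form_def by (simp add: field_simps)
  finally show ?thesis
    using LINT_triangle[of P a b "\<lambda>x. A x * B x"] affine_fun_continuous[OF A] affine_fun_continuous[OF B]
    by (simp add: continuous_on_mult)
qed

lemma affine_zero_set_null:
  assumes f: "affine_fun f" and "f z \<noteq> 0"
  shows "{x. f x = 0} \<in> null_sets lborel"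
proof (rule compact_negligible_null_sets)
  show cl: "closed {x. f x = 0}"
    using affine_fun_continuous[OF f, of UNIV] by (intro closed_Collect_eq) auto
  have cv: "convex {x. f x = 0}"
    unfolding convex_def using affine_fun_combination[OF f] by simp
  have "interior {x. f x = 0} = {}"
    using affine_fun_vanishes[OF f open_interior, of "{x. f x = 0}"] interior_subset assms(2) by force
  then have "frontier {x. f x = 0} = {x. f x = 0}" using cl by (simp add: frontier_def)
  then show "negligible {x. f x = 0}" using negligible_convex_frontier[OF cv] by simp
qed

text \<open>
  The bare hull, without its facets, so that it describes both the given quadrilateral and the thin
  ones that creases cut off from it.
\<close>

definition frame_quad :: "real^2 \<Rightarrow> real^2 \<Rightarrow> real^2 \<Rightarrow> real \<Rightarrow> real \<Rightarrow> (real^2) set" where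
  "frame_quad z v w p q = convex hull {z, z + v, z + p *\<^sub>R v + q *\<^sub>R w, z + w}"

text \<open>
  Four inequalities describe the quadrilateral, and the diagonal from \<open>z\<close> splits it into two
  triangles. Both follow from explicit barycentric coordinates in the triangle on whose side of the
  diagonal the point lies.
\<close>

lemma frame_quad_triangles:
  assumes d: "det2 v w \<noteq> 0" and pq: "0 < p" "0 < q" "1 < p + q"
  shows "z + s *\<^sub>R v + t *\<^sub>R w \<in> frame_quad z v w p q \<longleftrightarrow>
      0 \<le> s \<and> 0 \<le> t \<and> q * (s - 1) \<le> (p - 1) * t \<and> p * (t - 1) \<le> (q - 1) * s" (is "_ \<longleftrightarrow> ?ineq s t")
    and "frame_quad z v w p q = convex hull {z, z + v, z + p *\<^sub>R v + q *\<^sub>R w}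
      \<union> convex hull {z, z + p *\<^sub>R v + q *\<^sub>R w, z + w}"
    and "convex hull {z, z + v, z + p *\<^sub>R v + q *\<^sub>R w} \<inter> convex hull {z, z + p *\<^sub>R v + q *\<^sub>R w, z + w} \<in> null_sets lborel"
proof -
  define \<sigma> \<tau> where "\<sigma> x = det2 (x - z) w / det2 v w" and "\<tau> x = det2 v (x - z) / det2 v w" for x
  have aff: "affine_fun \<sigma>" "affine_fun \<tau>"
    unfolding \<sigma>_def[abs_def] \<tau>_def[abs_def] by (rule affine_fun_det2)+
  have st: "\<sigma> (z + s *\<^sub>R v + t *\<^sub>R w) = s" "\<tau> (z + s *\<^sub>R v + t *\<^sub>R w) = t" for s t
    using d by (simp_all add: \<sigma>_def \<tau>_def det2_simps)
  have co: "x = z + \<sigma> x *\<^sub>R v + \<tau> x *\<^sub>R w" for x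
    unfolding \<sigma>_def \<tau>_def by (rule frame_coordinates[OF d])
  have cor: "\<sigma> z = 0" "\<tau> z = 0" "\<sigma> (z + v) = 1" "\<tau> (z + v) = 0" "\<sigma> (z + w) = 0" "\<tau> (z + w) = 1"
    using st[of 0 0] st[of 1 0] st[of 0 1] by auto
  define S where "S = frame_quad z v w p q"
  define T1 where "T1 = convex hull {z, z + v, z + p *\<^sub>R v + q *\<^sub>R w}"
  define T2 where "T2 = convex hull {z, z + p *\<^sub>R v + q *\<^sub>R w, z + w}"
  have half: "convex {x. 0 \<le> f x}" if "affine_fun f" for f
    unfolding convex_def using affine_fun_combination[OF that] by (auto intro!: add_nonneg_nonneg mult_nonneg_nonneg)
  define h where "h x = q * \<sigma> x + (- p) * \<tau> x" for x
  have h: "affine_fun h" unfolding h_def[abs_def] by (intro affine_fun_add affine_fun_cmult aff)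
  have h': "affine_fun (\<lambda>x. - h x)" using affine_fun_cmult[OF h, of "-1"] by simp
  have T1h: "T1 \<subseteq> {x. 0 \<le> h x}" unfolding T1_def
    by (intro hull_minimal half[OF h]) (use pq in \<open>auto simp: h_def st cor\<close>)
  have T2h: "T2 \<subseteq> {x. 0 \<le> - h x}" unfolding T2_def
    by (intro hull_minimal half[OF h']) (use pq in \<open>auto simp: h_def st cor\<close>)
  have "{x. h x = 0} \<in> null_sets lborel"
    by (rule affine_zero_set_null[OF h, of "z + v"]) (use pq in \<open>simp add: h_def cor\<close>)
  moreover have "T1 \<inter> T2 \<in> sets lborel"
    unfolding T1_def T2_def by (auto intro!: borel_compact compact_Int finite_imp_compact_convex_hull)
  moreover have "T1 \<inter> T2 \<subseteq> {x. h x = 0}" using T1h T2h by force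
  ultimately have "T1 \<inter> T2 \<in> null_sets lborel" by (rule null_sets_subset)
  then show "convex hull {z, z + v, z + p *\<^sub>R v + q *\<^sub>R w} \<inter> convex hull {z, z + p *\<^sub>R v + q *\<^sub>R w, z + w} \<in> null_sets lborel"
    by (simp only: T1_def T2_def)
  have TS: "T1 \<union> T2 \<subseteq> S"
    unfolding T1_def T2_def S_def frame_quad_def by (intro Un_least hull_mono) auto
  have ineq: "?ineq (\<sigma> x) (\<tau> x)" if "x \<in> S" for x
  proof -
    define f3 where "f3 x = ((p - 1) * \<tau> x + (- q) * \<sigma> x) + q" for x
    define f4 where "f4 x = ((q - 1) * \<sigma> x + (- p) * \<tau> x) + p" for x
    have f: "affine_fun f3" "affine_fun f4" unfolding f3_def[abs_def] f4_def[abs_def]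
      by (intro affine_fun_add affine_fun_cmult aff affine_fun_const)+
    have fc: "f3 (z + p *\<^sub>R v + q *\<^sub>R w) = 0" "f4 (z + p *\<^sub>R v + q *\<^sub>R w) = 0"
      unfolding f3_def f4_def st by (simp_all add: algebra_simps)
    have fa: "0 \<le> f3 z" "0 \<le> f3 (z + v)" "0 \<le> f3 (z + w)" "0 \<le> f4 z" "0 \<le> f4 (z + v)" "0 \<le> f4 (z + w)"
      unfolding f3_def f4_def cor using pq by simp_all
    have "S \<subseteq> {x. 0 \<le> \<sigma> x}" unfolding S_def frame_quad_def
      by (intro hull_minimal half aff) (use pq in \<open>auto simp: st cor\<close>)
    moreover have "S \<subseteq> {x. 0 \<le> \<tau> x}" unfolding S_def frame_quad_def
      by (intro hull_minimal half aff) (use pq in \<open>auto simp: st cor\<close>)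
    moreover have "S \<subseteq> {x. 0 \<le> f3 x}" unfolding S_def frame_quad_def
      by (intro hull_minimal half f) (auto simp: fc fa)
    moreover have "S \<subseteq> {x. 0 \<le> f4 x}" unfolding S_def frame_quad_def
      by (intro hull_minimal half f) (auto simp: fc fa)
    ultimately have "0 \<le> \<sigma> x" "0 \<le> \<tau> x" "0 \<le> f3 x" "0 \<le> f4 x" using that by auto
    then show ?thesis by (simp add: f3_def f4_def algebra_simps)
  qed
  have mem: "z + s *\<^sub>R v + t *\<^sub>R w \<in> T1 \<union> T2" if i: "?ineq s t" for s t
  proof (cases "p * t \<le> q * s")
    case True
    define \<mu> \<kappa> where "\<mu> = t / q" and "\<kappa> = s - p * \<mu>"
    have t: "t = q * \<mu>" using pq by (simp add: \<mu>_def)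
    have nn: "0 \<le> \<mu>" "0 \<le> \<kappa>" "0 \<le> 1 - \<kappa> - \<mu>"
    proof -
      show "0 \<le> \<mu>" using i pq by (simp add: \<mu>_def)
      have "q * 0 \<le> q * \<kappa>" using True unfolding \<kappa>_def t by (simp add: algebra_simps)
      then show "0 \<le> \<kappa>" using pq by (simp only: mult_le_cancel_left_pos)
      have "q * 0 \<le> q * (1 - \<kappa> - \<mu>)" using i unfolding \<kappa>_def t by (simp add: algebra_simps)
      then show "0 \<le> 1 - \<kappa> - \<mu>" using pq by (simp only: mult_le_cancel_left_pos)
    qed
    have "z + s *\<^sub>R v + t *\<^sub>R w = (1 - \<kappa> - \<mu>) *\<^sub>R z + \<kappa> *\<^sub>R (z + v) + \<mu> *\<^sub>R (z + p *\<^sub>R v + q *\<^sub>R w)"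
      unfolding t by (simp add: \<kappa>_def algebra_simps)
    then have "z + s *\<^sub>R v + t *\<^sub>R w \<in> T1" unfolding T1_def convex_hull_3 using nn
      by (intro CollectI exI[of _ "1 - \<kappa> - \<mu>"] exI[of _ \<kappa>] exI[of _ \<mu>]) auto
    then show ?thesis by blast
  next
    case False
    define \<mu> \<kappa> where "\<mu> = s / p" and "\<kappa> = t - q * \<mu>"
    have s: "s = p * \<mu>" using pq by (simp add: \<mu>_def)
    have nn: "0 \<le> \<mu>" "0 \<le> \<kappa>" "0 \<le> 1 - \<kappa> - \<mu>"
    proof -
      show "0 \<le> \<mu>" using i pq by (simp add: \<mu>_def)
      have "p * 0 \<le> p * \<kappa>" using False unfolding \<kappa>_def s by (simp add: algebra_simps)
      then show "0 \<le> \<kappa>" using pq by (simp only: mult_le_cancel_left_pos)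
      have "p * 0 \<le> p * (1 - \<kappa> - \<mu>)" using i unfolding \<kappa>_def s by (simp add: algebra_simps)
      then show "0 \<le> 1 - \<kappa> - \<mu>" using pq by (simp only: mult_le_cancel_left_pos)
    qed
    have "z + s *\<^sub>R v + t *\<^sub>R w = (1 - \<kappa> - \<mu>) *\<^sub>R z + \<mu> *\<^sub>R (z + p *\<^sub>R v + q *\<^sub>R w) + \<kappa> *\<^sub>R (z + w)"
      unfolding s by (simp add: \<kappa>_def algebra_simps)
    then have "z + s *\<^sub>R v + t *\<^sub>R w \<in> T2" unfolding T2_def convex_hull_3 using nn
      by (intro CollectI exI[of _ "1 - \<kappa> - \<mu>"] exI[of _ \<mu>] exI[of _ \<kappa>]) auto
    then show ?thesis by blast
  qed
  show "z + s *\<^sub>R v + t *\<^sub>R w \<in> frame_quad z v w p q \<longleftrightarrow> ?ineq s t"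
    using ineq[of "z + s *\<^sub>R v + t *\<^sub>R w"] mem[of s t] TS unfolding S_def[symmetric] st by blast
  have "S \<subseteq> T1 \<union> T2" using ineq mem co by (metis subsetI)
  then show "frame_quad z v w p q = convex hull {z, z + v, z + p *\<^sub>R v + q *\<^sub>R w}
      \<union> convex hull {z, z + p *\<^sub>R v + q *\<^sub>R w, z + w}"
    using TS unfolding S_def T1_def T2_def by blast
qed

lemma LINT_frame_quad_product:
  assumes d: "det2 v w \<noteq> 0" and pq: "0 < p" "0 < q" "1 < p + q" and A: "affine_fun A" and B: "affine_fun B"
  shows "(LINT x:frame_quad z v w p q|lborel. A x * B x) = \<bar>det2 v w\<bar> / 24 *
    (q * moment_form A B z (z + v) (z + p *\<^sub>R v + q *\<^sub>R w) + p * moment_form A B z (z + p *\<^sub>R v + q *\<^sub>R w) (z + w))"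
proof -
  define T1 where "T1 = convex hull {z, z + v, z + p *\<^sub>R v + q *\<^sub>R w}"
  define T2 where "T2 = convex hull {z, z + p *\<^sub>R v + q *\<^sub>R w, z + w}"
  have comp: "compact T1" "compact T2" unfolding T1_def T2_def by (auto intro: finite_imp_compact_convex_hull)
  have cont: "continuous_on S (\<lambda>x. A x * B x)" for S
    using affine_fun_continuous[OF A] affine_fun_continuous[OF B] by (intro continuous_on_mult)
  have int: "set_integrable lborel T1 (\<lambda>x. A x * B x)" "set_integrable lborel T2 (\<lambda>x. A x * B x)"
    unfolding set_integrable_def by (intro borel_integrable_compact comp cont)+
  have "AE x in lborel. x \<notin> T1 \<inter> T2"
    using frame_quad_triangles(3)[OF d pq] unfolding T1_def T2_def by (rule AE_not_in)
  then have "(LINT x:T1 \<union> T2|lborel. A x * B x) = (LINT x:T1|lborel. A x * B x) + (LINT x:T2|lborel. A x * B x)"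
    using comp by (intro set_integral_Un_AE int) (auto simp: borel_compact elim: eventually_mono)
  moreover have "\<bar>det2 (z + v - z) (z + p *\<^sub>R v + q *\<^sub>R w - z)\<bar> = q * \<bar>det2 v w\<bar>"
    using pq by (simp add: det2_simps abs_mult add.assoc)
  moreover have "\<bar>det2 (z + p *\<^sub>R v + q *\<^sub>R w - z) (z + w - z)\<bar> = p * \<bar>det2 v w\<bar>"
    using pq by (simp add: det2_simps abs_mult add.assoc)
  ultimately show ?thesis
    unfolding frame_quad_triangles(2)[OF d pq] T1_def T2_def LINT_triangle_product[OF A B]
    by (simp add: algebra_simps)
qed

text \<open>
  For \<open>c > 0\<close> the minimum in \<open>y\<close> along the line \<open>x = 2 c\<close> is at \<open>y = - b\<close>. For \<open>c \<le> 0\<close> the linear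
  term decides when \<open>x\<close> is small.
\<close>

lemma indefinite_form_negative:
  fixes a b c :: real
  assumes b: "b < 0" and disc: "0 < b\<^sup>2 - 4 * a * c"
  obtains x y where "0 < x" "0 < y" "a * x\<^sup>2 + b * x * y + c * y\<^sup>2 < 0"
proof (cases "0 < c")
  case True
  have "a * (2 * c)\<^sup>2 + b * (2 * c) * (- b) + c * (- b)\<^sup>2 = - c * (b\<^sup>2 - 4 * a * c)"
    by (simp add: algebra_simps power2_eq_square)
  also have "\<dots> < 0" using True disc by simp
  finally show thesis using that[of "2 * c" "- b"] True b by simp
next
  case False
  \<comment> \<open>Small enough for \<open>b\<close> to dominate \<open>a x\<close>.\<close>
  define x where "x = - b / (2 * (\<bar>a\<bar> + 1))"
  have x: "0 < x" unfolding x_def using b by (intro divide_pos_pos) auto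
  have "a * x \<le> (\<bar>a\<bar> + 1) * x" using x by (intro mult_right_mono) auto
  also have "\<dots> = - b / 2" by (simp add: x_def field_simps)
  finally have "a * x + b < 0" using b by simp
  then have "x * (a * x + b) < 0" using x by (intro mult_pos_neg)
  then have "a * x\<^sup>2 + b * x * 1 + c * 1\<^sup>2 < 0" using False by (simp add: algebra_simps power2_eq_square)
  then show thesis using that[of x 1] x by simp
qed

section \<open>Instability away from parallelograms\<close>

lemma affine_fun_frame:
  assumes A: "affine_fun A"
  shows "A (z + s *\<^sub>R v + t *\<^sub>R w) = A z + s * (A (z + v) - A z) + t * (A (z + w) - A z)"
proof -
  obtain l b where l: "linear l" "A = (\<lambda>x. l x + b)" using A by (rule affine_funE)
  show ?thesis unfolding l(2) linear_add[OF l(1)] linear_scale[OF l(1)] by (simp add: algebra_simps)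
qed

lemma segment_mean_affine:
  assumes A: "affine_fun A"
  shows "segment_mean a b A = (A a + A b) / 2"
proof -
  have "((\<lambda>t. A (linepath a b t)) has_integral
     ((\<lambda>t. A a * t + (A b - A a) / 2 * t^2) 1 - (\<lambda>t. A a * t + (A b - A a) / 2 * t^2) 0)) {0..1}"
    unfolding linepath_def affine_fun_combination[OF A, of "1 - t" t for t, simplified]
    by (rule has_integral_FTC) (auto intro!: derivative_eq_intros simp: field_simps)
  then show ?thesis unfolding segment_mean_def by (intro integral_unique) (simp add: field_simps)
qed

text \<open>
  In the frame of a quadrilateral with corners \<open>(0, 0)\<close>, \<open>(1, 0)\<close>, \<open>(p, q)\<close>, \<open>(0, 1)\<close>, unit mass on
  the side from \<open>(0, 1)\<close> to \<open>(0, 0)\<close> has extremal function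
  \<open>12 (side_coeff0 + side_coeff1 s + side_coeff2 t) / side_denom\<close>. The formulas solve the three
  linear moment equations by Cramer's rule; \<open>side_denom\<close> is the Gram determinant up to a factor.
\<close>

definition side_denom :: "real \<Rightarrow> real \<Rightarrow> real" where
  "side_denom p q = (p + q) ^ 5 - 4 * p * q * (p + q) * (p + q - 1)"
definition side_coeff0 :: "real \<Rightarrow> real \<Rightarrow> real" where
  "side_coeff0 p q = p^4 + 2 * p^3 * q + 4 * p^2 * q^2 + 6 * p * q^3 + 3 * q^4 + 2 * p^2 * q - 2 * q^3"
definition side_coeff1 :: "real \<Rightarrow> real \<Rightarrow> real" where
  "side_coeff1 p q = 2 * q^3 - 4 * q^4 - 2 * p * q^2 - 8 * p * q^3 - 6 * p^2 * q - 4 * p^2 * q^2 - 2 * p^3"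
definition side_coeff2 :: "real \<Rightarrow> real \<Rightarrow> real" where
  "side_coeff2 p q = 4 * (q^2 - q^3 + p * q - 3 * p * q^2 + p * q^3 - 2 * p^2 * q + 2 * p^2 * q^2 + p^3 * q)"

lemma side_denom_pos:
  assumes "0 < p" "0 < q" "1 < p + q"
  shows "0 < side_denom p q"
proof -
  define s where "s = p + q"
  have s: "1 < s" using assms by (simp add: s_def)
  have "4 * p * q \<le> s\<^sup>2"
  proof -
    have "s\<^sup>2 - 4 * p * q = (p - q)\<^sup>2" by (simp add: s_def power2_eq_square algebra_simps)
    then show ?thesis using zero_le_power2[of "p - q"] by linarith
  qed
  then have "4 * p * q * (s - 1) \<le> s\<^sup>2 * (s - 1)" using s by (intro mult_right_mono) auto
  also have "\<dots> < s\<^sup>2 * s\<^sup>2"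
  proof (rule mult_strict_left_mono)
    have "s * 1 < s * s" using s by (intro mult_strict_left_mono) auto
    then show "s - 1 < s\<^sup>2" by (simp add: power2_eq_square)
  qed (use s in simp)
  finally have "0 < s * (s\<^sup>2 * s\<^sup>2 - 4 * p * q * (s - 1))" using s by simp
  also have "\<dots> = side_denom p q"
    by (simp add: side_denom_def s_def[symmetric] algebra_simps power_def numeral_eq_Suc)
  finally show ?thesis .
qed

text \<open>
  The moment equations with the denominator cleared. The letters \<open>a\<close>, \<open>b\<close>, \<open>c\<close>, \<open>d\<close> are the values at
  the corners of the affine test function.
\<close>

lemma side_moments:
  fixes p q a b d :: real
  defines "\<zeta>a \<equiv> side_coeff0 p q" and "\<zeta>b \<equiv> side_coeff0 p q + side_coeff1 p q"
    and "\<zeta>d \<equiv> side_coeff0 p q + side_coeff2 p q"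
  defines "\<zeta>c \<equiv> \<zeta>a + p * (\<zeta>b - \<zeta>a) + q * (\<zeta>d - \<zeta>a)" and "c \<equiv> a + p * (b - a) + q * (d - a)"
  shows "q * (\<zeta>a * a + \<zeta>b * b + \<zeta>c * c + (\<zeta>a + \<zeta>b + \<zeta>c) * (a + b + c))
    + p * (\<zeta>a * a + \<zeta>c * c + \<zeta>d * d + (\<zeta>a + \<zeta>c + \<zeta>d) * (a + c + d)) = 2 * side_denom p q * (d + a)"
  unfolding assms side_coeff0_def side_coeff1_def side_coeff2_def side_denom_def by algebra

lemma side_coeff_sum:
  "2 * side_coeff0 p q + side_coeff1 p q = 2 * (p + q - 1) * (p^3 + p^2 * q + p * q^2 + q^3)"
  unfolding side_coeff0_def side_coeff1_def by algebra

text \<open>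
  The left-hand side is, up to a positive factor, the discriminant of the form that governs thin
  creases; \<open>a\<close> and \<open>b\<close> are the values of the extremal function at the ends of the side along which the
  crease runs, up to the common factor \<open>12 / side_denom p q\<close>.
\<close>

lemma side_discriminant:
  fixes p q :: real
  defines "a \<equiv> side_coeff0 p q" and "b \<equiv> side_coeff0 p q + side_coeff1 p q"
  shows "side_denom p q * (a + 3 * b) - (a\<^sup>2 + 4 * a * b + b\<^sup>2) = 4 * (p - 1)\<^sup>2 * (p + q - 1) * (p + q) ^ 6"
  unfolding assms side_coeff0_def side_coeff1_def side_denom_def by algebra

context framed_quadrilateral
begin

definition side_extremal :: "real^2 \<Rightarrow> real" where
  "side_extremal x = 12 / side_denom p q * (side_coeff0 p q + (side_coeff1 p q * sc x + side_coeff2 p q * tc x))"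

lemma affine_side_extremal: "affine_fun side_extremal"
  unfolding side_extremal_def[abs_def]
  by (intro affine_fun_cmult affine_fun_add affine_fun_const affine_sc affine_tc)

lemma area_frame_quad: "area_integral g = (LINT x:frame_quad z0 e1 e2 p q|lborel. g x)"
  unfolding area_integral_def frame_quad_def hull[symmetric] ..

lemma area_side_extremal:
  assumes A: "affine_fun A"
  shows "area_integral (\<lambda>x. side_extremal x * A x) = 2 * (\<bar>det2 e1 e2\<bar> * segment_mean (z0 + e2) z0 A)"
proof -
  define a b d where "a = A z0" and "b = A (z0 + e1)" and "d = A (z0 + e2)"
  define k where "k = 12 / side_denom p q"
  have k: "k * side_denom p q = 12" using side_denom_pos[OF pq] by (simp add: k_def)
  define \<zeta>a \<zeta>b \<zeta>d where "\<zeta>a = side_coeff0 p q" and "\<zeta>b = side_coeff0 p q + side_coeff1 p q"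
    and "\<zeta>d = side_coeff0 p q + side_coeff2 p q"
  define \<zeta>c where "\<zeta>c = \<zeta>a + p * (\<zeta>b - \<zeta>a) + q * (\<zeta>d - \<zeta>a)"
  define c where "c = a + p * (b - a) + q * (d - a)"
  have cA: "A (z0 + p *\<^sub>R e1 + q *\<^sub>R e2) = c"
    unfolding affine_fun_frame[OF A] c_def a_def b_def d_def ..
  have z: "side_extremal z0 = k * \<zeta>a" "side_extremal (z0 + e1) = k * \<zeta>b" "side_extremal (z0 + e2) = k * \<zeta>d"
    by (simp_all add: side_extremal_def k_def \<zeta>a_def \<zeta>b_def \<zeta>d_def corner_coords)
  have cz: "side_extremal (z0 + p *\<^sub>R e1 + q *\<^sub>R e2) = k * \<zeta>c"
    unfolding affine_fun_frame[OF affine_side_extremal] z \<zeta>c_def by (simp add: algebra_simps)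
  have "q * moment_form side_extremal A z0 (z0 + e1) (z0 + p *\<^sub>R e1 + q *\<^sub>R e2)
      + p * moment_form side_extremal A z0 (z0 + p *\<^sub>R e1 + q *\<^sub>R e2) (z0 + e2)
    = k * (q * (\<zeta>a * a + \<zeta>b * b + \<zeta>c * c + (\<zeta>a + \<zeta>b + \<zeta>c) * (a + b + c))
    + p * (\<zeta>a * a + \<zeta>c * c + \<zeta>d * d + (\<zeta>a + \<zeta>c + \<zeta>d) * (a + c + d)))"
    unfolding moment_form_def z cz cA a_def[symmetric] b_def[symmetric] d_def[symmetric] by (simp add: algebra_simps)
  also have "\<dots> = (k * side_denom p q) * (2 * (d + a))"
    unfolding \<zeta>a_def \<zeta>b_def \<zeta>d_def \<zeta>c_def c_def side_moments by simp
  finally show ?thesis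
    unfolding area_frame_quad LINT_frame_quad_product[OF frame pq affine_side_extremal A]
      segment_mean_affine[OF A] k a_def d_def by (simp add: algebra_simps)
qed

text \<open>
  The crease is the line through \<open>z0 + \<alpha> e2\<close> and the point \<open>b'\<close> at the fraction \<open>\<beta>\<close> of the side from \<open>z0 + e1\<close> to the opposite corner. The part of
  the polygon where \<open>f\<close> is positive is itself a quadrilateral in the frame \<open>e1\<close>, \<open>\<alpha> e2\<close>, so the moments
  of \<open>f\<close> are exact polynomial expressions.
\<close>

lemma crease_integrals:
  fixes \<alpha> \<beta> :: real
  assumes \<alpha>: "0 < \<alpha>" "\<alpha> \<le> 1" and \<beta>: "0 < \<beta>" "\<beta> \<le> 1"
    and m_def: "m = 1 + \<beta> * (p - 1)"
    and l_def: "l = (\<lambda>x. m * \<alpha> + ((\<beta> * q - \<alpha>) * sc x + (- m) * tc x))"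
    and f_def: "f = (\<lambda>x. max 0 (l x))"
    and b'_def: "b' = z0 + e1 + \<beta> *\<^sub>R ((p - 1) *\<^sub>R e1 + q *\<^sub>R e2)"
  shows "f \<in> PL \<Delta>"
    and "segment_mean (z0 + e2) z0 f = m * \<alpha>\<^sup>2 / 2"
    and "\<And>Z. affine_fun Z \<Longrightarrow> area_integral (\<lambda>x. Z x * f x) = \<bar>det2 e1 e2\<bar> / 24 *
      (\<beta> * q * moment_form Z l z0 (z0 + e1) b' + \<alpha> * m * moment_form Z l z0 b' (z0 + \<alpha> *\<^sub>R e2))"
proof -
  have m: "0 < m"
  proof -
    have "m = (1 - \<beta>) + \<beta> * p" by (simp add: m_def algebra_simps)
    then show ?thesis using \<beta> pq by (simp add: add_nonneg_pos)
  qed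
  have l: "affine_fun l" unfolding l_def
    by (intro affine_fun_add affine_fun_cmult affine_fun_const affine_sc affine_tc)
  have fMax: "f x = Max ((\<lambda>a. a x) ` {\<lambda>x. 0, l})" for x by (simp add: f_def)
  show "f \<in> PL \<Delta>" unfolding PL_def using fMax l affine_fun_const[of 0]
    by (intro CollectI exI[of _ "{\<lambda>x. 0, l}"]) auto
  have l\<phi>: "l (\<phi> s t) = m * \<alpha> + (\<beta> * q - \<alpha>) * s - m * t" for s t
    by (simp add: l_def sc_\<phi> tc_\<phi>)
  show "segment_mean (z0 + e2) z0 f = m * \<alpha>\<^sup>2 / 2"
  proof -
    have "z0 + e2 = \<phi> 0 1" "z0 = \<phi> 0 0" by (simp_all add: \<phi>_def)
    then have lp: "linepath (z0 + e2) z0 t = \<phi> 0 (1 - t)" for t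
      using linepath_\<phi>[of 0 1 0 0 t] by simp
    have v: "f (\<phi> 0 (1 - t)) = max 0 (m * (t - (1 - \<alpha>)))" for t
      by (simp add: f_def l\<phi> algebra_simps)
    have "((\<lambda>t. max 0 (m * (t - (1 - \<alpha>)))) has_integral 0) {0..1 - \<alpha>}"
      by (rule has_integral_is_0) (use m in \<open>auto simp: max_def mult_le_0_iff zero_le_mult_iff\<close>)
    moreover have "((\<lambda>t. max 0 (m * (t - (1 - \<alpha>)))) has_integral m * \<alpha>\<^sup>2 / 2) {1 - \<alpha>..1}"
    proof -
      have "((\<lambda>t. m * (t - (1 - \<alpha>))) has_integral
          ((\<lambda>t. m / 2 * (t - (1 - \<alpha>))^2) 1 - (\<lambda>t. m / 2 * (t - (1 - \<alpha>))^2) (1 - \<alpha>))) {1 - \<alpha>..1}"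
        by (rule has_integral_FTC) (use \<alpha> in \<open>auto intro!: derivative_eq_intros\<close>)
      then have "((\<lambda>t. m * (t - (1 - \<alpha>))) has_integral m * \<alpha>\<^sup>2 / 2) {1 - \<alpha>..1}" by simp
      then show ?thesis
        by (rule has_integral_eq[rotated]) (use m in \<open>auto simp: max_def\<close>)
    qed
    ultimately have "((\<lambda>t. max 0 (m * (t - (1 - \<alpha>)))) has_integral 0 + m * \<alpha>\<^sup>2 / 2) {0..1}"
      using \<alpha> by (intro has_integral_combine[of 0 "1 - \<alpha>" 1]) auto
    then show ?thesis unfolding segment_mean_def lp v by (simp add: integral_unique)
  qed
  \<comment> \<open>The coordinates of \<open>b'\<close> in the frame \<open>e1\<close>, \<open>\<alpha> e2\<close>.\<close>
  define p' q' where "p' = m" and "q' = \<beta> * q / \<alpha>"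
  have d': "det2 e1 (\<alpha> *\<^sub>R e2) \<noteq> 0" using frame \<alpha> by (simp add: det2_simps)
  have pq': "0 < p'" "0 < q'" "1 < p' + q'"
  proof -
    show "0 < p'" "0 < q'" using m \<alpha> \<beta> pq by (simp_all add: p'_def q'_def)
    have "q * 1 \<le> q * (1 / \<alpha>)" using \<alpha> pq by (intro mult_left_mono) auto
    then have "0 < (p - 1) + q / \<alpha>" using pq by simp
    then have "0 < \<beta> * ((p - 1) + q / \<alpha>)" using \<beta> by simp
    then show "1 < p' + q'" by (simp add: p'_def q'_def m_def algebra_simps)
  qed
  define D where "D = frame_quad z0 e1 (\<alpha> *\<^sub>R e2) p' q'"
  have \<Delta>fq: "\<Delta> = frame_quad z0 e1 e2 p q" using hull by (simp add: frame_quad_def)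
  have in_\<Delta>: "x \<in> \<Delta> \<longleftrightarrow> 0 \<le> sc x \<and> 0 \<le> tc x \<and> q * (sc x - 1) \<le> (p - 1) * tc x \<and> p * (tc x - 1) \<le> (q - 1) * sc x" for x
    unfolding \<Delta>fq using frame_quad_triangles(1)[OF frame pq, of z0 "sc x" "tc x"] coords[of x] by simp
  have in_D: "x \<in> D \<longleftrightarrow> 0 \<le> sc x \<and> 0 \<le> tc x \<and> q * (sc x - 1) \<le> (p - 1) * tc x \<and> 0 \<le> l x" for x
  proof -
    have "x = z0 + sc x *\<^sub>R e1 + (tc x / \<alpha>) *\<^sub>R (\<alpha> *\<^sub>R e2)" using coords[of x] \<alpha> by simp
    then have "x \<in> D \<longleftrightarrow> 0 \<le> sc x \<and> 0 \<le> tc x / \<alpha> \<and> q' * (sc x - 1) \<le> (p' - 1) * (tc x / \<alpha>)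
        \<and> p' * (tc x / \<alpha> - 1) \<le> (q' - 1) * sc x"
      unfolding D_def using frame_quad_triangles(1)[OF d' pq', of z0 "sc x" "tc x / \<alpha>"] by simp
    moreover have "0 \<le> tc x / \<alpha> \<longleftrightarrow> 0 \<le> tc x" using \<alpha> by (simp add: zero_le_divide_iff)
    moreover have "q' * (sc x - 1) \<le> (p' - 1) * (tc x / \<alpha>) \<longleftrightarrow> q * (sc x - 1) \<le> (p - 1) * tc x"
    proof -
      have "q' * (sc x - 1) = (\<beta> / \<alpha>) * (q * (sc x - 1))" "(p' - 1) * (tc x / \<alpha>) = (\<beta> / \<alpha>) * ((p - 1) * tc x)"
        by (simp_all add: q'_def p'_def m_def)
      moreover have "0 < \<beta> / \<alpha>" using \<alpha> \<beta> by simp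
      ultimately show ?thesis by (simp only: mult_le_cancel_left_pos)
    qed
    moreover have "p' * (tc x / \<alpha> - 1) \<le> (q' - 1) * sc x \<longleftrightarrow> 0 \<le> l x"
    proof -
      have "\<alpha> * (p' * (tc x / \<alpha> - 1)) = m * tc x - m * \<alpha>" "\<alpha> * ((q' - 1) * sc x) = (\<beta> * q - \<alpha>) * sc x"
        using \<alpha> by (simp_all add: p'_def q'_def algebra_simps)
      moreover have "p' * (tc x / \<alpha> - 1) \<le> (q' - 1) * sc x \<longleftrightarrow>
          \<alpha> * (p' * (tc x / \<alpha> - 1)) \<le> \<alpha> * ((q' - 1) * sc x)"
        using \<alpha> by (simp only: mult_le_cancel_left_pos)
      ultimately have "p' * (tc x / \<alpha> - 1) \<le> (q' - 1) * sc x \<longleftrightarrow> m * tc x - m * \<alpha> \<le> (\<beta> * q - \<alpha>) * sc x"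
        by (simp only:)
      then show ?thesis unfolding l_def by linarith
    qed
    ultimately show ?thesis by blast
  qed
  have cb': "z0 + p' *\<^sub>R e1 + q' *\<^sub>R (\<alpha> *\<^sub>R e2) = b'"
    using \<alpha> by (simp add: p'_def q'_def b'_def m_def algebra_simps)
  have corners: "z0 \<in> \<Delta>" "z0 + e1 \<in> \<Delta>" "z0 + p *\<^sub>R e1 + q *\<^sub>R e2 \<in> \<Delta>" "z0 + e2 \<in> \<Delta>"
    by (subst hull, rule hull_inc, simp)+
  have D\<Delta>: "D \<subseteq> \<Delta>"
    unfolding D_def frame_quad_def cb'
  proof (intro hull_minimal convex)
    have "(1 - \<alpha>) *\<^sub>R z0 + \<alpha> *\<^sub>R (z0 + e2) \<in> \<Delta>" "(1 - \<beta>) *\<^sub>R (z0 + e1) + \<beta> *\<^sub>R (z0 + p *\<^sub>R e1 + q *\<^sub>R e2) \<in> \<Delta>"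
      using convexD_alt[OF convex corners(1,4), of \<alpha>] convexD_alt[OF convex corners(2,3), of \<beta>] \<alpha> \<beta> by auto
    then have "z0 + \<alpha> *\<^sub>R e2 \<in> \<Delta>" "b' \<in> \<Delta>" by (simp_all add: b'_def algebra_simps)
    then show "{z0, z0 + e1, b', z0 + \<alpha> *\<^sub>R e2} \<subseteq> \<Delta>" using corners by simp
  qed
  fix Z :: "real^2 \<Rightarrow> real" assume Z: "affine_fun Z"
  have "area_integral (\<lambda>x. Z x * f x) = (LINT x:D|lborel. Z x * l x)"
  proof -
    have "indicator \<Delta> x *\<^sub>R (Z x * f x) = indicator D x *\<^sub>R (Z x * l x)" for x
    proof (cases "x \<in> D")
      case True
      then show ?thesis using in_D[of x] D\<Delta> by (auto simp: f_def)
    next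
      case False
      then have "x \<notin> \<Delta> \<or> f x = 0" using in_D[of x] in_\<Delta>[of x] by (auto simp: f_def max_def)
      then show ?thesis using False by auto
    qed
    then show ?thesis unfolding area_integral_def set_lebesgue_integral_def by (simp only:)
  qed
  also have "\<dots> = \<bar>det2 e1 (\<alpha> *\<^sub>R e2)\<bar> / 24 *
      (q' * moment_form Z l z0 (z0 + e1) b' + p' * moment_form Z l z0 b' (z0 + \<alpha> *\<^sub>R e2))"
    unfolding D_def LINT_frame_quad_product[OF d' pq' Z l] cb' ..
  also have "\<dots> = \<bar>det2 e1 e2\<bar> / 24 *
      (\<beta> * q * moment_form Z l z0 (z0 + e1) b' + \<alpha> * m * moment_form Z l z0 b' (z0 + \<alpha> *\<^sub>R e2))"
    using \<alpha> by (simp add: det2_simps abs_mult p'_def q'_def algebra_simps)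
  finally show "area_integral (\<lambda>x. Z x * f x) = \<bar>det2 e1 e2\<bar> / 24 *
      (\<beta> * q * moment_form Z l z0 (z0 + e1) b' + \<alpha> * m * moment_form Z l z0 b' (z0 + \<alpha> *\<^sub>R e2))" .
qed

text \<open>
  With \<open>\<alpha> = \<epsilon> x\<close> and \<open>\<beta> = \<epsilon> y / q\<close> the invariant of the crease is \<open>\<epsilon>\<^sup>2 G(\<epsilon>)\<close> up to a positive factor,
  with \<open>G\<close> a polynomial in \<open>\<epsilon>\<close>. Its value at 0 is the form with the coefficients \<open>A\<close>, \<open>B\<close>, \<open>C\<close> below, and
  \<open>x\<close>, \<open>y\<close> are chosen to make it negative.
\<close>

lemma destabilizing_crease:
  assumes p1: "p \<noteq> 1"
  obtains f where "f \<in> PL \<Delta>"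
    "\<bar>det2 e1 e2\<bar> * segment_mean (z0 + e2) z0 f < 1/2 * area_integral (\<lambda>x. side_extremal x * f x)"
proof -
  define \<zeta>a \<zeta>b \<zeta>c \<zeta>d where "\<zeta>a = side_extremal z0" and "\<zeta>b = side_extremal (z0 + e1)"
    and "\<zeta>c = side_extremal (z0 + p *\<^sub>R e1 + q *\<^sub>R e2)" and "\<zeta>d = side_extremal (z0 + e2)"
  define a0 b0 where "a0 = side_coeff0 p q" and "b0 = side_coeff0 p q + side_coeff1 p q"
  define k where "k = 12 / side_denom p q"
  have kpos: "0 < k" using side_denom_pos[OF pq] by (simp add: k_def)
  have k: "k * side_denom p q = 12" using side_denom_pos[OF pq] by (simp add: k_def)
  have z: "\<zeta>a = k * a0" "\<zeta>b = k * b0"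
    by (simp_all add: \<zeta>a_def \<zeta>b_def side_extremal_def k_def a0_def b0_def corner_coords)
  have "0 < a0 + b0"
  proof -
    have "a0 + b0 = 2 * (p + q - 1) * (p^3 + p^2 * q + p * q^2 + q^3)"
      using side_coeff_sum[of p q] by (simp add: a0_def b0_def)
    then show ?thesis using pq by (simp add: add_pos_pos)
  qed
  then have sum_pos: "0 < \<zeta>a + \<zeta>b" using kpos unfolding z distrib_left[symmetric] by simp
  define A B C where "A = 24 - 3 * \<zeta>a - \<zeta>b" and "B = - 2 * (\<zeta>a + \<zeta>b)" and "C = - (\<zeta>a + 3 * \<zeta>b)"
  have "B\<^sup>2 - 4 * A * C = 4 * (2 * (12 * (\<zeta>a + 3 * \<zeta>b) - (\<zeta>a\<^sup>2 + 4 * \<zeta>a * \<zeta>b + \<zeta>b\<^sup>2)))"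
    by (simp add: A_def B_def C_def algebra_simps power2_eq_square)
  also have "\<dots> = 8 * k\<^sup>2 * (side_denom p q * (a0 + 3 * b0) - (a0\<^sup>2 + 4 * a0 * b0 + b0\<^sup>2))"
    unfolding z k[symmetric] by (simp add: algebra_simps power2_eq_square)
  also have "\<dots> = 8 * k\<^sup>2 * (4 * (p - 1)\<^sup>2 * (p + q - 1) * (p + q) ^ 6)"
    unfolding a0_def b0_def side_discriminant ..
  also have "\<dots> > 0" using kpos p1 pq by simp
  finally have disc: "0 < B\<^sup>2 - 4 * A * C" .
  have "B < 0" using sum_pos by (simp add: B_def)
  then obtain x y where xy: "0 < x" "0 < y" "A * x\<^sup>2 + B * x * y + C * y\<^sup>2 < 0"
    using indefinite_form_negative[OF _ disc] by blast
  \<comment> \<open>The quantities of \<open>crease_integrals\<close> for the scale \<open>\<epsilon>\<close>, with the common factors \<open>\<epsilon>\<close> removed.\<close>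
  define m where "m \<epsilon> = 1 + (\<epsilon> * y / q) * (p - 1)" for \<epsilon>
  define lb where "lb \<epsilon> = y + \<epsilon> * x * y * (p - 1) / q" for \<epsilon>
  define zb where "zb \<epsilon> = \<zeta>b + (\<epsilon> * y / q) * (\<zeta>c - \<zeta>b)" for \<epsilon>
  define za where "za \<epsilon> = \<zeta>a + (\<epsilon> * x) * (\<zeta>d - \<zeta>a)" for \<epsilon>
  define G where "G \<epsilon> = 24 * m \<epsilon> * x\<^sup>2
     - (y * (\<zeta>a * (m \<epsilon> * x) + \<zeta>b * lb \<epsilon> + (\<zeta>a + \<zeta>b + zb \<epsilon>) * (m \<epsilon> * x + lb \<epsilon>))
       + x * m \<epsilon> * (\<zeta>a * (m \<epsilon> * x) + (\<zeta>a + zb \<epsilon> + za \<epsilon>) * (m \<epsilon> * x)))" for \<epsilon>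
  have "G 0 = A * x\<^sup>2 + B * x * y + C * y\<^sup>2"
    by (simp add: G_def m_def lb_def zb_def za_def A_def B_def C_def algebra_simps power2_eq_square)
  then have G0: "G 0 < 0" using xy by simp
  have "isCont G 0" unfolding G_def m_def lb_def zb_def za_def
    using pq by (intro continuous_intros) auto
  then have "(G \<longlongrightarrow> G 0) (at_right 0)"
    unfolding isCont_def by (rule tendsto_within_subset) simp
  then have e1: "eventually (\<lambda>\<epsilon>. G \<epsilon> < 0) (at_right 0)"
    using G0 by (rule order_tendstoD)
  have "((\<lambda>\<epsilon>. \<epsilon> * x) \<longlongrightarrow> 0 * x) (at_right 0)" "((\<lambda>\<epsilon>. \<epsilon> * y / q) \<longlongrightarrow> 0 * y / q) (at_right 0)"
    using pq by (intro tendsto_intros; simp)+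
  then have e2: "eventually (\<lambda>\<epsilon>. \<epsilon> * x < 1) (at_right 0)" and e3: "eventually (\<lambda>\<epsilon>. \<epsilon> * y / q < 1) (at_right 0)"
    by (auto intro: order_tendstoD)
  have e4: "eventually (\<lambda>\<epsilon>::real. 0 < \<epsilon>) (at_right 0)" by (simp add: eventually_at_right_less)
  obtain \<epsilon> where \<epsilon>: "G \<epsilon> < 0" "\<epsilon> * x < 1" "\<epsilon> * y / q < 1" "0 < \<epsilon>"
    using eventually_happens'[OF _ eventually_conj[OF e1 eventually_conj[OF e2 eventually_conj[OF e3 e4]]]]
    by (auto simp: trivial_limit_at_right_real)
  define \<alpha> \<beta> where "\<alpha> = \<epsilon> * x" and "\<beta> = \<epsilon> * y / q"
  have \<alpha>\<beta>: "0 < \<alpha>" "\<alpha> \<le> 1" "0 < \<beta>" "\<beta> \<le> 1" using \<epsilon> xy pq by (simp_all add: \<alpha>_def \<beta>_def)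
  have m\<epsilon>: "m \<epsilon> = 1 + \<beta> * (p - 1)" by (simp add: m_def \<beta>_def)
  define l where "l = (\<lambda>u. m \<epsilon> * \<alpha> + ((\<beta> * q - \<alpha>) * sc u + (- m \<epsilon>) * tc u))"
  define f where "f = (\<lambda>u. max 0 (l u))"
  define b' where "b' = z0 + e1 + \<beta> *\<^sub>R ((p - 1) *\<^sub>R e1 + q *\<^sub>R e2)"
  note ci = crease_integrals[OF \<alpha>\<beta> m\<epsilon> l_def f_def b'_def]
  have b'\<phi>: "b' = \<phi> (1 + \<beta> * (p - 1)) (\<beta> * q)" "z0 + \<alpha> *\<^sub>R e2 = \<phi> 0 \<alpha>"
    by (simp_all add: b'_def \<phi>_def algebra_simps)
  have \<beta>q: "\<beta> * q = \<epsilon> * y" using pq by (simp add: \<beta>_def)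
  have lv: "l z0 = \<epsilon> * (m \<epsilon> * x)" "l (z0 + e1) = \<epsilon> * lb \<epsilon>" "l b' = 0" "l (z0 + \<alpha> *\<^sub>R e2) = 0"
  proof -
    show "l z0 = \<epsilon> * (m \<epsilon> * x)" by (simp add: l_def corner_coords \<alpha>_def)
    have "l (z0 + e1) = \<beta> * q + \<alpha> * \<beta> * (p - 1)" 
      unfolding l_def corner_coords m\<epsilon> by (simp add: algebra_simps)
    then show "l (z0 + e1) = \<epsilon> * lb \<epsilon>" unfolding \<beta>q by (simp add: lb_def \<alpha>_def \<beta>_def algebra_simps)
    show "l b' = 0" unfolding l_def b'\<phi> sc_\<phi> tc_\<phi> m\<epsilon> by (simp add: algebra_simps)
    show "l (z0 + \<alpha> *\<^sub>R e2) = 0" unfolding l_def b'\<phi> sc_\<phi> tc_\<phi> by simp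
  qed
  have zv: "side_extremal b' = zb \<epsilon>" "side_extremal (z0 + \<alpha> *\<^sub>R e2) = za \<epsilon>"
  proof -
    have "b' = (z0 + e1) + \<beta> *\<^sub>R ((z0 + p *\<^sub>R e1 + q *\<^sub>R e2) - (z0 + e1))"
      by (simp add: b'_def algebra_simps)
    then have "side_extremal b' = (1 - \<beta>) * \<zeta>b + \<beta> * \<zeta>c"
      using affine_fun_ray[OF affine_side_extremal, of "z0 + e1" \<beta> "z0 + p *\<^sub>R e1 + q *\<^sub>R e2"]
      by (simp only: \<zeta>b_def \<zeta>c_def)
    moreover have "zb \<epsilon> = \<zeta>b + \<beta> * (\<zeta>c - \<zeta>b)" by (simp add: zb_def \<beta>_def)
    ultimately show "side_extremal b' = zb \<epsilon>" by (simp add: algebra_simps)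
    have "z0 + \<alpha> *\<^sub>R e2 = z0 + \<alpha> *\<^sub>R ((z0 + e2) - z0)" by simp
    then have "side_extremal (z0 + \<alpha> *\<^sub>R e2) = (1 - \<alpha>) * \<zeta>a + \<alpha> * \<zeta>d"
      using affine_fun_ray[OF affine_side_extremal, of z0 \<alpha> "z0 + e2"] by (simp only: \<zeta>a_def \<zeta>d_def)
    then show "side_extremal (z0 + \<alpha> *\<^sub>R e2) = za \<epsilon>" by (simp add: za_def \<alpha>_def algebra_simps)
  qed
  have "\<bar>det2 e1 e2\<bar> * segment_mean (z0 + e2) z0 f - 1/2 * area_integral (\<lambda>x. side_extremal x * f x)
     = \<bar>det2 e1 e2\<bar> / 48 * (\<epsilon>\<^sup>2 * G \<epsilon>)"
    unfolding ci(2) ci(3)[OF affine_side_extremal] moment_form_def lv zv \<zeta>a_def[symmetric] \<zeta>b_def[symmetric]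
    unfolding \<beta>q \<alpha>_def G_def by (simp add: algebra_simps power2_eq_square)
  also have "\<dots> < 0" using frame \<epsilon> by (intro mult_pos_neg) auto
  finally show thesis using that[OF ci(1)] by simp
qed

text \<open>
  The densities are \<open>\<delta>\<close> times those of the stable normals plus the mass on the single side; for small
  \<open>\<delta>\<close> the sign of the invariant is that of the single side.
\<close>

theorem K_unstable_normals_exist:
  assumes p1: "p \<noteq> 1" and c: "c > 0"
  shows "\<exists>L. affine_normals \<Delta> L \<and> K_unstable c \<Delta> L"
proof -
  obtain f where f: "f \<in> PL \<Delta>"
    and neg: "\<bar>det2 e1 e2\<bar> * segment_mean (z0 + e2) z0 f < 1/2 * area_integral (\<lambda>x. side_extremal x * f x)"
    using destabilizing_crease[OF p1] by blast
  note cf = PL_continuous[OF f]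
  obtain L1 P1 where L1: "affine_normals \<Delta> L1" "\<And>F. F facet_of \<Delta> \<Longrightarrow> L1 F P1 = 1"
    and ext1: "\<And>A. affine_fun A \<Longrightarrow> c * area_integral (\<lambda>x. 4 * A x) = 2 * boundary_integral (facet_density c L1 P1) A"
  proof (rule barycentric_normals[OF c])
    fix L P
    assume "affine_normals \<Delta> L" "\<And>F. F facet_of \<Delta> \<Longrightarrow> L F P = 1"
      "\<And>A. affine_fun A \<Longrightarrow> c * area_integral (\<lambda>x. 4 * A x) = 2 * boundary_integral (facet_density c L P) A"
    then show thesis by (rule that)
  qed
  define r1 where "r1 = facet_density c L1 P1"
  have r1: "0 < r1 F" if "F facet_of \<Delta>" for F
    using c L1(2)[OF that] det2_facet_nonzero[OF L1(1) that, of P1] by (simp add: r1_def facet_density_def)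
  define E where "E = closed_segment (z0 + e2) z0"
  have EF: "E facet_of \<Delta>" using facets unfolding E_def by blast
  define J where "J = c * \<bar>det2 e1 e2\<bar>"
  have J: "0 < J" using c frame by (simp add: J_def)
  define S where "S g = J * segment_mean (z0 + e2) z0 g - 1/2 * (c * area_integral (\<lambda>x. side_extremal x * g x))" for g
  have Sneg: "S f < 0"
  proof -
    have "S f = c * (\<bar>det2 e1 e2\<bar> * segment_mean (z0 + e2) z0 f - 1/2 * area_integral (\<lambda>x. side_extremal x * f x))"
      by (simp add: S_def J_def algebra_simps)
    then show ?thesis using c neg by (simp add: mult_less_0_iff)
  qed
  define T where "T g = boundary_integral r1 g - 1/2 * (c * area_integral (\<lambda>x. 4 * g x))" for g
  \<comment> \<open>Chosen so that \<open>\<delta> |T f|\<close> is less than half of \<open>|S f|\<close>.\<close>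
  define \<delta> where "\<delta> = - S f / (2 * (\<bar>T f\<bar> + 1))"
  have \<delta>: "0 < \<delta>" unfolding \<delta>_def using Sneg by (intro divide_pos_pos) auto
  define r where "r F = \<delta> * r1 F + (if F = E then J else 0)" for F
  have rpos: "0 < r F" if "F facet_of \<Delta>" for F
    using r1[OF that] \<delta> J by (simp add: r_def add_pos_nonneg)
  obtain L P where L: "affine_normals \<Delta> L" "\<And>F. F facet_of \<Delta> \<Longrightarrow> L F P \<noteq> 0"
    "\<And>F. F facet_of \<Delta> \<Longrightarrow> facet_density c L P F = r F"
    by (rule normals_with_density[OF c, of r]) (use rpos in auto)
  have bd: "boundary_integral (facet_density c L P) g = \<delta> * boundary_integral r1 g + J * segment_mean (z0 + e2) z0 g"
    if g: "continuous_on \<Delta> g" for g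
  proof -
    have "boundary_integral (facet_density c L P) g = (\<Sum>F | F facet_of \<Delta>.
       \<delta> * (r1 F * segment_mean (endA F) (endB F) g) + (if F = E then J * segment_mean (endA F) (endB F) g else 0))"
      unfolding boundary_integral_def using L(3) by (intro sum.cong) (auto simp: r_def algebra_simps)
    also have "\<dots> = \<delta> * boundary_integral r1 g + J * segment_mean (endA E) (endB E) g"
      unfolding sum.distrib boundary_integral_def sum_distrib_left[symmetric]
      using finite_facets EF by (simp add: sum.delta)
    finally show ?thesis using facet_mean_eq[of "z0 + e2" z0 g] EF g by (simp add: E_def)
  qed
  define \<zeta> where "\<zeta> x = \<delta> * 4 + side_extremal x" for x
  have \<zeta>: "affine_fun \<zeta>" unfolding \<zeta>_def[abs_def]
    by (intro affine_fun_add affine_fun_const affine_side_extremal)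
  have area\<zeta>: "area_integral (\<lambda>x. \<zeta> x * g x) = \<delta> * area_integral (\<lambda>x. 4 * g x) + area_integral (\<lambda>x. side_extremal x * g x)"
    if g: "continuous_on \<Delta> g" for g
  proof -
    have cs: "continuous_on \<Delta> (\<lambda>x. \<delta> * (4 * g x))" "continuous_on \<Delta> (\<lambda>x. side_extremal x * g x)"
      using g affine_fun_continuous[OF affine_side_extremal] by (auto intro!: continuous_intros)
    have "(\<lambda>x. \<zeta> x * g x) = (\<lambda>x. \<delta> * (4 * g x) + side_extremal x * g x)"
      by (simp add: \<zeta>_def fun_eq_iff algebra_simps)
    then have "area_integral (\<lambda>x. \<zeta> x * g x) = area_integral (\<lambda>x. \<delta> * (4 * g x)) + area_integral (\<lambda>x. side_extremal x * g x)"
      using area_add[OF cs] by simp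
    then show ?thesis unfolding area_cmult[of \<delta>] .
  qed
  have main: "boundary_integral (facet_density c L P) g - 1/2 * (c * area_integral (\<lambda>x. \<zeta> x * g x)) = \<delta> * T g + S g"
    if g: "continuous_on \<Delta> g" for g
    unfolding bd[OF g] area\<zeta>[OF g] T_def S_def by (simp add: algebra_simps)
  have ext: "c * area_integral (\<lambda>x. \<zeta> x * A x) = 2 * boundary_integral (facet_density c L P) A" if A: "affine_fun A" for A
  proof -
    have "T A = 0" using ext1[OF A] by (simp add: T_def r1_def)
    moreover have "S A = 0" using area_side_extremal[OF A] by (simp add: S_def J_def)
    ultimately show ?thesis using main[OF affine_fun_continuous[OF A]] by simp
  qed
  have "futaki c \<Delta> L f = \<delta> * T f + S f"
    using futaki_eq[OF c L(1,2) \<zeta> ext cf] main[OF cf] by simp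
  also have "\<dots> < 0"
  proof -
    have "\<delta> * T f \<le> \<delta> * (\<bar>T f\<bar> + 1)" using \<delta> by (intro mult_left_mono) auto
    also have "\<dots> = - S f / 2" by (simp add: \<delta>_def field_simps)
    finally show ?thesis using Sneg by simp
  qed
  finally have "K_unstable c \<Delta> L" unfolding K_unstable_def using f by blast
  then show ?thesis using L(1) by blast
qed

end

section \<open>The stability dichotomy\<close>

theorem proposition6:
  fixes c :: real and \<Delta> :: "(real^2) set"
  assumes "c > 0" and "convex_quadrilateral \<Delta>"
  shows "(parallelogram \<Delta> \<longrightarrow> (\<forall>L. affine_normals \<Delta> L \<longrightarrow> K_polystable c \<Delta> L)) \<and>
         (\<not> parallelogram \<Delta> \<longrightarrow>
            (\<exists>L. affine_normals \<Delta> L \<and> K_polystable c \<Delta> L) \<and>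
            (\<exists>L. affine_normals \<Delta> L \<and> K_unstable c \<Delta> L))"
proof -
  obtain z0 e1 e2 p q where fq: "framed_quadrilateral \<Delta> z0 e1 e2 p q"
    and ext: "{x. x extreme_point_of \<Delta>} = {z0, z0 + e1, z0 + p *\<^sub>R e1 + q *\<^sub>R e2, z0 + e2}"
    and card: "card {x. x extreme_point_of \<Delta>} = 4"
    using convex_quadrilateral_framed[OF assms(2)] by blast
  interpret framed_quadrilateral \<Delta> z0 e1 e2 p q by (rule fq)
  note par = framed_parallelogram_iff[OF fq ext card]
  show ?thesis
  proof (intro conjI impI allI)
    fix L assume "parallelogram \<Delta>" and L: "affine_normals \<Delta> L"
    then have "framed_parallelogram \<Delta> z0 e1 e2"
      using fq par by (simp add: framed_parallelogram_def)
    then show "K_polystable c \<Delta> L"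
      using framed_parallelogram.parallelogram_K_polystable assms(1) L by blast
  next
    show "\<exists>L. affine_normals \<Delta> L \<and> K_polystable c \<Delta> L"
      by (rule K_polystable_normals_exist[OF assms(1)])
  next
    assume "\<not> parallelogram \<Delta>"
    then consider "p \<noteq> 1" | "q \<noteq> 1" using par by blast
    then show "\<exists>L. affine_normals \<Delta> L \<and> K_unstable c \<Delta> L"
    proof cases
      case 1 then show ?thesis by (rule K_unstable_normals_exist[OF _ assms(1)])
    next
      case 2 then show ?thesis
        by (rule framed_quadrilateral.K_unstable_normals_exist[OF framed_quadrilateral_swap[OF fq] _ assms(1)])
    qed
  qed
qed

end
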